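(* Let $R=\bigoplus_{n\ge 0}R_n$ be a finitely generated standard graded algebra over a Noetherian commutative ring $R_0$, let $M$ be a finitely generated graded $R$-module, and let $t\ge0$ be an integer. Let $z_1,\ldots,z_t$ be an $M$-filter-regular sequence of linear forms (elements of $R_1$). Let $Q_0=0$ and $Q_i=(z_1,\ldots,z_i)$ for $i=1,\ldots,t$. Then (a) $\operatorname{reg}_t(M)=\max\{a((Q_iM:R_+)/Q_iM)\mid i=0,\ldots,t\}$; (b) $a^*_t(M)=\max\{a((Q_iM:R_+)/Q_iM)-i\mid i=0,\ldots,t\}$.
   Context: Standard graded means $R$ is generated over $R_0$ by $R_1$; $R_+=\bigoplus_{n\ge1}R_n$. For a graded $R$-module $H$, $a(H)=\sup\{r\mid H_r\ne0\}$, with $a(0)=-\infty$. $H^i_{R_+}(M)$ is the $i$-th (graded) local cohomology module of $M$ with respect to $R_+$, and $a_i(M)=a(H^i_{R_+}(M))$. The partial regularities are $\operatorname{reg}_t(M)=\max\{a_i(M)+i\mid 0\le i\le t\}$ and $a^*_t(M)=\max\{a_i(M)\mid 0\le i\le t\}$. A homogeneous element $z\in R$ is $M$-filter-regular if $(0_M:z)_r=0$ for $r\gg0$, where $0_M:z=\{e\in M\mid ze=0\}$. A sequence $z_1,\ldots,z_t$ of homogeneous elements is an $M$-filter-regular sequence if $z_{i+1}$ is $M/Q_iM$-filter-regular for $i=0,\ldots,t-1$. $Q_iM:R_+=\{e\in M\mid R_+e\subseteq Q_iM\}$. *)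

theory Defs
  imports "HOL-Algebra.Algebra" "HOL-Library.Extended_Real"
begin

section \<open>Graded rings and graded modules\<close>

record 'a graded_ring = "'a ring" +
  rdeg :: "nat \<Rightarrow> 'a set"

record ('a, 'm) graded_module = "('a, 'm) module" +
  mdeg :: "int \<Rightarrow> 'm set"

definition direct_sum_decomp :: "('m, 'z) ring_scheme \<Rightarrow> ('i \<Rightarrow> 'm set) \<Rightarrow> bool" where
  "direct_sum_decomp G C \<longleftrightarrow>
     (\<forall>n. subgroup (C n) (add_monoid G)) \<and>
     (\<forall>x\<in>carrier G. \<exists>!c. (\<forall>n. c n \<in> C n) \<and> finite {n. c n \<noteq> \<zero>\<^bsub>G\<^esub>} \<and>
        x = (\<Oplus>\<^bsub>G\<^esub>n\<in>{n. c n \<noteq> \<zero>\<^bsub>G\<^esub>}. c n))"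

definition graded_cring :: "('a, 'z) graded_ring_scheme \<Rightarrow> bool" where
  "graded_cring R \<longleftrightarrow> cring R \<and> direct_sum_decomp R (rdeg R) \<and> \<one>\<^bsub>R\<^esub> \<in> rdeg R 0 \<and>
     (\<forall>m n. \<forall>a\<in>rdeg R m. \<forall>b\<in>rdeg R n. a \<otimes>\<^bsub>R\<^esub> b \<in> rdeg R (m + n))"

definition is_graded_module ::
  "('a, 'z) graded_ring_scheme \<Rightarrow> ('a, 'm, 'y) graded_module_scheme \<Rightarrow> bool" where
  "is_graded_module R M \<longleftrightarrow> module R M \<and> direct_sum_decomp M (mdeg M) \<and>
     (\<forall>n r. \<forall>a\<in>rdeg R n. \<forall>x\<in>mdeg M r. a \<odot>\<^bsub>M\<^esub> x \<in> mdeg M (int n + r))"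

definition fin_gen_algebra_over_degree_zero :: "('a, 'z) graded_ring_scheme \<Rightarrow> bool" where
  "fin_gen_algebra_over_degree_zero R \<longleftrightarrow>
     (\<exists>S. finite S \<and> S \<subseteq> carrier R \<and> generate_ring R (rdeg R 0 \<union> S) = carrier R)"

definition standard_graded :: "('a, 'z) graded_ring_scheme \<Rightarrow> bool" where
  "standard_graded R \<longleftrightarrow> generate_ring R (rdeg R 0 \<union> rdeg R 1) = carrier R"

text \<open>The ideal \<open>R\<^sub>+\<close>: all finite sums of elements of positive degree.\<close>
definition irrelevant_ideal :: "('a, 'z) graded_ring_scheme \<Rightarrow> 'a set" where
  "irrelevant_ideal R =
     {(\<Oplus>\<^bsub>R\<^esub>n\<in>F. c n) | F c. finite F \<and> F \<subseteq> {1..} \<and> (\<forall>n\<in>F. c n \<in> rdeg R n)}"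


section \<open>Submodules and quotients\<close>

definition submodule_span ::
  "('a, 'z) ring_scheme \<Rightarrow> ('a, 'm, 'y) module_scheme \<Rightarrow> 'm set \<Rightarrow> 'm set" where
  "submodule_span R M S = \<Inter>{N. submodule N R M \<and> S \<subseteq> N}"

definition fin_gen_module ::
  "('a, 'z) ring_scheme \<Rightarrow> ('a, 'm, 'y) module_scheme \<Rightarrow> bool" where
  "fin_gen_module R M \<longleftrightarrow>
     (\<exists>S. finite S \<and> S \<subseteq> carrier M \<and> submodule_span R M S = carrier M)"

definition ideal_times_module ::
  "('a, 'z) ring_scheme \<Rightarrow> 'a set \<Rightarrow> ('a, 'm, 'y) module_scheme \<Rightarrow> 'm set" where
  "ideal_times_module R I M = submodule_span R M {q \<odot>\<^bsub>M\<^esub> e | q e. q \<in> I \<and> e \<in> carrier M}"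

definition colon :: "('a, 'm, 'y) module_scheme \<Rightarrow> 'm set \<Rightarrow> 'a set \<Rightarrow> 'm set" where
  "colon M N I = {e \<in> carrier M. \<forall>a\<in>I. a \<odot>\<^bsub>M\<^esub> e \<in> N}"

definition graded_sub :: "('a, 'm) graded_module \<Rightarrow> 'm set \<Rightarrow> ('a, 'm) graded_module" where
  "graded_sub M N = M\<lparr>carrier := N, mdeg := (\<lambda>r. mdeg M r \<inter> N)\<rparr>"

text \<open>The fields \<open>mult\<close> and \<open>one\<close>, which the record type of modules inherits from
  that of rings, play no role in a module.\<close>
definition graded_quot :: "('a, 'm) graded_module \<Rightarrow> 'm set \<Rightarrow> ('a, 'm set) graded_module" where
  "graded_quot M N =
     \<lparr>carrier = a_rcosets\<^bsub>M\<^esub> N, monoid.mult = (\<lambda>_ _. N), one = N, ring.zero = N, add = set_add M,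
      smult = (\<lambda>a C. \<Union>x\<in>C. N +>\<^bsub>M\<^esub> (a \<odot>\<^bsub>M\<^esub> x)),
      mdeg = (\<lambda>r. (\<lambda>x. N +>\<^bsub>M\<^esub> x) ` mdeg M r)\<rparr>"

text \<open>\<open>a(H)\<close>; the supremum of the empty set is \<open>-\<infinity>\<close>.\<close>
definition a_inv_module :: "('a, 'm) graded_module \<Rightarrow> ereal" where
  "a_inv_module H = Sup {ereal (of_int r) | r. mdeg H r \<noteq> {\<zero>\<^bsub>H\<^esub>}}"


section \<open>Filter-regular sequences\<close>

definition filter_regular ::
  "('a, 'z) graded_ring_scheme \<Rightarrow> ('a, 'm) graded_module \<Rightarrow> 'a \<Rightarrow> bool" where
  "filter_regular R M z \<longleftrightarrow> (\<exists>n. z \<in> rdeg R n) \<and>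
     (\<exists>r0. \<forall>r\<ge>r0. mdeg (graded_sub M {e \<in> carrier M. z \<odot>\<^bsub>M\<^esub> e = \<zero>\<^bsub>M\<^esub>}) r = {\<zero>\<^bsub>M\<^esub>})"

text \<open>\<open>Q\<^sub>i = (z\<^sub>1, \<dots>, z\<^sub>i)\<close>; for \<open>i = 0\<close> this is the ideal generated by
  the empty set, the zero ideal.\<close>
definition seq_ideal :: "('a, 'z) ring_scheme \<Rightarrow> (nat \<Rightarrow> 'a) \<Rightarrow> nat \<Rightarrow> 'a set" where
  "seq_ideal R z i = Idl\<^bsub>R\<^esub> (z ` {1..i})"

definition filter_regular_seq ::
  "('a, 'z) graded_ring_scheme \<Rightarrow> ('a, 'm) graded_module \<Rightarrow> (nat \<Rightarrow> 'a) \<Rightarrow> nat \<Rightarrow> bool" where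
  "filter_regular_seq R M z t \<longleftrightarrow>
     (\<forall>i<t. filter_regular R
              (graded_quot M (ideal_times_module R (seq_ideal R z i) M)) (z (Suc i)))"

text \<open>\<open>(Q\<^sub>i M : R\<^sub>+) / Q\<^sub>i M\<close>\<close>
definition colon_quot ::
  "('a, 'z) graded_ring_scheme \<Rightarrow> ('a, 'm) graded_module \<Rightarrow> (nat \<Rightarrow> 'a) \<Rightarrow> nat
     \<Rightarrow> ('a, 'm set) graded_module" where
  "colon_quot R M z i =
     (let N = ideal_times_module R (seq_ideal R z i) M
      in graded_quot (graded_sub M (colon M N (irrelevant_ideal R))) N)"


section \<open>Graded local cohomology\<close>

definition graded_hom ::
  "('a, 'z) graded_ring_scheme \<Rightarrow> ('a, 'm) graded_module \<Rightarrow> ('a, 'n) graded_module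
     \<Rightarrow> ('m \<Rightarrow> 'n) set" where
  "graded_hom R M N = {f. f \<in> carrier M \<rightarrow> carrier N \<and>
     (\<forall>x\<in>carrier M. \<forall>y\<in>carrier M. f (x \<oplus>\<^bsub>M\<^esub> y) = f x \<oplus>\<^bsub>N\<^esub> f y) \<and>
     (\<forall>a\<in>carrier R. \<forall>x\<in>carrier M. f (a \<odot>\<^bsub>M\<^esub> x) = a \<odot>\<^bsub>N\<^esub> f x) \<and>
     (\<forall>r. f ` mdeg M r \<subseteq> mdeg N r)}"

text \<open>Injective objects of the category of graded \<open>R\<close>-modules and homomorphisms of degree 0.
  A formula of HOL cannot quantify over all carrier types, so the test modules \<open>A\<close>, \<open>B\<close>
  live in the type \<^typ>\<open>'a \<times> 'e\<close>. This loses nothing: that type contains copies of all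
  shifts \<open>R(d)\<close> and their homogeneous ideals, so by Baer's criterion the extension
  property holds for test modules of every type as soon as it holds for these.\<close>
definition graded_injective ::
  "('a, 'z) graded_ring_scheme \<Rightarrow> ('a, 'e) graded_module \<Rightarrow> bool" where
  "graded_injective R E \<longleftrightarrow> is_graded_module R E \<and>
     (\<forall>(A :: ('a, 'a \<times> 'e) graded_module) (B :: ('a, 'a \<times> 'e) graded_module).
        \<forall>j \<in> graded_hom R A B. \<forall>f \<in> graded_hom R A E.
        is_graded_module R A \<longrightarrow> is_graded_module R B \<longrightarrow> inj_on j (carrier A) \<longrightarrow>
        (\<exists>g \<in> graded_hom R B E. \<forall>x\<in>carrier A. g (j x) = f x))"

text \<open>An exact sequence \<open>0 \<rightarrow> M \<rightarrow> E\<^sup>0 \<rightarrow> E\<^sup>1 \<rightarrow> \<dots>\<close> of graded modules and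
  homomorphisms of degree 0, with augmentation \<open>\<epsilon>\<close> and all \<open>E\<^sup>i\<close> injective.\<close>
definition graded_injective_resolution ::
  "('a, 'z) graded_ring_scheme \<Rightarrow> ('a, 'm) graded_module \<Rightarrow> ('m \<Rightarrow> 'e)
     \<Rightarrow> (nat \<Rightarrow> ('a, 'e) graded_module) \<Rightarrow> (nat \<Rightarrow> 'e \<Rightarrow> 'e) \<Rightarrow> bool" where
  "graded_injective_resolution R M \<epsilon> E d \<longleftrightarrow>
     (\<forall>i. graded_injective R (E i)) \<and>
     \<epsilon> \<in> graded_hom R M (E 0) \<and> (\<forall>i. d i \<in> graded_hom R (E i) (E (Suc i))) \<and>
     inj_on \<epsilon> (carrier M) \<and>
     \<epsilon> ` carrier M = a_kernel (E 0) (E 1) (d 0) \<and>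
     (\<forall>i. d i ` carrier (E i) = a_kernel (E (Suc i)) (E (Suc (Suc i))) (d (Suc i)))"

text \<open>The torsion functor \<open>\<Gamma>\<^sub>I(E)\<close>: the elements annihilated by some power of \<open>I\<close>.\<close>
definition torsion ::
  "('a, 'z) ring_scheme \<Rightarrow> 'a set \<Rightarrow> ('a, 'e, 'y) module_scheme \<Rightarrow> 'e set" where
  "torsion R I E =
     {e \<in> carrier E. \<exists>n::nat. \<forall>a \<in> I [^]\<^bsub>ideals_set R\<^esub> n. a \<odot>\<^bsub>E\<^esub> e = \<zero>\<^bsub>E\<^esub>}"

text \<open>The \<open>i\<close>-th right derived functor of \<open>\<Gamma>\<close> at \<open>R\<^sub>+\<close>, computed from the injective
  resolution \<open>(E, d)\<close>: the \<open>i\<close>-th cohomology of the complex \<open>\<Gamma>(E\<^sup>0) \<rightarrow> \<Gamma>(E\<^sup>1) \<rightarrow> \<dots>\<close>.\<close>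
definition local_cohomology ::
  "('a, 'z) graded_ring_scheme \<Rightarrow> (nat \<Rightarrow> ('a, 'e) graded_module) \<Rightarrow> (nat \<Rightarrow> 'e \<Rightarrow> 'e) \<Rightarrow> nat
     \<Rightarrow> ('a, 'e set) graded_module" where
  "local_cohomology R E d i =
     (let \<Gamma> = (\<lambda>k. torsion R (irrelevant_ideal R) (E k));
          Z = {e \<in> \<Gamma> i. d i e = \<zero>\<^bsub>E (Suc i)\<^esub>};
          B = (case i of 0 \<Rightarrow> {\<zero>\<^bsub>E 0\<^esub>} | Suc k \<Rightarrow> d k ` \<Gamma> k)
      in graded_quot (graded_sub (E i) Z) B)"

definition a_inv ::
  "('a, 'z) graded_ring_scheme \<Rightarrow> (nat \<Rightarrow> ('a, 'e) graded_module) \<Rightarrow> (nat \<Rightarrow> 'e \<Rightarrow> 'e) \<Rightarrow> nat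
     \<Rightarrow> ereal" where
  "a_inv R E d i = a_inv_module (local_cohomology R E d i)"

definition partial_reg ::
  "('a, 'z) graded_ring_scheme \<Rightarrow> (nat \<Rightarrow> ('a, 'e) graded_module) \<Rightarrow> (nat \<Rightarrow> 'e \<Rightarrow> 'e) \<Rightarrow> nat
     \<Rightarrow> ereal" where
  "partial_reg R E d t = (MAX i\<in>{0..t}. a_inv R E d i + ereal (real i))"

definition partial_a_star ::
  "('a, 'z) graded_ring_scheme \<Rightarrow> (nat \<Rightarrow> ('a, 'e) graded_module) \<Rightarrow> (nat \<Rightarrow> 'e \<Rightarrow> 'e) \<Rightarrow> nat
     \<Rightarrow> ereal" where
  "partial_a_star R E d t = (MAX i\<in>{0..t}. a_inv R E d i)"

end

theory Submission
  imports Defs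
begin

text \<open>
  Let \<open>E\<close> be the given injective resolution of \<open>M\<close> and \<open>D\<^sub>i\<close> the total complex of the Koszul
  complex of \<open>z\<^sub>1, \<dots>, z\<^sub>i\<close> on \<open>E\<close>, an iterated mapping cone. The long exact sequence of a cone
  of torsion complexes, together with the fact that every torsion class is killed by a power of
  \<open>z\<^sub>i\<^sub>+\<^sub>1\<close>, gives for \<open>h\<^sub>i\<^sub>,\<^sub>j = a(H\<^sup>j(\<Gamma>(D\<^sub>i)))\<close> the inequalities
  \<open>h\<^sub>i\<^sub>,\<^sub>j\<^sub>+\<^sub>1 + 1 \<le> h\<^sub>i\<^sub>+\<^sub>1\<^sub>,\<^sub>j \<le> max h\<^sub>i\<^sub>,\<^sub>j (h\<^sub>i\<^sub>,\<^sub>j\<^sub>+\<^sub>1 + 1)\<close>,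
  from which both formulas follow once \<open>h\<^sub>i\<^sub>,\<^sub>0\<close> is identified with \<open>a((Q\<^sub>i M : R\<^sub>+)/Q\<^sub>i M)\<close>.

  Filter-regularity says that in large internal degrees \<open>D\<^sub>i\<close> is exact except at \<open>0\<close>, where its
  cohomology is \<open>M/Q\<^sub>i M\<close>. As \<open>D\<^sub>i\<close> consists of injectives and is bounded below, its negative part
  splits in those degrees. This makes it possible to lift \<open>a \<mapsto> a s\<close> on \<open>R\<^bsub>\<ge>n\<^esub>\<close> through the
  differential, for \<open>s\<close> with \<open>R\<^bsub>\<ge>n\<^esub> s\<close> consisting of boundaries; by injectivity the lift is
  multiplication by some \<open>w\<close>, and \<open>s\<close> differs from the boundary of \<open>w\<close> by torsion. Hence
  \<open>H\<^sup>0(\<Gamma>(D\<^sub>i)) = \<Gamma>(M/Q\<^sub>i M)\<close>, whose largest degree is attained in the socle.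
\<close>

section \<open>Projections onto homogeneous components\<close>

text \<open>The obstacle is that z_{i+1} is a nonzerodivisor on M/Q_iM only in large degrees. An
  induction over the modules M/Q_iM would need a new injective resolution for each of them and
  control over the kernels of multiplication. The complexes D_i need neither: they are built from
  the one given resolution, and the kernels survive in them as cohomology in negative cohomological
  degrees, which vanishes in large internal degrees. The price is that degree 0 of the torsion
  cohomology has to be compared with M/Q_iM by hand.

  Two choices shape the details. \<open>graded_injective\<close> speaks of test modules of one fixed
  type, whereas the cones live in another one. Injectivity is therefore first turned into Baer's
  condition, which mentions only homogeneous ideals of R and maps from them; this condition passes
  to cones and gives back the extension property for modules of every type. Moreover all arguments
  about the complexes are carried out degree by degree on homogeneous elements, so that the cones
  never have to be decomposed into direct sums.\<close>

definition grading_projections ::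
  "('m, 'z) ring_scheme \<Rightarrow> ('i \<Rightarrow> 'm set) \<Rightarrow> ('i \<Rightarrow> 'm \<Rightarrow> 'm) \<Rightarrow> bool" where
  "grading_projections G C p \<longleftrightarrow>
     (\<forall>n. subgroup (C n) (add_monoid G)) \<and>
     (\<forall>x\<in>carrier G. \<forall>n. p n x \<in> C n) \<and>
     (\<forall>x\<in>carrier G. finite {n. p n x \<noteq> \<zero>\<^bsub>G\<^esub>}) \<and>
     (\<forall>x\<in>carrier G. \<forall>y\<in>carrier G. \<forall>n. p n (x \<oplus>\<^bsub>G\<^esub> y) = p n x \<oplus>\<^bsub>G\<^esub> p n y) \<and>
     (\<forall>n. \<forall>c\<in>C n. p n c = c \<and> (\<forall>m. m \<noteq> n \<longrightarrow> p m c = \<zero>\<^bsub>G\<^esub>)) \<and>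
     (\<forall>x\<in>carrier G. (\<forall>n. p n x = \<zero>\<^bsub>G\<^esub>) \<longrightarrow> x = \<zero>\<^bsub>G\<^esub>)"

context abelian_group
begin

lemma subgroup_addD:
  assumes "subgroup H (add_monoid G)"
  shows "H \<subseteq> carrier G" "\<zero> \<in> H" "x \<in> H \<Longrightarrow> y \<in> H \<Longrightarrow> x \<oplus> y \<in> H" "x \<in> H \<Longrightarrow> \<ominus> x \<in> H"
  using assms unfolding subgroup_def Ring.a_inv_def by auto

lemma decomp_unique:
  assumes "direct_sum_decomp G C" "\<And>n. c n \<in> C n" "\<And>n. c' n \<in> C n"
    "finite {n. c n \<noteq> \<zero>}" "finite {n. c' n \<noteq> \<zero>}"
    "(\<Oplus>n\<in>{n. c n \<noteq> \<zero>}. c n) = (\<Oplus>n\<in>{n. c' n \<noteq> \<zero>}. c' n)"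
  shows "c = c'"
proof -
  have C: "\<And>n. C n \<subseteq> carrier G"
    using assms(1) subgroup_addD(1) unfolding direct_sum_decomp_def by blast
  define x where "x = (\<Oplus>n\<in>{n. c n \<noteq> \<zero>}. c n)"
  have "x \<in> carrier G" unfolding x_def by (rule finsum_closed) (use assms(2) C in auto)
  then have "\<exists>!c. (\<forall>n. c n \<in> C n) \<and> finite {n. c n \<noteq> \<zero>} \<and> x = (\<Oplus>n\<in>{n. c n \<noteq> \<zero>}. c n)"
    using assms(1) unfolding direct_sum_decomp_def by blast
  moreover have "(\<forall>n. c n \<in> C n) \<and> finite {n. c n \<noteq> \<zero>} \<and> x = (\<Oplus>n\<in>{n. c n \<noteq> \<zero>}. c n)"
    using assms x_def by simp
  moreover have "(\<forall>n. c' n \<in> C n) \<and> finite {n. c' n \<noteq> \<zero>} \<and> x = (\<Oplus>n\<in>{n. c' n \<noteq> \<zero>}. c' n)"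
    using assms x_def by simp
  ultimately show ?thesis by blast
qed

lemma finsum_support:
  assumes "finite F" "\<And>n. c n \<in> carrier G" "\<And>n. n \<notin> F \<Longrightarrow> c n = \<zero>"
  shows "(\<Oplus>n\<in>{n. c n \<noteq> \<zero>}. c n) = (\<Oplus>n\<in>F. c n)"
  by (rule add.finprod_mono_neutral_cong_left) (use assms in auto)

text \<open>Uniqueness does the work: the termwise sum of two decompositions is the decomposition of
  the sum, which makes the projections additive, and the family concentrated in one index is the
  decomposition of a homogeneous element.\<close>

lemma grading_projections_exist:
  assumes D: "direct_sum_decomp G C"
  obtains p where "grading_projections G C p"
proof -
  have sub: "\<And>n. subgroup (C n) (add_monoid G)" using D unfolding direct_sum_decomp_def by blast
  note S = subgroup_addD[OF sub]
  have "\<forall>x. \<exists>c. x \<in> carrier G \<longrightarrow> (\<forall>n. c n \<in> C n) \<and> finite {n. c n \<noteq> \<zero>} \<and>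
        x = (\<Oplus>n\<in>{n. c n \<noteq> \<zero>}. c n)"
    using D unfolding direct_sum_decomp_def by meson
  then obtain q where q: "\<And>x. x \<in> carrier G \<Longrightarrow> (\<forall>n. q x n \<in> C n) \<and> finite {n. q x n \<noteq> \<zero>} \<and>
        x = (\<Oplus>n\<in>{n. q x n \<noteq> \<zero>}. q x n)" by metis
  have carr: "q x n \<in> carrier G" if "x \<in> carrier G" for x n using q[OF that] S(1) by blast
  have add: "q (x \<oplus> y) = (\<lambda>n. q x n \<oplus> q y n)" if x: "x \<in> carrier G" and y: "y \<in> carrier G" for x y
  proof (rule decomp_unique[OF D])
    have xy: "x \<oplus> y \<in> carrier G" using x y by simp
    show "q (x \<oplus> y) n \<in> C n" "q x n \<oplus> q y n \<in> C n" for n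
      using q[OF xy] q[OF x] q[OF y] S(3) by auto
    let ?F = "{n. q x n \<noteq> \<zero>} \<union> {n. q y n \<noteq> \<zero>}"
    have F: "finite ?F" using q[OF x] q[OF y] by blast
    show "finite {n. q (x \<oplus> y) n \<noteq> \<zero>}" using q[OF xy] by blast
    show "finite {n. q x n \<oplus> q y n \<noteq> \<zero>}" by (rule finite_subset[OF _ F]) auto
    have "(\<Oplus>n\<in>{n. q x n \<oplus> q y n \<noteq> \<zero>}. q x n \<oplus> q y n) = (\<Oplus>n\<in>?F. q x n \<oplus> q y n)"
      by (rule finsum_support[OF F]) (use carr x y in auto)
    also have "\<dots> = (\<Oplus>n\<in>?F. q x n) \<oplus> (\<Oplus>n\<in>?F. q y n)"
      by (rule finsum_addf) (use carr x y in auto)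
    also have "(\<Oplus>n\<in>?F. q x n) = (\<Oplus>n\<in>{n. q x n \<noteq> \<zero>}. q x n)"
      by (rule finsum_support[symmetric, OF F]) (use carr x y in auto)
    also have "\<dots> = x" using q[OF x] by simp
    also have "(\<Oplus>n\<in>?F. q y n) = (\<Oplus>n\<in>{n. q y n \<noteq> \<zero>}. q y n)"
      by (rule finsum_support[symmetric, OF F]) (use carr x y in auto)
    also have "\<dots> = y" using q[OF y] by simp
    finally show "(\<Oplus>n\<in>{n. q (x \<oplus> y) n \<noteq> \<zero>}. q (x \<oplus> y) n) =
        (\<Oplus>n\<in>{n. q x n \<oplus> q y n \<noteq> \<zero>}. q x n \<oplus> q y n)" using q[OF xy] by simp
  qed
  have hom: "q c = (\<lambda>m. if m = n then c else \<zero>)" if c: "c \<in> C n" for c n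
  proof (rule decomp_unique[OF D])
    have cc: "c \<in> carrier G" using c S(1) by blast
    show "q c m \<in> C m" "(if m = n then c else \<zero>) \<in> C m" for m using q[OF cc] c S(2) by auto
    show "finite {m. q c m \<noteq> \<zero>}" using q[OF cc] by blast
    show "finite {m. (if m = n then c else \<zero>) \<noteq> \<zero>}" by (rule finite_subset[of _ "{n}"]) auto
    have "(\<Oplus>m\<in>{m. (if m = n then c else \<zero>) \<noteq> \<zero>}. if m = n then c else \<zero>)
        = (\<Oplus>m\<in>{n}. if m = n then c else \<zero>)"
      by (rule finsum_support) (use cc in auto)
    also have "\<dots> = c" using cc by simp
    finally show "(\<Oplus>m\<in>{m. q c m \<noteq> \<zero>}. q c m) =
       (\<Oplus>m\<in>{m. (if m = n then c else \<zero>) \<noteq> \<zero>}. if m = n then c else \<zero>)" using q[OF cc] by simp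
  qed
  have faith: "x = \<zero>" if x: "x \<in> carrier G" and "\<forall>n. q x n = \<zero>" for x
  proof -
    have "x = (\<Oplus>n\<in>{n. q x n \<noteq> \<zero>}. q x n)" using q[OF x] by blast
    then show ?thesis using that by simp
  qed
  have "grading_projections G C (\<lambda>n x. q x n)"
    unfolding grading_projections_def
    by (intro conjI ballI allI impI) (use sub q add hom faith in \<open>auto\<close>)
  then show thesis by (rule that)
qed

context
  fixes C :: "'i \<Rightarrow> 'a set" and p :: "'i \<Rightarrow> 'a \<Rightarrow> 'a"
  assumes gp: "grading_projections G C p"
begin

lemma gp_sub: "subgroup (C n) (add_monoid G)"
  using gp unfolding grading_projections_def by blast

lemmas gp_C = subgroup_addD[OF gp_sub]

lemma gp_proj: "x \<in> carrier G \<Longrightarrow> p n x \<in> C n"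
  and gp_fin: "x \<in> carrier G \<Longrightarrow> finite {n. p n x \<noteq> \<zero>}"
  and gp_add: "x \<in> carrier G \<Longrightarrow> y \<in> carrier G \<Longrightarrow> p n (x \<oplus> y) = p n x \<oplus> p n y"
  and gp_same: "c \<in> C n \<Longrightarrow> p n c = c"
  and gp_other: "c \<in> C n \<Longrightarrow> m \<noteq> n \<Longrightarrow> p m c = \<zero>"
  and gp_faith: "x \<in> carrier G \<Longrightarrow> (\<And>n. p n x = \<zero>) \<Longrightarrow> x = \<zero>"
  using gp unfolding grading_projections_def by blast+

lemma gp_carr: "x \<in> carrier G \<Longrightarrow> p n x \<in> carrier G"
  using gp_proj gp_C(1) by blast

lemma gp_zero: "p n \<zero> = \<zero>"
  using gp_same[OF gp_C(2)] .

lemma gp_minus: "x \<in> carrier G \<Longrightarrow> p n (\<ominus> x) = \<ominus> p n x"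
  by (metis a_inv_closed gp_add gp_carr gp_zero minus_equality l_neg)

lemma gp_finsum:
  assumes "finite F" "\<And>n. n \<in> F \<Longrightarrow> c n \<in> C n"
  shows "p m (\<Oplus>n\<in>F. c n) = (if m \<in> F then c m else \<zero>)"
  using assms
proof (induction F rule: finite_induct)
  case empty
  then show ?case by (simp add: gp_zero)
next
  case (insert n F)
  have c: "c n \<in> carrier G" "c \<in> F \<rightarrow> carrier G" using insert.prems gp_C(1) by auto
  have "p m (\<Oplus>n\<in>insert n F. c n) = p m (c n) \<oplus> p m (\<Oplus>n\<in>F. c n)"
    using c insert.hyps by (simp add: gp_add)
  moreover have "c n \<in> C n" using insert by blast
  moreover have "m \<in> F \<Longrightarrow> c m \<in> carrier G" using c by auto
  ultimately show ?case using insert c gp_same[of "c n" n] gp_other[of "c n" n m]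
    by (cases "m = n") (auto simp: insert.IH)
qed

text \<open>\<open>grading_projections\<close> only demands that an element with vanishing
  projections is zero. Applied to the difference of the two sides, this recovers the
  decomposition.\<close>

lemma gp_sum:
  assumes "x \<in> carrier G"
  shows "x = (\<Oplus>n\<in>{n. p n x \<noteq> \<zero>}. p n x)"
proof -
  let ?y = "\<Oplus>n\<in>{n. p n x \<noteq> \<zero>}. p n x"
  have y: "?y \<in> carrier G" by (rule finsum_closed) (use gp_carr assms in auto)
  have "p m (x \<oplus> \<ominus> ?y) = \<zero>" for m
    using gp_finsum[OF gp_fin[OF assms], of "\<lambda>n. p n x" m] gp_proj[OF assms] assms y gp_carr
    by (auto simp: gp_add gp_minus r_neg)
  then have "x \<oplus> \<ominus> ?y = \<zero>" using gp_faith assms y by simp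
  then show ?thesis using assms y
    by (metis a_inv_closed minus_equality minus_minus)
qed

text \<open>The base case concerns only the components of the given x, so it may exploit what is
  known about them, for example that they lie in a given homogeneous ideal.\<close>

lemma gp_induct:
  assumes x: "x \<in> carrier G" and P: "\<And>n. P (p n x)" and P0: "P \<zero>"
    and Pa: "\<And>u v. u \<in> carrier G \<Longrightarrow> v \<in> carrier G \<Longrightarrow> P u \<Longrightarrow> P v \<Longrightarrow> P (u \<oplus> v)"
  shows "P x"
proof -
  have "finite F \<Longrightarrow> P (\<Oplus>n\<in>F. p n x)" for F
  proof (induction F rule: finite_induct)
    case (insert n F)
    have "(\<lambda>n. p n x) \<in> F \<rightarrow> carrier G" using x gp_carr by auto
    then show ?case using insert P Pa gp_carr[OF x] by (simp add: finsum_closed)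
  qed (simp add: P0)
  then show ?thesis using gp_sum[OF x] gp_fin[OF x] by metis
qed

text \<open>Converse of \<open>grading_projections_exist\<close>; through it the test modules for
  injectivity are shown to be graded.\<close>

lemma decomp_of_projections: "direct_sum_decomp G C"
  unfolding direct_sum_decomp_def
proof (intro conjI allI ballI)
  fix x assume x: "x \<in> carrier G"
  show "\<exists>!c. (\<forall>n. c n \<in> C n) \<and> finite {n. c n \<noteq> \<zero>} \<and> x = (\<Oplus>n\<in>{n. c n \<noteq> \<zero>}. c n)"
  proof (rule ex1I[of _ "\<lambda>n. p n x"])
    show "(\<forall>n. p n x \<in> C n) \<and> finite {n. p n x \<noteq> \<zero>} \<and> x = (\<Oplus>n\<in>{n. p n x \<noteq> \<zero>}. p n x)"
      using gp_proj gp_fin gp_sum x by blast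
    fix c assume c: "(\<forall>n. c n \<in> C n) \<and> finite {n. c n \<noteq> \<zero>} \<and> x = (\<Oplus>n\<in>{n. c n \<noteq> \<zero>}. c n)"
    show "c = (\<lambda>n. p n x)"
    proof
      fix m
      have "p m x = p m (\<Oplus>n\<in>{n. c n \<noteq> \<zero>}. c n)" using c by simp
      also have "\<dots> = c m" using c by (subst gp_finsum) auto
      finally show "c m = p m x" by simp
    qed
  qed
qed (rule gp_sub)

end

end

section \<open>Baer's criterion for graded injective modules\<close>

text \<open>Components of R are indexed by natural numbers, those of modules by integers. With zeros
  in negative degrees, the shift R(-r) has the components \<open>zdeg R (k - r)\<close>.\<close>

definition zdeg :: "'a graded_ring \<Rightarrow> int \<Rightarrow> 'a set" where
  "zdeg R k = (if k < 0 then {\<zero>\<^bsub>R\<^esub>} else rdeg R (nat k))"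

text \<open>The direct sum requirement is dropped: only homogeneous elements matter below.\<close>
definition pregraded ::
  "'a graded_ring \<Rightarrow> ('a, 'x) graded_module \<Rightarrow> bool" where
  "pregraded R U \<longleftrightarrow> module R U \<and> (\<forall>r. subgroup (mdeg U r) (add_monoid U)) \<and>
     (\<forall>n r. \<forall>a\<in>rdeg R n. \<forall>x\<in>mdeg U r. a \<odot>\<^bsub>U\<^esub> x \<in> mdeg U (int n + r))"

text \<open>A homomorphism of degree 0 from the graded submodule of \<open>U\<close> with components \<open>S r\<close> to \<open>Y\<close>,
  given on homogeneous elements only.\<close>
definition partial_hom ::
  "'a graded_ring \<Rightarrow> ('a, 'x) graded_module \<Rightarrow> ('a, 'y) graded_module
     \<Rightarrow> (int \<Rightarrow> 'x set) \<Rightarrow> (int \<Rightarrow> 'x \<Rightarrow> 'y) \<Rightarrow> bool" where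
  "partial_hom R U Y S f \<longleftrightarrow> (\<forall>r.
     S r \<subseteq> mdeg U r \<and> \<zero>\<^bsub>U\<^esub> \<in> S r \<and>
     (\<forall>x\<in>S r. f r x \<in> mdeg Y r) \<and>
     (\<forall>x\<in>S r. \<forall>y\<in>S r. x \<oplus>\<^bsub>U\<^esub> y \<in> S r \<and> f r (x \<oplus>\<^bsub>U\<^esub> y) = f r x \<oplus>\<^bsub>Y\<^esub> f r y) \<and>
     (\<forall>n. \<forall>a\<in>rdeg R n. \<forall>x\<in>S r. a \<odot>\<^bsub>U\<^esub> x \<in> S (int n + r) \<and>
        f (int n + r) (a \<odot>\<^bsub>U\<^esub> x) = a \<odot>\<^bsub>Y\<^esub> f r x))"

text \<open>A homomorphism of degree 0 from a homogeneous ideal \<open>I\<close> of \<open>R(-r)\<close> to \<open>Y\<close>.\<close>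
definition ideal_hom ::
  "'a graded_ring \<Rightarrow> ('a, 'y) graded_module \<Rightarrow> int \<Rightarrow> (int \<Rightarrow> 'a set) \<Rightarrow> (int \<Rightarrow> 'a \<Rightarrow> 'y) \<Rightarrow> bool" where
  "ideal_hom R Y r I \<phi> \<longleftrightarrow> (\<forall>k.
      I k \<subseteq> zdeg R (k - r) \<and> \<zero>\<^bsub>R\<^esub> \<in> I k \<and>
      (\<forall>a\<in>I k. \<phi> k a \<in> mdeg Y k) \<and>
      (\<forall>a\<in>I k. \<forall>b\<in>I k. a \<oplus>\<^bsub>R\<^esub> b \<in> I k \<and> \<phi> k (a \<oplus>\<^bsub>R\<^esub> b) = \<phi> k a \<oplus>\<^bsub>Y\<^esub> \<phi> k b) \<and>
      (\<forall>n. \<forall>b\<in>rdeg R n. \<forall>a\<in>I k. b \<otimes>\<^bsub>R\<^esub> a \<in> I (int n + k) \<and>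
         \<phi> (int n + k) (b \<otimes>\<^bsub>R\<^esub> a) = b \<odot>\<^bsub>Y\<^esub> \<phi> k a))"

text \<open>No test module occurs here, hence no carrier type for one. The element y has degree r
  because 1 has degree r in R(-r).\<close>

definition baer_injective :: "'a graded_ring \<Rightarrow> ('a, 'y) graded_module \<Rightarrow> bool" where
  "baer_injective R Y \<longleftrightarrow> (\<forall>r I \<phi>. ideal_hom R Y r I \<phi> \<longrightarrow>
     (\<exists>y\<in>mdeg Y r. \<forall>k. \<forall>a\<in>I k. \<phi> k a = a \<odot>\<^bsub>Y\<^esub> y))"

lemma baer_injectiveD:
  assumes "baer_injective R Y" "ideal_hom R Y r I \<phi>"
  shows "\<exists>y\<in>mdeg Y r. \<forall>k. \<forall>a\<in>I k. \<phi> k a = a \<odot>\<^bsub>Y\<^esub> y"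
  using assms unfolding baer_injective_def by blast

lemma ideal_homD:
  assumes "ideal_hom R Y r I \<phi>"
  shows "I k \<subseteq> zdeg R (k - r)" "\<zero>\<^bsub>R\<^esub> \<in> I k"
    "a \<in> I k \<Longrightarrow> b \<in> I k \<Longrightarrow> a \<oplus>\<^bsub>R\<^esub> b \<in> I k"
    "b \<in> rdeg R n \<Longrightarrow> a \<in> I k \<Longrightarrow> b \<otimes>\<^bsub>R\<^esub> a \<in> I (int n + k)"
    "a \<in> I k \<Longrightarrow> \<phi> k a \<in> mdeg Y k"
    "a \<in> I k \<Longrightarrow> b \<in> I k \<Longrightarrow> \<phi> k (a \<oplus>\<^bsub>R\<^esub> b) = \<phi> k a \<oplus>\<^bsub>Y\<^esub> \<phi> k b"
    "b \<in> rdeg R n \<Longrightarrow> a \<in> I k \<Longrightarrow> \<phi> (int n + k) (b \<otimes>\<^bsub>R\<^esub> a) = b \<odot>\<^bsub>Y\<^esub> \<phi> k a"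
  using assms unfolding ideal_hom_def by blast+

lemma partial_homD:
  assumes "partial_hom R U Y S f"
  shows "x \<in> S r \<Longrightarrow> x \<in> mdeg U r" "\<zero>\<^bsub>U\<^esub> \<in> S r"
    "x \<in> S r \<Longrightarrow> y \<in> S r \<Longrightarrow> x \<oplus>\<^bsub>U\<^esub> y \<in> S r"
    "a \<in> rdeg R n \<Longrightarrow> x \<in> S r \<Longrightarrow> a \<odot>\<^bsub>U\<^esub> x \<in> S (int n + r)"
    "x \<in> S r \<Longrightarrow> f r x \<in> mdeg Y r"
    "x \<in> S r \<Longrightarrow> y \<in> S r \<Longrightarrow> f r (x \<oplus>\<^bsub>U\<^esub> y) = f r x \<oplus>\<^bsub>Y\<^esub> f r y"
    "a \<in> rdeg R n \<Longrightarrow> x \<in> S r \<Longrightarrow> f (int n + r) (a \<odot>\<^bsub>U\<^esub> x) = a \<odot>\<^bsub>Y\<^esub> f r x"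
  using assms unfolding partial_hom_def by blast+

lemma is_graded_module_pregraded: "is_graded_module R U \<Longrightarrow> pregraded R U"
  unfolding is_graded_module_def pregraded_def direct_sum_decomp_def by blast

section \<open>Components of a graded ring and homogeneous induction\<close>

locale graded_ring_base =
  fixes R :: "'a graded_ring" (structure)
  assumes graded: "graded_cring R"

sublocale graded_ring_base \<subseteq> cring R
  using graded unfolding graded_cring_def by blast

context graded_ring_base
begin

lemma rdeg_sub: "subgroup (rdeg R n) (add_monoid R)"
  using graded unfolding graded_cring_def direct_sum_decomp_def by blast

lemmas rdeg_add_simps = subgroup_addD[OF rdeg_sub]

lemma rdeg_carr [intro]: "a \<in> rdeg R n \<Longrightarrow> a \<in> carrier R"
  using rdeg_add_simps(1) by blast

lemma rdeg_one: "\<one> \<in> rdeg R 0"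
  and rdeg_mult: "a \<in> rdeg R m \<Longrightarrow> b \<in> rdeg R n \<Longrightarrow> a \<otimes> b \<in> rdeg R (m + n)"
  using graded unfolding graded_cring_def by blast+

lemma zdeg_sub: "subgroup (zdeg R k) (add_monoid R)"
proof -
  have "subgroup {\<zero>} (add_monoid R)" using add.triv_subgroup by simp
  then show ?thesis using rdeg_sub by (simp add: zdeg_def)
qed

lemmas zdeg_add_simps = subgroup_addD[OF zdeg_sub]

lemma zdeg_carr [intro]: "a \<in> zdeg R n \<Longrightarrow> a \<in> carrier R"
  using zdeg_add_simps(1) by blast

lemma zdeg_int: "zdeg R (int n) = rdeg R n"
  by (simp add: zdeg_def)

lemma zdeg_mult: "a \<in> rdeg R n \<Longrightarrow> b \<in> zdeg R k \<Longrightarrow> a \<otimes> b \<in> zdeg R (int n + k)"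
proof (cases "k < 0")
  case True
  assume "a \<in> rdeg R n" "b \<in> zdeg R k"
  then have "a \<otimes> b = \<zero>" using True rdeg_carr by (auto simp: zdeg_def)
  then show ?thesis using zdeg_add_simps(2) by simp
next
  case False
  assume "a \<in> rdeg R n" "b \<in> zdeg R k"
  then show ?thesis using False rdeg_mult[of a n b "nat k"] by (simp add: zdeg_def nat_add_distrib)
qed

lemma zdeg_projections:
  obtains p where "grading_projections R (zdeg R) p"
proof -
  have "direct_sum_decomp R (rdeg R)" using graded unfolding graded_cring_def by blast
  then obtain p where p: "grading_projections R (rdeg R) p"
    using grading_projections_exist by blast
  note P = gp_proj[OF p] gp_fin[OF p] gp_add[OF p] gp_same[OF p] gp_other[OF p] gp_faith[OF p]
    gp_carr[OF p] gp_zero[OF p]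
  define q where "q = (\<lambda>k x. if k < 0 then \<zero> else p (nat k) x)"
  have "grading_projections R (zdeg R) q"
    unfolding grading_projections_def
  proof (intro conjI ballI allI impI)
    fix x assume x: "x \<in> carrier R"
    have "{n. q n x \<noteq> \<zero>} \<subseteq> int ` {n. p n x \<noteq> \<zero>}"
    proof
      fix n assume "n \<in> {n. q n x \<noteq> \<zero>}"
      then have "n = int (nat n)" "nat n \<in> {n. p n x \<noteq> \<zero>}" by (auto simp: q_def split: if_splits)
      then show "n \<in> int ` {n. p n x \<noteq> \<zero>}" by (rule image_eqI)
    qed
    then show "finite {n. q n x \<noteq> \<zero>}" using P(2)[OF x] finite_surj by blast
    show "x = \<zero>" if "\<forall>n. q n x = \<zero>"
    proof (rule P(6)[OF x])
      show "p n x = \<zero>" for n using that[rule_format, of "int n"] by (simp add: q_def)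
    qed
  next
    fix m n :: int and c assume c: "c \<in> zdeg R n" and "m \<noteq> n"
    then show "q m c = \<zero>" using P(5)[of c "nat n" "nat m"] P(8)
      by (auto simp: q_def zdeg_def split: if_splits)
  qed (use zdeg_sub P(1,3,4) in \<open>auto simp: q_def zdeg_def\<close>)
  then show thesis by (rule that)
qed

lemma homogeneous_induct [consumes 1, case_names hom add]:
  assumes x: "x \<in> carrier R" and Q: "\<And>n a. a \<in> rdeg R n \<Longrightarrow> P a"
    and Qa: "\<And>u v. u \<in> carrier R \<Longrightarrow> v \<in> carrier R \<Longrightarrow> P u \<Longrightarrow> P v \<Longrightarrow> P (u \<oplus> v)"
  shows "P x"
proof -
  obtain p where p: "grading_projections R (zdeg R) p" by (rule zdeg_projections)
  show ?thesis
  proof (rule gp_induct[OF p x])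
    show "P \<zero>" using Q rdeg_add_simps(2) by blast
    then show "P (p n x)" for n
      using gp_proj[OF p x, of n] Q by (auto simp: zdeg_def split: if_splits)
  qed (rule Qa)
qed

lemma pregradedD:
  assumes "pregraded R U"
  shows "module R U" "subgroup (mdeg U r) (add_monoid U)" "mdeg U r \<subseteq> carrier U"
    "\<zero>\<^bsub>U\<^esub> \<in> mdeg U r" "x \<in> mdeg U r \<Longrightarrow> y \<in> mdeg U r \<Longrightarrow> x \<oplus>\<^bsub>U\<^esub> y \<in> mdeg U r"
    "x \<in> mdeg U r \<Longrightarrow> \<ominus>\<^bsub>U\<^esub> x \<in> mdeg U r"
    "a \<in> rdeg R n \<Longrightarrow> x \<in> mdeg U r \<Longrightarrow> a \<odot>\<^bsub>U\<^esub> x \<in> mdeg U (int n + r)"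
    "abelian_group U"
    "x \<in> mdeg U r \<Longrightarrow> x \<in> carrier U"
proof -
  show m: "module R U" using assms unfolding pregraded_def by blast
  then interpret U: module R U .
  show s: "subgroup (mdeg U r) (add_monoid U)" for r using assms unfolding pregraded_def by blast
  note S = U.M.subgroup_addD[OF s]
  show "mdeg U r \<subseteq> carrier U"
    "\<zero>\<^bsub>U\<^esub> \<in> mdeg U r" "x \<in> mdeg U r \<Longrightarrow> y \<in> mdeg U r \<Longrightarrow> x \<oplus>\<^bsub>U\<^esub> y \<in> mdeg U r"
    "x \<in> mdeg U r \<Longrightarrow> \<ominus>\<^bsub>U\<^esub> x \<in> mdeg U r" "x \<in> mdeg U r \<Longrightarrow> x \<in> carrier U"
    using S by blast+
  show "a \<in> rdeg R n \<Longrightarrow> x \<in> mdeg U r \<Longrightarrow> a \<odot>\<^bsub>U\<^esub> x \<in> mdeg U (int n + r)"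
    using assms unfolding pregraded_def by blast
  show "abelian_group U" by (rule U.M.abelian_group_axioms)
qed

text \<open>An ideal S is made into a module on pairs by attaching a constant c, since
  \<open>graded_injective\<close> admits only test modules on a product type. The sets
  \<open>C k\<close> are the components of S, while \<open>C0\<close> and \<open>p\<close> belong to
  the ambient ring, whose grading may be shifted.\<close>

lemma test_module_graded:
  fixes c :: 'e
  defines "T \<equiv> \<lambda>S C. \<lparr>carrier = S \<times> {c}, monoid.mult = (\<lambda>_ _. (\<zero>, c)), one = (\<zero>, c),
      ring.zero = (\<zero>, c), add = (\<lambda>u v. (fst u \<oplus> fst v, c)), smult = (\<lambda>a u. (a \<otimes> fst u, c)),
      mdeg = (\<lambda>k. C k \<times> {c})\<rparr>"
  assumes p: "grading_projections R C0 p" and S: "ideal S R"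
    and C: "\<And>k::int. subgroup (C k) (add_monoid R)" "\<And>k. C k \<subseteq> C0 k" "\<And>k. C k \<subseteq> S"
      "\<And>x k. x \<in> S \<Longrightarrow> p k x \<in> C k"
      "\<And>n k a x. a \<in> rdeg R n \<Longrightarrow> x \<in> C k \<Longrightarrow> a \<otimes> x \<in> C (int n + k)"
  shows "is_graded_module R (T S C :: ('a, 'a \<times> 'e) graded_module)"
proof -
  interpret S: ideal S R by (rule S)
  let ?T = "T S C"
  have Sc: "x \<in> S \<Longrightarrow> x \<in> carrier R" for x by (rule S.Icarr)
  have ab: "abelian_group ?T"
  proof (rule abelian_groupI)
    fix x assume "x \<in> carrier ?T"
    then show "\<exists>y\<in>carrier ?T. y \<oplus>\<^bsub>?T\<^esub> x = \<zero>\<^bsub>?T\<^esub>"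
      by (intro bexI[of _ "(\<ominus> fst x, c)"]) (auto simp: T_def Sc l_neg S.a_inv_closed)
  qed (auto simp: T_def Sc a_ac S.a_closed S.zero_closed)
  have mod: "module R ?T"
    by (rule moduleI[OF is_cring ab])
      (auto simp: T_def Sc l_distr r_distr m_assoc S.I_l_closed)
  interpret T: abelian_group ?T by (rule ab)
  note P = gp_proj[OF p] gp_fin[OF p] gp_add[OF p] gp_same[OF p] gp_other[OF p] gp_faith[OF p]
    gp_carr[OF p] gp_zero[OF p]
  note CC = subgroup_addD[OF C(1)]
  have "grading_projections ?T (mdeg ?T) (\<lambda>k u. (p k (fst u), c))"
    unfolding grading_projections_def
  proof (intro conjI ballI allI impI)
    fix n :: int
    show "subgroup (mdeg ?T n) (add_monoid ?T)"
    proof (rule T.add.subgroupI)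
      fix a assume a: "a \<in> mdeg ?T n"
      have "\<ominus>\<^bsub>?T\<^esub> a = (\<ominus> fst a, c)"
        by (rule T.minus_equality) (use a C(3) in \<open>auto simp: T_def Sc l_neg S.a_inv_closed subset_iff\<close>)
      then show "\<ominus>\<^bsub>?T\<^esub> a \<in> mdeg ?T n" using a CC by (auto simp: T_def)
    qed (use CC(2)[of n] CC(3)[of _ n] C(3)[of n] in \<open>auto simp: T_def\<close>)
  next
    fix x assume x: "x \<in> carrier ?T"
    have "finite {n. p n (fst x) \<noteq> \<zero>}" using P(2)[of "fst x"] x Sc by (auto simp: T_def)
    then show "finite {n. (p n (fst x), c) \<noteq> \<zero>\<^bsub>?T\<^esub>}" by (simp add: T_def)
    show "(p n (fst x), c) \<in> mdeg ?T n" for n using x C(4) by (auto simp: T_def)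
    show "x = \<zero>\<^bsub>?T\<^esub>" if "\<forall>n. (p n (fst x), c) = \<zero>\<^bsub>?T\<^esub>"
      using that P(6)[of "fst x"] x Sc by (auto simp: T_def)
    fix y n assume y: "y \<in> carrier ?T"
    show "(p n (fst (x \<oplus>\<^bsub>?T\<^esub> y)), c) = (p n (fst x), c) \<oplus>\<^bsub>?T\<^esub> (p n (fst y), c)"
      using x y P(3) Sc by (auto simp: T_def)
  next
    fix n d assume d: "d \<in> mdeg ?T n"
    then have "fst d \<in> C0 n" using C(2)[of n] by (auto simp: T_def)
    then show "(p n (fst d), c) = d" using P(4) d by (auto simp: T_def)
    show "(p m (fst d), c) = \<zero>\<^bsub>?T\<^esub>" if "m \<noteq> n" for m
      using P(5)[OF \<open>fst d \<in> C0 n\<close> that] by (simp add: T_def)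
  qed
  then have "direct_sum_decomp ?T (mdeg ?T)" by (rule T.decomp_of_projections)
  then show ?thesis using mod C(5) unfolding is_graded_module_def by (auto simp: T_def)
qed

text \<open>The degreewise data are glued to one homomorphism on the ideal with components
  \<open>I k\<close>. It extends to all of R(-r), and the value of the extension at 1 is the
  required element.\<close>

lemma graded_injective_baer:
  fixes Y :: "('a, 'y) graded_module"
  assumes inj: "graded_injective R Y"
  shows "baer_injective R Y"
  unfolding baer_injective_def
proof (intro allI impI)
  fix r :: int and I :: "int \<Rightarrow> 'a set" and \<phi> :: "int \<Rightarrow> 'a \<Rightarrow> 'y"
  assume A: "ideal_hom R Y r I \<phi>"
  note I = ideal_homD(1-4)[OF A] and phi = ideal_homD(5-7)[OF A]
  have gY: "is_graded_module R Y" using inj unfolding graded_injective_def by blast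
  note Y = pregradedD[OF is_graded_module_pregraded[OF gY]]
  interpret Y: module R Y by (rule Y(1))
  obtain p0 where p0: "grading_projections R (zdeg R) p0" by (rule zdeg_projections)
  \<comment> \<open>The grading of R(-r), in which 1 has degree r.\<close>
  define p where "p = (\<lambda>k. p0 (k - r))"
  define Z where "Z = (\<lambda>k. zdeg R (k - r))"
  have p: "grading_projections R Z p"
    unfolding grading_projections_def
  proof (intro conjI ballI allI impI)
    fix x assume x: "x \<in> carrier R"
    have "{n. p n x \<noteq> \<zero>} \<subseteq> (\<lambda>n. n + r) ` {n. p0 n x \<noteq> \<zero>}"
    proof
      fix n assume "n \<in> {n. p n x \<noteq> \<zero>}"
      then have "n - r \<in> {n. p0 n x \<noteq> \<zero>}" by (simp add: p_def)
      then show "n \<in> (\<lambda>n. n + r) ` {n. p0 n x \<noteq> \<zero>}" by (rule rev_image_eqI) simp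
    qed
    then show "finite {n. p n x \<noteq> \<zero>}" using gp_fin[OF p0 x] finite_surj by blast
    show "x = \<zero>" if "\<forall>n. p n x = \<zero>"
    proof (rule gp_faith[OF p0 x])
      show "p0 n x = \<zero>" for n using that[rule_format, of "n + r"] by (simp add: p_def)
    qed
  qed (use zdeg_sub gp_proj[OF p0] gp_same[OF p0] gp_other[OF p0] gp_add[OF p0]
      in \<open>auto simp: p_def Z_def\<close>)
  note P = gp_proj[OF p] gp_fin[OF p] gp_add[OF p] gp_same[OF p] gp_other[OF p] gp_faith[OF p]
    gp_carr[OF p] gp_zero[OF p] gp_minus[OF p]
  have Ic: "a \<in> I k \<Longrightarrow> a \<in> carrier R" for a k using I(1) zdeg_carr by blast
  \<comment> \<open>\<open>ideal_hom\<close> does not list closure under negation; it follows by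
    multiplying with -1, which lies in degree 0.\<close>
  have Imin: "\<ominus> a \<in> I k" if "a \<in> I k" for a k
  proof -
    have "(\<ominus> \<one>) \<otimes> a \<in> I (int 0 + k)" by (rule I(4)) (use rdeg_one rdeg_add_simps(4) that in auto)
    then show ?thesis using Ic[OF that] by (simp add: l_minus)
  qed
  have Isub: "subgroup (I k) (add_monoid R)" for k
    by (rule add.subgroupI) (use Ic I(2)[of k] I(3) Imin in auto)
  \<comment> \<open>The sum of all \<open>I k\<close> inside R, described by components.\<close>
  define S where "S = {x \<in> carrier R. \<forall>k. p k x \<in> I k}"
  have Sc: "x \<in> S \<Longrightarrow> x \<in> carrier R" for x by (simp add: S_def)
  have S0: "\<zero> \<in> S" by (simp add: S_def P(8) I(2))
  have Sadd: "x \<in> S \<Longrightarrow> y \<in> S \<Longrightarrow> x \<oplus> y \<in> S" for x y by (simp add: S_def P(3) I(3))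
  have IS: "I k \<subseteq> S" for k
  proof
    fix a assume a: "a \<in> I k"
    then have aZ: "a \<in> Z k" using I(1) by (auto simp: Z_def)
    have "p m a \<in> I m" for m using P(4)[OF aZ] P(5)[OF aZ, of m] a I(2) by (cases "m = k") auto
    then show "a \<in> S" using Ic[OF a] by (simp add: S_def)
  qed
  have Sind [consumes 1, case_names hom add]: "Q x" if x: "x \<in> S" and Q: "\<And>k a. a \<in> I k \<Longrightarrow> Q a"
    and Qa: "\<And>u v. u \<in> S \<Longrightarrow> v \<in> S \<Longrightarrow> Q u \<Longrightarrow> Q v \<Longrightarrow> Q (u \<oplus> v)" for x Q
  proof -
    have "x \<in> S \<and> Q x"
    proof (rule gp_induct[OF p])
      show "x \<in> carrier R" using x by (simp add: S_def)
      show "p n x \<in> S \<and> Q (p n x)" for n using x Q IS unfolding S_def by blast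
      show "\<zero> \<in> S \<and> Q \<zero>" using S0 Q I(2) by blast
    qed (use Qa Sadd in auto)
    then show ?thesis by simp
  qed
  have Smul: "a \<otimes> x \<in> S" if a: "a \<in> carrier R" and x: "x \<in> S" for a x
    using a
  proof (induction a rule: homogeneous_induct)
    case (hom n a)
    from x show ?case
    proof (induction x rule: Sind)
      case (hom k b)
      show ?case using I(4)[OF \<open>a \<in> rdeg R n\<close> hom] IS by blast
    next
      case (add u v)
      then show ?case using Sadd Sc \<open>a \<in> rdeg R n\<close> rdeg_carr by (simp add: r_distr)
    qed
  next
    case (add u v)
    then show ?case using Sadd x Sc by (simp add: l_distr)
  qed
  have Smin: "\<ominus> x \<in> S" if "x \<in> S" for x
    using that P(9) Imin by (simp add: S_def)
  have "ideal S R"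
  proof (rule idealI)
    show "ring R" by (rule ring_axioms)
    show "subgroup S (add_monoid R)"
      by (rule add.subgroupI) (use Sc S0 Sadd Smin in auto)
    show "x \<otimes> a \<in> S" if "a \<in> S" "x \<in> carrier R" for a x using Smul that by blast
    then show "a \<otimes> x \<in> S" if "a \<in> S" "x \<in> carrier R" for a x
      using m_comm[OF Sc[OF that(1)] that(2)] that by simp
  qed
  note S = this
  \<comment> \<open>The only additive map on S that restricts to \<phi> on every component.\<close>
  define F where "F = (\<lambda>x. \<Oplus>\<^bsub>Y\<^esub>k\<in>{k. p k x \<noteq> \<zero>}. \<phi> k (p k x))"
  have phic: "a \<in> I k \<Longrightarrow> \<phi> k a \<in> carrier Y" for a k using phi(1) Y(3) by blast
  have phi0: "\<phi> k \<zero> = \<zero>\<^bsub>Y\<^esub>" for k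
  proof -
    have "\<phi> k (\<zero> \<oplus> \<zero>) = \<phi> k \<zero> \<oplus>\<^bsub>Y\<^esub> \<phi> k \<zero>" using phi(2) I(2) by blast
    then show ?thesis using phic[OF I(2)] Y.M.add.r_cancel_one' by force
  qed
  \<comment> \<open>Padding with zero terms allows the sums for two elements to be added over a
    common finite index set.\<close>
  have Fext: "F x = (\<Oplus>\<^bsub>Y\<^esub>k\<in>A. \<phi> k (p k x))" if "x \<in> S" "finite A" "{k. p k x \<noteq> \<zero>} \<subseteq> A" for x A
    unfolding F_def
  proof (rule Y.M.add.finprod_mono_neutral_cong_left)
    show "(\<lambda>k. \<phi> k (p k x)) \<in> A \<rightarrow> carrier Y" using that phic by (auto simp: S_def)
  qed (use that phi0 in auto)
  have Fc: "F x \<in> carrier Y" if "x \<in> S" for x unfolding F_def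
    by (rule Y.M.finsum_closed) (use that phic in \<open>auto simp: S_def\<close>)
  have Fadd: "F (x \<oplus> y) = F x \<oplus>\<^bsub>Y\<^esub> F y" if x: "x \<in> S" and y: "y \<in> S" for x y
  proof -
    let ?A = "{k. p k x \<noteq> \<zero>} \<union> {k. p k y \<noteq> \<zero>}"
    have A: "finite ?A" using P(2) Sc x y by auto
    have "{k. p k (x \<oplus> y) \<noteq> \<zero>} \<subseteq> ?A" using P(3) Sc x y by auto
    then have "F (x \<oplus> y) = (\<Oplus>\<^bsub>Y\<^esub>k\<in>?A. \<phi> k (p k (x \<oplus> y)))" using Fext[OF Sadd[OF x y] A] by blast
    also have "\<dots> = (\<Oplus>\<^bsub>Y\<^esub>k\<in>?A. \<phi> k (p k x) \<oplus>\<^bsub>Y\<^esub> \<phi> k (p k y))"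
      using x y P(3) phi(2) by (simp add: S_def)
    also have "\<dots> = (\<Oplus>\<^bsub>Y\<^esub>k\<in>?A. \<phi> k (p k x)) \<oplus>\<^bsub>Y\<^esub> (\<Oplus>\<^bsub>Y\<^esub>k\<in>?A. \<phi> k (p k y))"
      by (rule Y.M.finsum_addf) (use x y phic in \<open>auto simp: S_def\<close>)
    also have "\<dots> = F x \<oplus>\<^bsub>Y\<^esub> F y" using Fext[OF x A] Fext[OF y A] by simp
    finally show ?thesis .
  qed
  have FI: "F a = \<phi> k a" if a: "a \<in> I k" for a k
  proof -
    have aZ: "a \<in> Z k" using I(1) a by (auto simp: Z_def)
    have "F a = (\<Oplus>\<^bsub>Y\<^esub>m\<in>{k}. \<phi> m (p m a))"
      by (rule Fext) (use a IS P(5)[OF aZ] in auto)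
    then show ?thesis using P(4)[OF aZ] phic[OF a] by simp
  qed
  have Fmul: "F (a \<otimes> x) = a \<odot>\<^bsub>Y\<^esub> F x" if a: "a \<in> carrier R" and x: "x \<in> S" for a x
    using a
  proof (induction a rule: homogeneous_induct)
    case (hom n a)
    from x show ?case
    proof (induction x rule: Sind)
      case (hom k b)
      show ?case using FI[OF I(4)[OF \<open>a \<in> rdeg R n\<close> hom]] FI[OF hom] phi(3)[OF \<open>a \<in> rdeg R n\<close> hom] by simp
    next
      case (add u v)
      have ac: "a \<in> carrier R" using \<open>a \<in> rdeg R n\<close> rdeg_carr by blast
      show ?case using add Sc ac by (simp add: r_distr Fadd Smul Y.smult_r_distr Fc)
    qed
  next
    case (add u v)
    then show ?case using x Sc by (simp add: l_distr Fadd Smul Y.smult_l_distr Fc)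
  qed
  define c where "c = \<zero>\<^bsub>Y\<^esub>"
  define T :: "'a set \<Rightarrow> (int \<Rightarrow> 'a set) \<Rightarrow> ('a, 'a \<times> 'y) graded_module"
    where "T = (\<lambda>S C. \<lparr>carrier = S \<times> {c}, monoid.mult = (\<lambda>_ _. (\<zero>, c)), one = (\<zero>, c),
      ring.zero = (\<zero>, c), add = (\<lambda>u v. (fst u \<oplus> fst v, c)), smult = (\<lambda>a u. (a \<otimes> fst u, c)),
      mdeg = (\<lambda>k. C k \<times> {c})\<rparr>)"
  have gA: "is_graded_module R (T S I)"
    unfolding T_def
    by (rule test_module_graded[OF p S]) (use Isub I IS in \<open>auto simp: S_def Z_def\<close>)
  have gB: "is_graded_module R (T (carrier R) Z)"
    unfolding T_def
  proof (rule test_module_graded[OF p oneideal])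
    show "a \<otimes> x \<in> Z (int n + k)" if "a \<in> rdeg R n" "x \<in> Z k" for a x n k
      using zdeg_mult[of a n x "k - r"] that by (simp add: Z_def algebra_simps)
  qed (use P(1) zdeg_sub in \<open>auto simp: Z_def\<close>)
  have j: "id \<in> graded_hom R (T S I) (T (carrier R) Z)"
    unfolding graded_hom_def using Sc I(1) by (auto simp: T_def Z_def)
  have f: "(\<lambda>u. F (fst u)) \<in> graded_hom R (T S I) Y"
    unfolding graded_hom_def using Fc Fadd Fmul FI phi(1) by (auto simp: T_def)
  have "\<forall>(A :: ('a, 'a \<times> 'y) graded_module) (B :: ('a, 'a \<times> 'y) graded_module). \<forall>j\<in>graded_hom R A B. \<forall>f\<in>graded_hom R A Y.
       is_graded_module R A \<longrightarrow> is_graded_module R B \<longrightarrow> inj_on j (carrier A) \<longrightarrow>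
       (\<exists>g\<in>graded_hom R B Y. \<forall>x\<in>carrier A. g (j x) = f x)"
    using inj unfolding graded_injective_def by (rule conjunct2)
  then have "\<exists>g\<in>graded_hom R (T (carrier R) Z) Y. \<forall>x\<in>carrier (T S I). g (id x) = F (fst x)"
    using j f gA gB inj_on_id by (elim allE[of _ "T S I"] allE[of _ "T (carrier R) Z"]) (drule bspec, assumption, drule bspec, assumption, simp)
  then obtain g where g: "g \<in> graded_hom R (T (carrier R) Z) Y"
    and gf: "\<And>x. x \<in> S \<Longrightarrow> g (x, c) = F x" by (auto simp: T_def)
  \<comment> \<open>The unit lies in degree r of R(-r), so its image is homogeneous of degree
    r.\<close>
  have "(\<one>, c) \<in> mdeg (T (carrier R) Z) r" using rdeg_one by (simp add: T_def Z_def zdeg_def)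
  then have y: "g (\<one>, c) \<in> mdeg Y r" using g unfolding graded_hom_def by blast
  have "\<phi> k a = a \<odot>\<^bsub>Y\<^esub> g (\<one>, c)" if a: "a \<in> I k" for a k
  proof -
    have ac: "a \<in> carrier R" using Ic[OF a] .
    have "\<forall>a\<in>carrier R. \<forall>x\<in>carrier R. g (a \<otimes> x, c) = a \<odot>\<^bsub>Y\<^esub> g (x, c)"
      using g unfolding graded_hom_def by (simp add: T_def)
    then have "g (a \<otimes> \<one>, c) = a \<odot>\<^bsub>Y\<^esub> g (\<one>, c)" using ac by blast
    then have "g (a, c) = a \<odot>\<^bsub>Y\<^esub> g (\<one>, c)" using ac by simp
    moreover have "g (a, c) = \<phi> k a" using gf[of a] IS[of k] FI[OF a] a by auto
    ultimately show ?thesis by simp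
  qed
  then show "\<exists>y\<in>mdeg Y r. \<forall>k. \<forall>a\<in>I k. \<phi> k a = a \<odot>\<^bsub>Y\<^esub> y" using y by blast
qed

lemma zdeg_smult:
  assumes V: "pregraded R V" and a: "a \<in> zdeg R (k - r)" and v: "v \<in> mdeg V r"
  shows "a \<odot>\<^bsub>V\<^esub> v \<in> mdeg V k"
proof (cases "k - r < 0")
  case True
  interpret V: module R V by (rule pregradedD(1)[OF V])
  show ?thesis using True a v pregradedD(9)[OF V v] pregradedD(4)[OF V] by (auto simp: zdeg_def)
next
  case False
  then have "a \<in> rdeg R (nat (k - r))" using a by (simp add: zdeg_def)
  from pregradedD(7)[OF V this v] show ?thesis using False by simp
qed

text \<open>Zorn's lemma together with extension by one homogeneous element, as in the ungraded
  criterion. Graphs consist of triples that record the degree, because in a pregraded module one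
  element may lie in several components and its image may then depend on the degree.\<close>

lemma baer_extension:
  fixes U :: "('a, 'x) graded_module" and Y :: "('a, 'y) graded_module"
  assumes U: "pregraded R U" and Y: "pregraded R Y" and inj: "baer_injective R Y"
    and f: "partial_hom R U Y S f"
  obtains g where "partial_hom R U Y (mdeg U) g" "\<And>r x. x \<in> S r \<Longrightarrow> g r x = f r x"
proof -
  note UD = pregradedD[OF U] and YD = pregradedD[OF Y]
  interpret U: module R U by (rule UD(1))
  interpret Y: module R Y by (rule YD(1))
  note S = partial_homD(1-4)[OF f] and ff = partial_homD(5-7)[OF f]
  have f0: "f r \<zero>\<^bsub>U\<^esub> = \<zero>\<^bsub>Y\<^esub>" for r
  proof -
    have "f r \<zero>\<^bsub>U\<^esub> = f r \<zero>\<^bsub>U\<^esub> \<oplus>\<^bsub>Y\<^esub> f r \<zero>\<^bsub>U\<^esub>" using ff(2)[OF S(2) S(2), of r] by simp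
    moreover have "f r \<zero>\<^bsub>U\<^esub> \<in> carrier Y" using ff(1)[OF S(2)] YD(3) by blast
    ultimately show ?thesis using Y.M.add.r_cancel_one' by metis
  qed
  \<comment> \<open>graphs of partial homomorphisms extending \<open>f\<close>\<close>
  define ok where "ok = (\<lambda>G :: (int \<times> 'x \<times> 'y) set.
    (\<forall>r x y. (r, x, y) \<in> G \<longrightarrow> x \<in> mdeg U r \<and> y \<in> mdeg Y r) \<and>
    (\<forall>r. \<forall>x\<in>S r. (r, x, f r x) \<in> G) \<and>
    (\<forall>r x y x' y'. (r, x, y) \<in> G \<longrightarrow> (r, x', y') \<in> G \<longrightarrow> (r, x \<oplus>\<^bsub>U\<^esub> x', y \<oplus>\<^bsub>Y\<^esub> y') \<in> G) \<and>
    (\<forall>n a r x y. a \<in> rdeg R n \<longrightarrow> (r, x, y) \<in> G \<longrightarrow> (int n + r, a \<odot>\<^bsub>U\<^esub> x, a \<odot>\<^bsub>Y\<^esub> y) \<in> G) \<and>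
    (\<forall>r y. (r, \<zero>\<^bsub>U\<^esub>, y) \<in> G \<longrightarrow> y = \<zero>\<^bsub>Y\<^esub>))"
  have okd: "x \<in> mdeg U r" "y \<in> mdeg Y r" if "ok G" "(r, x, y) \<in> G" for G r x y
    using that by (simp_all add: ok_def)
  have okc: "x \<in> carrier U" "y \<in> carrier Y" if "ok G" "(r, x, y) \<in> G" for G r x y
    using okd[OF that] UD(3) YD(3) by blast+
  have okf: "(r, x, f r x) \<in> G" if "ok G" "x \<in> S r" for G r x
    using that by (simp add: ok_def)
  have oka: "(r, x \<oplus>\<^bsub>U\<^esub> x', y \<oplus>\<^bsub>Y\<^esub> y') \<in> G"
    if "ok G" "(r, x, y) \<in> G" "(r, x', y') \<in> G" for G r x y x' y'
    using that by (simp add: ok_def)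
  have oks: "(int n + r, a \<odot>\<^bsub>U\<^esub> x, a \<odot>\<^bsub>Y\<^esub> y) \<in> G"
    if "ok G" "a \<in> rdeg R n" "(r, x, y) \<in> G" for G n a r x y
    using that by (simp add: ok_def)
  have okz: "y = \<zero>\<^bsub>Y\<^esub>" if "ok G" "(r, \<zero>\<^bsub>U\<^esub>, y) \<in> G" for G r y
    using that by (simp add: ok_def)
  have ok_neg: "(r, \<ominus>\<^bsub>U\<^esub> x, \<ominus>\<^bsub>Y\<^esub> y) \<in> G" if "ok G" "(r, x, y) \<in> G" for G r x y
  proof -
    have "(int 0 + r, (\<ominus> \<one>) \<odot>\<^bsub>U\<^esub> x, (\<ominus> \<one>) \<odot>\<^bsub>Y\<^esub> y) \<in> G"
      by (rule oks[OF that(1) rdeg_add_simps(4)[OF rdeg_one] that(2)])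
    moreover have "x \<in> carrier U" "y \<in> carrier Y" using okc[OF that] .
    ultimately show ?thesis by (simp add: U.smult_l_minus Y.smult_l_minus)
  qed
  \<comment> \<open>The last clause of \<open>ok\<close> controls only the values over zero;
    subtracting two triples turns it into single-valuedness.\<close>
  have ok_fun: "y = y'" if G: "ok G" and m: "(r, x, y) \<in> G" "(r, x, y') \<in> G" for G r x y y'
  proof -
    have c: "x \<in> carrier U" "y \<in> carrier Y" "y' \<in> carrier Y"
      using okc[OF G] m by auto
    have "(r, x \<oplus>\<^bsub>U\<^esub> \<ominus>\<^bsub>U\<^esub> x, y \<oplus>\<^bsub>Y\<^esub> \<ominus>\<^bsub>Y\<^esub> y') \<in> G"
      by (rule oka[OF G m(1) ok_neg[OF G m(2)]])
    then have "y \<oplus>\<^bsub>Y\<^esub> \<ominus>\<^bsub>Y\<^esub> y' = \<zero>\<^bsub>Y\<^esub>" using okz[OF G] c U.M.r_neg[of x] by auto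
    then show ?thesis using c by (metis Y.M.a_inv_closed Y.M.minus_equality Y.M.minus_minus)
  qed
  have "\<exists>G\<in>{G. ok G}. \<forall>H\<in>{G. ok G}. G \<subseteq> H \<longrightarrow> H = G"
  proof (rule subset_Zorn_nonempty)
    have "ok {(r, x, f r x) | r x. x \<in> S r}"
      unfolding ok_def using S ff f0 by auto
    then show "{G. ok G} \<noteq> {}" by blast
    fix \<C> assume ne: "\<C> \<noteq> {}" and ch: "subset.chain {G. ok G} \<C>"
    have okC: "\<And>G. G \<in> \<C> \<Longrightarrow> ok G" using ch unfolding subset.chain_def by blast
    have cmp: "G \<subseteq> H \<or> H \<subseteq> G" if "G \<in> \<C>" "H \<in> \<C>" for G H
      using ch that unfolding subset.chain_def by blast
    have "ok (\<Union>\<C>)"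
      unfolding ok_def
    proof (intro conjI allI ballI impI)
      fix r x y x' y' assume "(r, x, y) \<in> \<Union>\<C>" "(r, x', y') \<in> \<Union>\<C>"
      then obtain G H where GH: "G \<in> \<C>" "H \<in> \<C>" "(r, x, y) \<in> G" "(r, x', y') \<in> H" by blast
      then obtain K where "K \<in> \<C>" "(r, x, y) \<in> K" "(r, x', y') \<in> K" using cmp[OF GH(1,2)] by blast
      then have "(r, x \<oplus>\<^bsub>U\<^esub> x', y \<oplus>\<^bsub>Y\<^esub> y') \<in> K" by (intro oka okC)
      then show "(r, x \<oplus>\<^bsub>U\<^esub> x', y \<oplus>\<^bsub>Y\<^esub> y') \<in> \<Union>\<C>" using \<open>K \<in> \<C>\<close> by blast
    next
      fix r x assume "x \<in> S r"
      then show "(r, x, f r x) \<in> \<Union>\<C>" using ne okf[OF okC] by blast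
    next
      fix n a r x y assume a: "a \<in> rdeg R n" and "(r, x, y) \<in> \<Union>\<C>"
      then obtain G where G: "G \<in> \<C>" "(r, x, y) \<in> G" by blast
      then have "(int n + r, a \<odot>\<^bsub>U\<^esub> x, a \<odot>\<^bsub>Y\<^esub> y) \<in> G" by (intro oks okC a)
      then show "(int n + r, a \<odot>\<^bsub>U\<^esub> x, a \<odot>\<^bsub>Y\<^esub> y) \<in> \<Union>\<C>" using G by blast
    next
      fix r x y assume "(r, x, y) \<in> \<Union>\<C>"
      then obtain G where G: "G \<in> \<C>" "(r, x, y) \<in> G" by blast
      then show "x \<in> mdeg U r" "y \<in> mdeg Y r" using okd[OF okC[OF G(1)]] by blast+
    next
      fix r y assume "(r, \<zero>\<^bsub>U\<^esub>, y) \<in> \<Union>\<C>"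
      then obtain G where G: "G \<in> \<C>" "(r, \<zero>\<^bsub>U\<^esub>, y) \<in> G" by blast
      then show "y = \<zero>\<^bsub>Y\<^esub>" using okz[OF okC[OF G(1)]] by blast
    qed
    then show "\<Union>\<C> \<in> {G. ok G}" by blast
  qed
  then obtain G where G: "ok G" and max: "\<And>H. ok H \<Longrightarrow> G \<subseteq> H \<Longrightarrow> H = G" by blast
  note Gd = okd[OF G] and Gc = okc[OF G] and Gf = okf[OF G] and Ga = oka[OF G] and Gs = oks[OF G]
  note Gfun = ok_fun[OF G] and Gneg = ok_neg[OF G]
  have G0: "(r, \<zero>\<^bsub>U\<^esub>, \<zero>\<^bsub>Y\<^esub>) \<in> G" for r using Gf[OF S(2)] f0 by metis
  have total: "\<exists>y. (r0, b, y) \<in> G" if b: "b \<in> mdeg U r0" for r0 b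
  proof -
    have bc: "b \<in> carrier U" using b UD(3) by blast
    \<comment> \<open>The multipliers that carry b into the domain of G. On them the values are
      already prescribed by G, and Baer's condition turns these values into multiples of a single
      element, the future image of b.\<close>
    define I where "I = (\<lambda>k. {a \<in> zdeg R (k - r0). \<exists>y. (k, a \<odot>\<^bsub>U\<^esub> b, y) \<in> G})"
    define \<phi> where "\<phi> = (\<lambda>k a. SOME y. (k, a \<odot>\<^bsub>U\<^esub> b, y) \<in> G)"
    have phi: "(k, a \<odot>\<^bsub>U\<^esub> b, \<phi> k a) \<in> G" if "a \<in> I k" for a k
      using that someI_ex[of "\<lambda>y. (k, a \<odot>\<^bsub>U\<^esub> b, y) \<in> G"] unfolding I_def \<phi>_def by blast
    have Ic: "a \<in> carrier R" if "a \<in> I k" for a k using that zdeg_carr unfolding I_def by blast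
    have "\<exists>y\<in>mdeg Y r0. \<forall>k. \<forall>a\<in>I k. \<phi> k a = a \<odot>\<^bsub>Y\<^esub> y"
    proof (rule baer_injectiveD[OF inj], unfold ideal_hom_def, intro conjI allI ballI)
      fix k
      show "I k \<subseteq> zdeg R (k - r0)" unfolding I_def by blast
      show "\<zero> \<in> I k" using G0 zdeg_add_simps(2) bc unfolding I_def by auto
      show "\<phi> k a \<in> mdeg Y k" if "a \<in> I k" for a using Gd(2)[OF phi[OF that]] .
      fix a c assume ac: "a \<in> I k" "c \<in> I k"
      have s: "(k, (a \<oplus> c) \<odot>\<^bsub>U\<^esub> b, \<phi> k a \<oplus>\<^bsub>Y\<^esub> \<phi> k c) \<in> G"
        using Ga[OF phi[OF ac(1)] phi[OF ac(2)]] Ic ac bc by (simp add: U.smult_l_distr)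
      then show I': "a \<oplus> c \<in> I k" using ac zdeg_add_simps(3) unfolding I_def by blast
      show "\<phi> k (a \<oplus> c) = \<phi> k a \<oplus>\<^bsub>Y\<^esub> \<phi> k c" using Gfun[OF phi[OF I'] s] .
    next
      fix k n c a assume c: "c \<in> rdeg R n" and a: "a \<in> I k"
      have s: "(int n + k, (c \<otimes> a) \<odot>\<^bsub>U\<^esub> b, c \<odot>\<^bsub>Y\<^esub> \<phi> k a) \<in> G"
        using Gs[OF c phi[OF a]] Ic[OF a] rdeg_carr[OF c] bc by (simp add: U.smult_assoc1)
      have "c \<otimes> a \<in> zdeg R (int n + (k - r0))" using zdeg_mult[OF c] a unfolding I_def by blast
      then show I': "c \<otimes> a \<in> I (int n + k)" using s unfolding I_def by (auto simp: algebra_simps)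
      show "\<phi> (int n + k) (c \<otimes> a) = c \<odot>\<^bsub>Y\<^esub> \<phi> k a" using Gfun[OF phi[OF I'] s] .
    qed
    then obtain y0 where y0: "y0 \<in> mdeg Y r0" and y0': "\<And>k a. a \<in> I k \<Longrightarrow> \<phi> k a = a \<odot>\<^bsub>Y\<^esub> y0"
      by blast
    have y0c: "y0 \<in> carrier Y" using y0 YD(3) by blast
    \<comment> \<open>The graph of the extension of G that sends b to \<open>y0\<close>.\<close>
    define H where "H = {(k, x \<oplus>\<^bsub>U\<^esub> a \<odot>\<^bsub>U\<^esub> b, y \<oplus>\<^bsub>Y\<^esub> a \<odot>\<^bsub>Y\<^esub> y0) | k x y a.
        (k, x, y) \<in> G \<and> a \<in> zdeg R (k - r0)}"
    have HI: "(k, x \<oplus>\<^bsub>U\<^esub> a \<odot>\<^bsub>U\<^esub> b, y \<oplus>\<^bsub>Y\<^esub> a \<odot>\<^bsub>Y\<^esub> y0) \<in> H"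
      if "(k, x, y) \<in> G" "a \<in> zdeg R (k - r0)" for k x y a using that unfolding H_def by blast
    have GH: "G \<subseteq> H"
    proof
      fix g assume "g \<in> G"
      then obtain k x y where g: "g = (k, x, y)" "(k, x, y) \<in> G" by (metis prod_cases3)
      have "(k, x \<oplus>\<^bsub>U\<^esub> \<zero> \<odot>\<^bsub>U\<^esub> b, y \<oplus>\<^bsub>Y\<^esub> \<zero> \<odot>\<^bsub>Y\<^esub> y0) \<in> H"
        by (rule HI) (use g zdeg_add_simps(2) in auto)
      then show "g \<in> H" using g Gc[OF g(2)] bc y0c by simp
    qed
    have "ok H"
      unfolding ok_def
    proof (intro conjI allI ballI impI)
      fix k x y assume "(k, x, y) \<in> H"
      then obtain x1 y1 a where h: "(k, x1, y1) \<in> G" "a \<in> zdeg R (k - r0)"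
        "x = x1 \<oplus>\<^bsub>U\<^esub> a \<odot>\<^bsub>U\<^esub> b" "y = y1 \<oplus>\<^bsub>Y\<^esub> a \<odot>\<^bsub>Y\<^esub> y0" unfolding H_def by blast
      show "x \<in> mdeg U k"
        unfolding h(3) by (rule UD(5)[OF Gd(1)[OF h(1)] zdeg_smult[OF U h(2) b]])
      show "y \<in> mdeg Y k"
        unfolding h(4) by (rule YD(5)[OF Gd(2)[OF h(1)] zdeg_smult[OF Y h(2) y0]])
    next
      fix r x assume "x \<in> S r" then show "(r, x, f r x) \<in> H" using Gf GH by blast
    next
      fix k x y x' y' assume "(k, x, y) \<in> H" "(k, x', y') \<in> H"
      then obtain x1 y1 a x2 y2 c where h: "(k, x1, y1) \<in> G" "a \<in> zdeg R (k - r0)"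
        "x = x1 \<oplus>\<^bsub>U\<^esub> a \<odot>\<^bsub>U\<^esub> b" "y = y1 \<oplus>\<^bsub>Y\<^esub> a \<odot>\<^bsub>Y\<^esub> y0"
        "(k, x2, y2) \<in> G" "c \<in> zdeg R (k - r0)"
        "x' = x2 \<oplus>\<^bsub>U\<^esub> c \<odot>\<^bsub>U\<^esub> b" "y' = y2 \<oplus>\<^bsub>Y\<^esub> c \<odot>\<^bsub>Y\<^esub> y0" unfolding H_def by blast
      have cc: "a \<in> carrier R" "c \<in> carrier R" using h by auto
      have "(k, (x1 \<oplus>\<^bsub>U\<^esub> x2) \<oplus>\<^bsub>U\<^esub> (a \<oplus> c) \<odot>\<^bsub>U\<^esub> b, (y1 \<oplus>\<^bsub>Y\<^esub> y2) \<oplus>\<^bsub>Y\<^esub> (a \<oplus> c) \<odot>\<^bsub>Y\<^esub> y0) \<in> H"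
        by (rule HI[OF Ga[OF h(1) h(5)] zdeg_add_simps(3)[OF h(2) h(6)]])
      then show "(k, x \<oplus>\<^bsub>U\<^esub> x', y \<oplus>\<^bsub>Y\<^esub> y') \<in> H"
        using h cc bc y0c Gc[OF h(1)] Gc[OF h(5)]
        by (simp add: U.smult_l_distr Y.smult_l_distr U.M.a_ac Y.M.a_ac)
    next
      fix n c k x y assume c: "c \<in> rdeg R n" and "(k, x, y) \<in> H"
      then obtain x1 y1 a where h: "(k, x1, y1) \<in> G" "a \<in> zdeg R (k - r0)"
        "x = x1 \<oplus>\<^bsub>U\<^esub> a \<odot>\<^bsub>U\<^esub> b" "y = y1 \<oplus>\<^bsub>Y\<^esub> a \<odot>\<^bsub>Y\<^esub> y0" unfolding H_def by blast
      have cc: "a \<in> carrier R" "c \<in> carrier R" using h c by auto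
      have "c \<otimes> a \<in> zdeg R (int n + k - r0)" using zdeg_mult[OF c h(2)] by (simp add: algebra_simps)
      then have "(int n + k, c \<odot>\<^bsub>U\<^esub> x1 \<oplus>\<^bsub>U\<^esub> (c \<otimes> a) \<odot>\<^bsub>U\<^esub> b, c \<odot>\<^bsub>Y\<^esub> y1 \<oplus>\<^bsub>Y\<^esub> (c \<otimes> a) \<odot>\<^bsub>Y\<^esub> y0) \<in> H"
        by (rule HI[OF Gs[OF c h(1)]])
      then show "(int n + k, c \<odot>\<^bsub>U\<^esub> x, c \<odot>\<^bsub>Y\<^esub> y) \<in> H"
        using h cc bc y0c Gc[OF h(1)]
        by (simp add: U.smult_r_distr Y.smult_r_distr U.smult_assoc1 Y.smult_assoc1)
    next
      fix k y assume "(k, \<zero>\<^bsub>U\<^esub>, y) \<in> H"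
      then obtain x1 y1 a where h: "(k, x1, y1) \<in> G" "a \<in> zdeg R (k - r0)"
        "\<zero>\<^bsub>U\<^esub> = x1 \<oplus>\<^bsub>U\<^esub> a \<odot>\<^bsub>U\<^esub> b" "y = y1 \<oplus>\<^bsub>Y\<^esub> a \<odot>\<^bsub>Y\<^esub> y0" unfolding H_def by blast
      have ac: "a \<in> carrier R" using h by auto
      note gc = Gc[OF h(1)]
      \<comment> \<open>Well-definedness: x1 + a b = 0 puts a b into the domain of G, so a lies in
        I, where the value of G at a b is a y0.\<close>
      have ab: "a \<odot>\<^bsub>U\<^esub> b = \<ominus>\<^bsub>U\<^esub> x1"
        using h(3) ac bc gc by (metis U.M.a_comm U.M.minus_equality U.smult_closed)
      have "(k, a \<odot>\<^bsub>U\<^esub> b, \<ominus>\<^bsub>Y\<^esub> y1) \<in> G" unfolding ab by (rule Gneg[OF h(1)])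
      moreover from this have aI: "a \<in> I k" using h(2) unfolding I_def by blast
      ultimately have "\<ominus>\<^bsub>Y\<^esub> y1 = a \<odot>\<^bsub>Y\<^esub> y0" using Gfun[OF phi[OF aI]] y0'[OF aI] by metis
      then show "y = \<zero>\<^bsub>Y\<^esub>" using h(4) gc Y.M.r_neg by metis
    qed
    then have "H = G" using max GH by blast
    moreover have "(r0, \<zero>\<^bsub>U\<^esub> \<oplus>\<^bsub>U\<^esub> \<one> \<odot>\<^bsub>U\<^esub> b, \<zero>\<^bsub>Y\<^esub> \<oplus>\<^bsub>Y\<^esub> \<one> \<odot>\<^bsub>Y\<^esub> y0) \<in> H"
      by (rule HI[OF G0]) (use rdeg_one in \<open>simp add: zdeg_def\<close>)
    ultimately show ?thesis using bc by auto
  qed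
  define g where "g = (\<lambda>r x. SOME y. (r, x, y) \<in> G)"
  have g: "(r, x, g r x) \<in> G" if "x \<in> mdeg U r" for r x
    using someI_ex[OF total[OF that]] unfolding g_def .
  show thesis
  proof (rule that)
    show "g r x = f r x" if "x \<in> S r" for r x
      using Gfun[OF g[OF S(1)[OF that]] Gf[OF that]] .
    show "partial_hom R U Y (mdeg U) g"
      unfolding partial_hom_def
    proof (intro allI conjI ballI)
      fix r x y assume xy: "x \<in> mdeg U r" "y \<in> mdeg U r"
      then show s: "x \<oplus>\<^bsub>U\<^esub> y \<in> mdeg U r" by (rule UD(5))
      show "g r (x \<oplus>\<^bsub>U\<^esub> y) = g r x \<oplus>\<^bsub>Y\<^esub> g r y"
        using Gfun[OF g[OF s] Ga[OF g[OF xy(1)] g[OF xy(2)]]] .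
    next
      fix r n a x assume a: "a \<in> rdeg R n" and x: "x \<in> mdeg U r"
      then show s: "a \<odot>\<^bsub>U\<^esub> x \<in> mdeg U (int n + r)" by (rule UD(7))
      show "g (int n + r) (a \<odot>\<^bsub>U\<^esub> x) = a \<odot>\<^bsub>Y\<^esub> g r x"
        using Gfun[OF g[OF s] Gs[OF a g[OF x]]] .
    qed (use UD(4) Gd(2)[OF g] in auto)
  qed
qed

end

section \<open>Mapping cones\<close>

text \<open>Iterated mapping cones have to live in one type, which must be closed under pairing.\<close>
datatype 'e ktree = Leaf (leaf_val: 'e) | Node (lft: "'e ktree") (rgt: "'e ktree")

text \<open>\<open>U \<oplus> V(-1)\<close>\<close>
definition cone_module ::
  "('a, 'e ktree) graded_module \<Rightarrow> ('a, 'e ktree) graded_module \<Rightarrow> ('a, 'e ktree) graded_module" where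
  "cone_module U V =
     \<lparr>carrier = {Node x y | x y. x \<in> carrier U \<and> y \<in> carrier V},
      monoid.mult = (\<lambda>_ _. Node \<zero>\<^bsub>U\<^esub> \<zero>\<^bsub>V\<^esub>), one = Node \<zero>\<^bsub>U\<^esub> \<zero>\<^bsub>V\<^esub>, ring.zero = Node \<zero>\<^bsub>U\<^esub> \<zero>\<^bsub>V\<^esub>,
      add = (\<lambda>u v. Node (lft u \<oplus>\<^bsub>U\<^esub> lft v) (rgt u \<oplus>\<^bsub>V\<^esub> rgt v)),
      smult = (\<lambda>a u. Node (a \<odot>\<^bsub>U\<^esub> lft u) (a \<odot>\<^bsub>V\<^esub> rgt u)),
      mdeg = (\<lambda>r. {Node x y | x y. x \<in> mdeg U r \<and> y \<in> mdeg V (r - 1)})\<rparr>"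

lemma cone_module_simps:
  "Node x y \<in> carrier (cone_module U V) \<longleftrightarrow> x \<in> carrier U \<and> y \<in> carrier V"
  "\<zero>\<^bsub>cone_module U V\<^esub> = Node \<zero>\<^bsub>U\<^esub> \<zero>\<^bsub>V\<^esub>"
  "Node x y \<oplus>\<^bsub>cone_module U V\<^esub> Node x' y' = Node (x \<oplus>\<^bsub>U\<^esub> x') (y \<oplus>\<^bsub>V\<^esub> y')"
  "a \<odot>\<^bsub>cone_module U V\<^esub> Node x y = Node (a \<odot>\<^bsub>U\<^esub> x) (a \<odot>\<^bsub>V\<^esub> y)"
  "Node x y \<in> mdeg (cone_module U V) r \<longleftrightarrow> x \<in> mdeg U r \<and> y \<in> mdeg V (r - 1)"
  by (auto simp: cone_module_def)

lemma cone_module_cases: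
  "u \<in> carrier (cone_module U V) \<Longrightarrow> \<exists>x y. u = Node x y \<and> x \<in> carrier U \<and> y \<in> carrier V"
  "u \<in> mdeg (cone_module U V) r \<Longrightarrow> \<exists>x y. u = Node x y \<and> x \<in> mdeg U r \<and> y \<in> mdeg V (r - 1)"
  by (auto simp: cone_module_def)

text \<open>Torsion is tested against the components R_s for large s instead of powers of an ideal.
  This suits degreewise arguments; \<open>torsion_homogeneous\<close> identifies the two
  notions.\<close>

definition htors :: "'a graded_ring \<Rightarrow> ('a, 'x) graded_module \<Rightarrow> int \<Rightarrow> 'x set" where
  "htors R U r = {x \<in> mdeg U r. \<exists>n. \<forall>s\<ge>n. \<forall>a\<in>rdeg R s. a \<odot>\<^bsub>U\<^esub> x = \<zero>\<^bsub>U\<^esub>}"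

text \<open>\<open>H\<^sup>j(\<Gamma>(D))\<^sub>r \<noteq> 0\<close>, where \<open>\<Gamma>\<close> is the functor of \<open>R\<^sub>+\<close>-torsion\<close>
definition tors_coh_nz ::
  "'a graded_ring \<Rightarrow> (int \<Rightarrow> ('a, 'x) graded_module) \<Rightarrow> (int \<Rightarrow> 'x \<Rightarrow> 'x) \<Rightarrow> int \<Rightarrow> int \<Rightarrow> bool" where
  "tors_coh_nz R D \<delta> j r \<longleftrightarrow> (\<exists>x\<in>htors R (D j) r. \<delta> j x = \<zero>\<^bsub>D (j + 1)\<^esub> \<and>
     (\<forall>w\<in>htors R (D (j - 1)) r. \<delta> (j - 1) w \<noteq> x))"

text \<open>The cone of multiplication by a linear form from D(-1) to D, placed so that D keeps its
  cohomological degrees. Each cone extends the complex by one place to the left, whence the indexing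
  by integers.\<close>

definition cone_complex :: "(int \<Rightarrow> ('a, 'e ktree) graded_module) \<Rightarrow> int \<Rightarrow> ('a, 'e ktree) graded_module"
  where "cone_complex D j = cone_module (D j) (D (j + 1))"

text \<open>The sign in the second component makes the square zero: the contributions z \<delta> y
  and -z \<delta> y cancel. As the second summand is shifted by one internal degree, multiplication
  by z has degree 0.\<close>

definition cone_diff :: "'a \<Rightarrow> (int \<Rightarrow> ('a, 'e ktree) graded_module) \<Rightarrow> (int \<Rightarrow> 'e ktree \<Rightarrow> 'e ktree)
    \<Rightarrow> int \<Rightarrow> 'e ktree \<Rightarrow> 'e ktree" where
  "cone_diff z D \<delta> j u = Node (\<delta> j (lft u) \<oplus>\<^bsub>D (j + 1)\<^esub> z \<odot>\<^bsub>D (j + 1)\<^esub> rgt u)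
     (\<ominus>\<^bsub>D (j + 1 + 1)\<^esub> \<delta> (j + 1) (rgt u))"

lemma graded_homD:
  assumes "f \<in> graded_hom R U V"
  shows "x \<in> carrier U \<Longrightarrow> f x \<in> carrier V"
    "x \<in> carrier U \<Longrightarrow> y \<in> carrier U \<Longrightarrow> f (x \<oplus>\<^bsub>U\<^esub> y) = f x \<oplus>\<^bsub>V\<^esub> f y"
    "a \<in> carrier R \<Longrightarrow> x \<in> carrier U \<Longrightarrow> f (a \<odot>\<^bsub>U\<^esub> x) = a \<odot>\<^bsub>V\<^esub> f x"
    "x \<in> mdeg U r \<Longrightarrow> f x \<in> mdeg V r"
  using assms unfolding graded_hom_def by (auto simp: image_subset_iff)

context graded_ring_base
begin

lemma graded_hom_zero:
  assumes "f \<in> graded_hom R U V" "module R U" "module R V"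
  shows "f \<zero>\<^bsub>U\<^esub> = \<zero>\<^bsub>V\<^esub>"
proof -
  interpret U: module R U by fact
  interpret V: module R V by fact
  show ?thesis using graded_homD(3)[OF assms(1), of \<zero> "\<zero>\<^bsub>U\<^esub>"] graded_homD(1)[OF assms(1), of "\<zero>\<^bsub>U\<^esub>"]
    by simp
qed

lemma graded_hom_minus:
  assumes "f \<in> graded_hom R U V" "module R U" "module R V" "x \<in> carrier U"
  shows "f (\<ominus>\<^bsub>U\<^esub> x) = \<ominus>\<^bsub>V\<^esub> f x"
proof -
  interpret U: module R U by fact
  interpret V: module R V by fact
  show ?thesis using graded_homD(3)[OF assms(1), of "\<ominus> \<one>" x] graded_homD(1)[OF assms(1), of x] assms(4)
    by (simp add: U.smult_l_minus V.smult_l_minus)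
qed

lemma htors_add:
  assumes U: "pregraded R U" and x: "x \<in> htors R U r" and y: "y \<in> htors R U r"
  shows "x \<oplus>\<^bsub>U\<^esub> y \<in> htors R U r"
proof -
  interpret U: module R U by (rule pregradedD(1)[OF U])
  obtain n where n: "\<And>s a. s \<ge> n \<Longrightarrow> a \<in> rdeg R s \<Longrightarrow> a \<odot>\<^bsub>U\<^esub> x = \<zero>\<^bsub>U\<^esub>" using x unfolding htors_def by blast
  obtain m where m: "\<And>s a. s \<ge> m \<Longrightarrow> a \<in> rdeg R s \<Longrightarrow> a \<odot>\<^bsub>U\<^esub> y = \<zero>\<^bsub>U\<^esub>" using y unfolding htors_def by blast
  have d: "x \<in> mdeg U r" "y \<in> mdeg U r" using x y unfolding htors_def by auto
  then have c: "x \<in> carrier U" "y \<in> carrier U" using pregradedD(3)[OF U] by blast+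
  have "a \<odot>\<^bsub>U\<^esub> (x \<oplus>\<^bsub>U\<^esub> y) = \<zero>\<^bsub>U\<^esub>" if "s \<ge> max n m" "a \<in> rdeg R s" for s a
    using that n[of s a] m[of s a] c rdeg_carr[OF that(2)] by (simp add: U.smult_r_distr)
  then show ?thesis using pregradedD(5)[OF U d] unfolding htors_def by blast
qed

lemma htors_smult:
  assumes U: "pregraded R U" and x: "x \<in> htors R U r" and b: "b \<in> rdeg R k"
  shows "b \<odot>\<^bsub>U\<^esub> x \<in> htors R U (int k + r)"
proof -
  interpret U: module R U by (rule pregradedD(1)[OF U])
  obtain n where n: "\<And>s a. s \<ge> n \<Longrightarrow> a \<in> rdeg R s \<Longrightarrow> a \<odot>\<^bsub>U\<^esub> x = \<zero>\<^bsub>U\<^esub>" using x unfolding htors_def by blast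
  have d: "x \<in> mdeg U r" using x unfolding htors_def by auto
  then have c: "x \<in> carrier U" using pregradedD(3)[OF U] by blast
  have "a \<odot>\<^bsub>U\<^esub> (b \<odot>\<^bsub>U\<^esub> x) = \<zero>\<^bsub>U\<^esub>" if "s \<ge> n" "a \<in> rdeg R s" for s a
  proof -
    have "a \<odot>\<^bsub>U\<^esub> (b \<odot>\<^bsub>U\<^esub> x) = b \<odot>\<^bsub>U\<^esub> (a \<odot>\<^bsub>U\<^esub> x)"
      using c rdeg_carr[OF that(2)] rdeg_carr[OF b] by (metis U.smult_assoc1 m_comm)
    then show ?thesis using n[OF that] rdeg_carr[OF b] by simp
  qed
  then show ?thesis using pregradedD(7)[OF U b d] unfolding htors_def by blast
qed

lemma htors_minus:
  assumes U: "pregraded R U" and x: "x \<in> htors R U r"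
  shows "\<ominus>\<^bsub>U\<^esub> x \<in> htors R U r"
proof -
  interpret U: module R U by (rule pregradedD(1)[OF U])
  have "x \<in> carrier U" using x pregradedD(3)[OF U] unfolding htors_def by blast
  then show ?thesis using htors_smult[OF U x rdeg_add_simps(4)[OF rdeg_one]]
    by (simp add: U.smult_l_minus)
qed

lemma htors_zero: "pregraded R U \<Longrightarrow> \<zero>\<^bsub>U\<^esub> \<in> htors R U r"
  using pregradedD(4)[of U r] module.smult_r_null[OF pregradedD(1)] rdeg_carr
  unfolding htors_def by blast

lemma htors_cone:
  "Node x y \<in> htors R (cone_module U V) r \<longleftrightarrow> x \<in> htors R U r \<and> y \<in> htors R V (r - 1)"
proof
  assume "x \<in> htors R U r \<and> y \<in> htors R V (r - 1)"
  then obtain n m where d: "x \<in> mdeg U r" "y \<in> mdeg V (r - 1)"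
    "\<forall>s\<ge>n. \<forall>a\<in>rdeg R s. a \<odot>\<^bsub>U\<^esub> x = \<zero>\<^bsub>U\<^esub>" "\<forall>s\<ge>m. \<forall>a\<in>rdeg R s. a \<odot>\<^bsub>V\<^esub> y = \<zero>\<^bsub>V\<^esub>"
    unfolding htors_def by blast
  then show "Node x y \<in> htors R (cone_module U V) r"
    unfolding htors_def by (auto simp: cone_module_simps intro!: exI[of _ "max n m"])
qed (auto simp: htors_def cone_module_simps)

lemma cone_module_pregraded:
  assumes U: "pregraded R U" and V: "pregraded R V"
  shows "pregraded R (cone_module U V)"
proof -
  interpret U: module R U by (rule pregradedD(1)[OF U])
  interpret V: module R V by (rule pregradedD(1)[OF V])
  let ?C = "cone_module U V"
  note UD = pregradedD[OF U] and VD = pregradedD[OF V]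
  have ab: "abelian_group ?C"
  proof (rule abelian_groupI)
    fix u assume "u \<in> carrier ?C"
    then obtain x y where u: "u = Node x y" "x \<in> carrier U" "y \<in> carrier V"
      using cone_module_cases(1) by blast
    then show "\<exists>v\<in>carrier ?C. v \<oplus>\<^bsub>?C\<^esub> u = \<zero>\<^bsub>?C\<^esub>"
      by (intro bexI[of _ "Node (\<ominus>\<^bsub>U\<^esub> x) (\<ominus>\<^bsub>V\<^esub> y)"]) (auto simp: cone_module_simps U.M.l_neg V.M.l_neg)
  qed (auto dest!: cone_module_cases(1) simp: cone_module_simps U.M.a_ac V.M.a_ac)
  have mod: "module R ?C"
    by (rule moduleI[OF is_cring ab])
      (auto dest!: cone_module_cases(1) simp: cone_module_simps U.smult_l_distr V.smult_l_distr
        U.smult_r_distr V.smult_r_distr U.smult_assoc1 V.smult_assoc1)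
  interpret C: module R ?C by (rule mod)
  have neg: "\<ominus>\<^bsub>?C\<^esub> (Node x y) = Node (\<ominus>\<^bsub>U\<^esub> x) (\<ominus>\<^bsub>V\<^esub> y)" if "x \<in> carrier U" "y \<in> carrier V" for x y
    by (rule C.M.minus_equality) (use that in \<open>auto simp: cone_module_simps U.M.l_neg V.M.l_neg\<close>)
  have "subgroup (mdeg ?C r) (add_monoid ?C)" for r
  proof (rule C.M.add.subgroupI)
    have "Node \<zero>\<^bsub>U\<^esub> \<zero>\<^bsub>V\<^esub> \<in> mdeg ?C r" using UD(4) VD(4) by (simp add: cone_module_simps)
    then show "mdeg ?C r \<noteq> {}" by blast
    show "mdeg ?C r \<subseteq> carrier ?C"
    proof
      fix u assume "u \<in> mdeg ?C r"
      from cone_module_cases(2)[OF this] show "u \<in> carrier ?C" using UD(9) VD(9)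
        by (auto simp: cone_module_simps)
    qed
    fix u assume "u \<in> mdeg ?C r"
    then obtain x y where u: "u = Node x y" "x \<in> mdeg U r" "y \<in> mdeg V (r - 1)"
      using cone_module_cases(2) by blast
    show "\<ominus>\<^bsub>?C\<^esub> u \<in> mdeg ?C r"
      using u neg UD(9)[OF u(2)] VD(9)[OF u(3)] UD(6)[OF u(2)] VD(6)[OF u(3)]
      by (simp add: cone_module_simps)
    fix v assume "v \<in> mdeg ?C r"
    then obtain x' y' where v: "v = Node x' y'" "x' \<in> mdeg U r" "y' \<in> mdeg V (r - 1)"
      using cone_module_cases(2) by blast
    show "u \<oplus>\<^bsub>?C\<^esub> v \<in> mdeg ?C r"
      using u v UD(5)[OF u(2) v(2)] VD(5)[OF u(3) v(3)] by (simp add: cone_module_simps)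
  qed
  moreover have "a \<odot>\<^bsub>?C\<^esub> u \<in> mdeg ?C (int n + r)" if a: "a \<in> rdeg R n" and u0: "u \<in> mdeg ?C r" for a n u r
  proof -
    obtain x y where u: "u = Node x y" "x \<in> mdeg U r" "y \<in> mdeg V (r - 1)"
      using cone_module_cases(2)[OF u0] by blast
    show ?thesis using u UD(7)[OF a u(2)] VD(7)[OF a u(3)] by (simp add: cone_module_simps algebra_simps)
  qed
  ultimately show "pregraded R ?C" using mod unfolding pregraded_def by blast
qed

lemma cone_module_baer:
  assumes U: "baer_injective R U" and V: "baer_injective R V"
  shows "baer_injective R (cone_module U V)"
  unfolding baer_injective_def
proof (intro allI impI)
  let ?C = "cone_module U V"
  fix r I \<phi>
  assume A: "ideal_hom R ?C r I \<phi>"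
  note I = ideal_homD(1-4)[OF A] and phi = ideal_homD(5-7)[OF A]
  define f where "f = (\<lambda>k a. lft (\<phi> k a))"
  define g where "g = (\<lambda>k a. rgt (\<phi> k a))"
  have fg: "\<phi> k a = Node (f k a) (g k a)" "f k a \<in> mdeg U k" "g k a \<in> mdeg V (k - 1)"
    if "a \<in> I k" for k a
    using cone_module_cases(2)[OF phi(1)[OF that]] by (auto simp: f_def g_def)
  have add: "f k (a \<oplus> b) = f k a \<oplus>\<^bsub>U\<^esub> f k b" "g k (a \<oplus> b) = g k a \<oplus>\<^bsub>V\<^esub> g k b"
    if "a \<in> I k" "b \<in> I k" for k a b
    using phi(2)[OF that] fg(1)[OF that(1)] fg(1)[OF that(2)] fg(1)[OF I(3)[OF that]]
    by (simp_all add: cone_module_simps)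
  have mul: "f (int n + k) (b \<otimes> a) = b \<odot>\<^bsub>U\<^esub> f k a" "g (int n + k) (b \<otimes> a) = b \<odot>\<^bsub>V\<^esub> g k a"
    if "b \<in> rdeg R n" "a \<in> I k" for k a b n
    using phi(3)[OF that] fg(1)[OF that(2)] fg(1)[OF I(4)[OF that]]
    by (simp_all add: cone_module_simps)
  have "\<exists>x\<in>mdeg U r. \<forall>k. \<forall>a\<in>I k. f k a = a \<odot>\<^bsub>U\<^esub> x"
    by (rule baer_injectiveD[OF U], unfold ideal_hom_def)
      (intro conjI allI ballI I fg(2) add(1) mul(1); assumption)
  then obtain x where x: "x \<in> mdeg U r" "\<And>k a. a \<in> I k \<Longrightarrow> f k a = a \<odot>\<^bsub>U\<^esub> x" by blast
  \<comment> \<open>V enters the cone as V(-1), so the second components form a homomorphism into V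
    from an ideal of R(-(r - 1)), obtained by reindexing.\<close>
  define J where "J = (\<lambda>k. I (k + 1))"
  define h where "h = (\<lambda>k. g (k + 1))"
  have "\<exists>y\<in>mdeg V (r - 1). \<forall>k. \<forall>a\<in>J k. h k a = a \<odot>\<^bsub>V\<^esub> y"
  proof (rule baer_injectiveD[OF V], unfold ideal_hom_def, intro conjI allI ballI)
    fix k
    show "J k \<subseteq> zdeg R (k - (r - 1))" using I(1)[of "k + 1"] by (simp add: J_def algebra_simps)
    show "h k a \<in> mdeg V k" if "a \<in> J k" for a
      using fg(3)[of a "k + 1"] that by (simp add: J_def h_def)
    show "b \<otimes> a \<in> J (int n + k)" "h (int n + k) (b \<otimes> a) = b \<odot>\<^bsub>V\<^esub> h k a"
      if "b \<in> rdeg R n" "a \<in> J k" for a b n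
      using that I(4)[of b n a "k + 1"] mul(2)[of b n a "k + 1"] by (simp_all add: J_def h_def add.assoc)
  qed (use I add in \<open>auto simp: J_def h_def\<close>)
  then obtain y where y: "y \<in> mdeg V (r - 1)" "\<And>k a. a \<in> J k \<Longrightarrow> h k a = a \<odot>\<^bsub>V\<^esub> y" by blast
  have "\<phi> k a = a \<odot>\<^bsub>?C\<^esub> Node x y" if "a \<in> I k" for k a
    using fg(1)[OF that] x(2)[OF that] y(2)[of a "k - 1"] that by (simp add: J_def h_def cone_module_simps)
  moreover have "Node x y \<in> mdeg ?C r" using x y by (simp add: cone_module_simps)
  ultimately show "\<exists>u\<in>mdeg ?C r. \<forall>k. \<forall>a\<in>I k. \<phi> k a = a \<odot>\<^bsub>?C\<^esub> u" by blast
qed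

end

section \<open>Complexes of injectives and the torsion cohomology of a cone\<close>

locale injective_complex = graded_ring_base R for R :: "'a graded_ring" (structure) +
  fixes D :: "int \<Rightarrow> ('a, 'x) graded_module" and \<delta> :: "int \<Rightarrow> 'x \<Rightarrow> 'x"
  assumes pregr: "pregraded R (D j)"
    and baer: "baer_injective R (D j)"
    and diff: "\<delta> j \<in> graded_hom R (D j) (D (j + 1))"
    and diff2: "x \<in> carrier (D j) \<Longrightarrow> \<delta> (j + 1) (\<delta> j x) = \<zero>\<^bsub>D (j + 1 + 1)\<^esub>"
begin

lemma Dmod: "module R (D j)" by (rule pregradedD(1)[OF pregr])

lemmas Dcarr = pregradedD(9)[OF pregr]
lemmas Ddeg_zero = pregradedD(4)[OF pregr]
lemmas Ddeg_add = pregradedD(5)[OF pregr]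
lemmas Ddeg_minus = pregradedD(6)[OF pregr]
lemmas Ddeg_smult = pregradedD(7)[OF pregr]
lemmas diff_carr = graded_homD(1)[OF diff]
lemmas diff_add = graded_homD(2)[OF diff]
lemmas diff_smult = graded_homD(3)[OF diff]
lemmas diff_deg = graded_homD(4)[OF diff]
lemmas diff_zero = graded_hom_zero[OF diff Dmod Dmod]
lemmas diff_minus = graded_hom_minus[OF diff Dmod Dmod]

end

context
  fixes R :: "'a graded_ring" (structure) and D :: "int \<Rightarrow> ('a, 'e ktree) graded_module" and \<delta> z
  assumes ic: "injective_complex R D \<delta>" and z: "z \<in> rdeg R 1"
begin

interpretation injective_complex R D \<delta> by (rule ic)

text \<open>Keeps indices in the form \<open>j + 1 + 1\<close>, in which the facts about the differential are stated.\<close>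
declare [[simproc del: int_combine_numerals]]

lemma z_carr: "z \<in> carrier R" using z by blast

lemma cone_diff_Node:
  "cone_diff z D \<delta> j (Node x y) = Node (\<delta> j x \<oplus>\<^bsub>D (j + 1)\<^esub> z \<odot>\<^bsub>D (j + 1)\<^esub> y) (\<ominus>\<^bsub>D (j + 1 + 1)\<^esub> \<delta> (j + 1) y)"
  by (simp add: cone_diff_def)

lemma z_deg: "y \<in> mdeg (D j) (r - 1) \<Longrightarrow> z \<odot>\<^bsub>D j\<^esub> y \<in> mdeg (D j) r"
  using Ddeg_smult[OF z, of y j "r - 1"] by simp

lemma z_htors: "y \<in> htors R (D j) (r - 1) \<Longrightarrow> z \<odot>\<^bsub>D j\<^esub> y \<in> htors R (D j) r"
  using htors_smult[OF pregr _ z, of y j "r - 1"] by simp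

lemma cone_injective_complex: "injective_complex R (cone_complex D) (cone_diff z D \<delta>)"
proof
  fix j
  let ?A = "D j" and ?B = "D (j + 1)" and ?C = "D (j + 1 + 1)"
  interpret A: module R ?A by (rule Dmod)
  interpret B: module R ?B by (rule Dmod)
  interpret C: module R ?C by (rule Dmod)
  show "pregraded R (cone_complex D j)"
    unfolding cone_complex_def by (rule cone_module_pregraded[OF pregr pregr])
  show "baer_injective R (cone_complex D j)"
    unfolding cone_complex_def by (rule cone_module_baer[OF baer baer])
  note cl = diff_carr[of _ j] diff_carr[of _ "j + 1"] z_carr
  show "cone_diff z D \<delta> j \<in> graded_hom R (cone_complex D j) (cone_complex D (j + 1))"
    unfolding graded_hom_def cone_complex_def mem_Collect_eq
  proof (intro conjI ballI allI subsetI funcsetI)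
    fix u assume "u \<in> carrier (cone_module ?A ?B)"
    then obtain x y where u: "u = Node x y" "x \<in> carrier ?A" "y \<in> carrier ?B"
      using cone_module_cases(1) by blast
    show "cone_diff z D \<delta> j u \<in> carrier (cone_module ?B ?C)"
      using u cl by (simp add: cone_diff_Node cone_module_simps)
    show "cone_diff z D \<delta> j (a \<odot>\<^bsub>cone_module ?A ?B\<^esub> u) = a \<odot>\<^bsub>cone_module ?B ?C\<^esub> cone_diff z D \<delta> j u"
      if a: "a \<in> carrier R" for a
    proof -
      have "z \<odot>\<^bsub>?B\<^esub> (a \<odot>\<^bsub>?B\<^esub> y) = a \<odot>\<^bsub>?B\<^esub> (z \<odot>\<^bsub>?B\<^esub> y)"
        using u a z_carr by (metis B.smult_assoc1 m_comm)
      then show ?thesis using u cl a diff_smult[OF a u(2)] diff_smult[OF a u(3)]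
        by (simp add: cone_diff_Node cone_module_simps B.smult_r_distr C.smult_r_minus)
    qed
    fix v assume "v \<in> carrier (cone_module ?A ?B)"
    then obtain x' y' where v: "v = Node x' y'" "x' \<in> carrier ?A" "y' \<in> carrier ?B"
      using cone_module_cases(1) by blast
    show "cone_diff z D \<delta> j (u \<oplus>\<^bsub>cone_module ?A ?B\<^esub> v) =
        cone_diff z D \<delta> j u \<oplus>\<^bsub>cone_module ?B ?C\<^esub> cone_diff z D \<delta> j v"
      using u v cl diff_add[OF u(2) v(2)] diff_add[OF u(3) v(3)]
      by (simp add: cone_diff_Node cone_module_simps B.smult_r_distr B.M.a_ac C.M.minus_add)
  next
    fix r w assume "w \<in> cone_diff z D \<delta> j ` mdeg (cone_module ?A ?B) r"
    then obtain x y where u: "w = cone_diff z D \<delta> j (Node x y)" "x \<in> mdeg ?A r" "y \<in> mdeg ?B (r - 1)"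
      using cone_module_cases(2) by blast
    show "w \<in> mdeg (cone_module ?B ?C) r"
      using u Ddeg_add[OF diff_deg[OF u(2)] z_deg[OF u(3)]] Ddeg_minus[OF diff_deg[OF u(3)]]
      by (simp add: cone_diff_Node cone_module_simps)
  qed
  fix u assume "u \<in> carrier (cone_complex D j)"
  then obtain x y where u: "u = Node x y" "x \<in> carrier ?A" "y \<in> carrier ?B"
    unfolding cone_complex_def using cone_module_cases(1) by blast
  let ?E = "D (j + 1 + 1 + 1)"
  interpret E: module R ?E by (rule Dmod)
  have "\<delta> (j + 1) (\<delta> j x \<oplus>\<^bsub>?B\<^esub> z \<odot>\<^bsub>?B\<^esub> y) = z \<odot>\<^bsub>?C\<^esub> \<delta> (j + 1) y"
    using u cl by (simp add: diff_add diff_smult diff2)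
  then have "\<delta> (j + 1) (\<delta> j x \<oplus>\<^bsub>?B\<^esub> z \<odot>\<^bsub>?B\<^esub> y) \<oplus>\<^bsub>?C\<^esub> z \<odot>\<^bsub>?C\<^esub> (\<ominus>\<^bsub>?C\<^esub> \<delta> (j + 1) y) = \<zero>\<^bsub>?C\<^esub>"
    using u cl by (simp add: C.smult_r_minus C.M.r_neg)
  moreover have "\<delta> (j + 1 + 1) (\<ominus>\<^bsub>?C\<^esub> \<delta> (j + 1) y) = \<zero>\<^bsub>?E\<^esub>"
    using diff_minus[OF diff_carr[OF u(3)]] diff2[OF u(3)] by simp
  ultimately show "cone_diff z D \<delta> (j + 1) (cone_diff z D \<delta> j u) = \<zero>\<^bsub>cone_complex D (j + 1 + 1)\<^esub>"
    unfolding u(1) cone_diff_Node cone_complex_def cone_module_simps by simp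
qed

text \<open>Multiply a nonzero class by a power of \<open>z\<close> that is as large as possible; the last nonzero
  multiple lies in the image of the connecting map.\<close>
lemma tors_coh_cone_lower:
  assumes "tors_coh_nz R D \<delta> (j + 1) r"
  shows "\<exists>k\<ge>r + 1. tors_coh_nz R (cone_complex D) (cone_diff z D \<delta>) j k"
proof -
  let ?B = "D (j + 1)" and ?C = "D (j + 1 + 1)"
  interpret A: module R "D j" by (rule Dmod)
  interpret B: module R ?B by (rule Dmod)
  interpret C: module R ?C by (rule Dmod)
  obtain x where x: "x \<in> htors R ?B r" "\<delta> (j + 1) x = \<zero>\<^bsub>?C\<^esub>"
    "\<And>w. w \<in> htors R (D j) r \<Longrightarrow> \<delta> j w \<noteq> x"
    using assms unfolding tors_coh_nz_def by auto
  define y where "y = (\<lambda>k. ((\<lambda>v. z \<odot>\<^bsub>?B\<^esub> v) ^^ k) x)"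
  have y: "y k \<in> htors R ?B (r + int k) \<and> \<delta> (j + 1) (y k) = \<zero>\<^bsub>?C\<^esub>" for k
  proof (induction k)
    case (Suc k)
    have "y k \<in> carrier ?B" using Suc Dcarr unfolding htors_def by blast
    then have "\<delta> (j + 1) (z \<odot>\<^bsub>?B\<^esub> y k) = \<zero>\<^bsub>?C\<^esub>" using Suc z_carr by (simp add: diff_smult)
    moreover have "y k \<in> htors R ?B (r + int (Suc k) - 1)" using Suc by (simp add: algebra_simps)
    ultimately show ?case using z_htors by (simp add: y_def)
  qed (use x in \<open>simp add: y_def\<close>)
  obtain n where n: "\<And>s a. s \<ge> n \<Longrightarrow> a \<in> rdeg R s \<Longrightarrow> a \<odot>\<^bsub>?B\<^esub> x = \<zero>\<^bsub>?B\<^esub>"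
    using x(1) unfolding htors_def by blast
  have xc: "x \<in> carrier ?B" using x(1) Dcarr unfolding htors_def by blast
  have zpow: "z [^] k \<in> rdeg R k" for k :: nat
  proof (induction k)
    case (Suc k)
    show ?case using rdeg_mult[OF Suc z] by simp
  qed (use rdeg_one in simp)
  have ypow: "y k = (z [^] k) \<odot>\<^bsub>?B\<^esub> x" for k
  proof (induction k)
    case (Suc k)
    have "y (Suc k) = z \<odot>\<^bsub>?B\<^esub> ((z [^] k) \<odot>\<^bsub>?B\<^esub> x)" using Suc by (simp add: y_def)
    also have "\<dots> = (z [^] k \<otimes> z) \<odot>\<^bsub>?B\<^esub> x" using z_carr xc by (metis B.smult_assoc1 m_comm nat_pow_closed)
    finally show ?case by simp
  qed (use xc in \<open>simp add: y_def\<close>)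
  \<comment> \<open>z^n has degree n, and from degree n on every homogeneous element annihilates
    x.\<close>
  have yn: "y n = \<zero>\<^bsub>?B\<^esub>" using n[OF le_refl zpow] ypow by simp
  \<comment> \<open>\<open>P k\<close> says that the class of z^k x vanishes. It is false for k = 0
    and true for k = n, so it changes between some k and k + 1.\<close>
  define P where "P = (\<lambda>k. \<exists>w\<in>htors R (D j) (r + int k). \<delta> j w = y k)"
  have "P n" unfolding P_def yn using htors_zero[OF pregr] diff_zero by blast
  moreover have "\<not> P 0" unfolding P_def y_def using x(3) by auto
  ultimately obtain k where k: "\<not> P k" "P (Suc k)"
    using ex_least_nat_less[of P n] by auto
  then obtain w where w: "w \<in> htors R (D j) (r + int (Suc k))" "\<delta> j w = y (Suc k)"
    unfolding P_def by blast
  have wc: "w \<in> carrier (D j)" using w Dcarr unfolding htors_def by blast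
  have ykc: "y k \<in> carrier ?B" using y[of k] Dcarr unfolding htors_def by blast
  have ySuc: "y (Suc k) = z \<odot>\<^bsub>?B\<^esub> y k" by (simp add: y_def)
  \<comment> \<open>A cocycle, because \<delta> w = z (z^k x). Its second component z^k x has degree
    r + k, so the pair has degree r + 1 + k.\<close>
  let ?u = "Node (\<ominus>\<^bsub>D j\<^esub> w) (y k)"
  have "?u \<in> htors R (cone_complex D j) (r + 1 + int k)"
    unfolding cone_complex_def htors_cone
    using htors_minus[OF pregr w(1)] y[of k] by (simp add: algebra_simps)
  moreover have "cone_diff z D \<delta> j ?u = \<zero>\<^bsub>cone_complex D (j + 1)\<^esub>"
    unfolding cone_complex_def cone_module_simps cone_diff_Node
    using diff_minus[OF wc] w(2) y[of k] ySuc ykc z_carr by (simp add: B.M.l_neg)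
  \<comment> \<open>The second component of a boundary is -\<delta> b with b torsion; hence the
    class of z^k x would vanish, against the choice of k.\<close>
  moreover have "cone_diff z D \<delta> (j - 1) v \<noteq> ?u"
    if v: "v \<in> htors R (cone_complex D (j - 1)) (r + 1 + int k)" for v
  proof
    assume eq: "cone_diff z D \<delta> (j - 1) v = ?u"
    obtain a b where ab: "v = Node a b"
      using v cone_module_cases(2) unfolding htors_def cone_complex_def by blast
    then have b: "b \<in> htors R (D j) (r + int k)"
      using v unfolding cone_complex_def ab htors_cone by (simp add: algebra_simps)
    have "y k = \<ominus>\<^bsub>?B\<^esub> \<delta> j b" using eq unfolding ab cone_diff_Node by simp
    also have "\<dots> = \<delta> j (\<ominus>\<^bsub>D j\<^esub> b)"
      using diff_minus[of b j] b Dcarr unfolding htors_def by auto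
    finally have "P k" unfolding P_def using htors_minus[OF pregr b] by metis
    then show False using k by blast
  qed
  ultimately have "tors_coh_nz R (cone_complex D) (cone_diff z D \<delta>) j (r + 1 + int k)"
    unfolding tors_coh_nz_def by blast
  then show ?thesis by (intro exI[of _ "r + 1 + int k"]) auto
qed

text \<open>Exactness of the long exact sequence at the cohomology of the cone. The component y of a
  cocycle (x, y) is closed; if y = \<delta> w with w torsion, then (x, y) is cohomologous to (x + z
  w, 0), whose class comes from D in the same cohomological degree.\<close>

lemma tors_coh_cone_upper:
  assumes "tors_coh_nz R (cone_complex D) (cone_diff z D \<delta>) j r"
  shows "tors_coh_nz R D \<delta> j r \<or> tors_coh_nz R D \<delta> (j + 1) (r - 1)"
proof (rule ccontr)
  assume neg: "\<not> ?thesis"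
  let ?A = "D j" and ?B = "D (j + 1)" and ?C = "D (j + 1 + 1)"
  interpret A: module R ?A by (rule Dmod)
  interpret B: module R ?B by (rule Dmod)
  interpret C: module R ?C by (rule Dmod)
  obtain u where u: "u \<in> htors R (cone_complex D j) r"
    "cone_diff z D \<delta> j u = \<zero>\<^bsub>cone_complex D (j + 1)\<^esub>"
    "\<And>w. w \<in> htors R (cone_complex D (j - 1)) r \<Longrightarrow> cone_diff z D \<delta> (j - 1) w \<noteq> u"
    using assms unfolding tors_coh_nz_def by blast
  obtain x y where xy: "u = Node x y"
    using u(1) cone_module_cases(2) unfolding htors_def cone_complex_def by blast
  have x: "x \<in> htors R ?A r" and y: "y \<in> htors R ?B (r - 1)"
    using u(1) unfolding xy cone_complex_def htors_cone by auto
  have xc: "x \<in> carrier ?A" "y \<in> carrier ?B" using x y Dcarr unfolding htors_def by blast+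
  have e1: "\<delta> j x \<oplus>\<^bsub>?B\<^esub> z \<odot>\<^bsub>?B\<^esub> y = \<zero>\<^bsub>?B\<^esub>" and e2: "\<ominus>\<^bsub>?C\<^esub> \<delta> (j + 1) y = \<zero>\<^bsub>?C\<^esub>"
    using u(2) unfolding xy cone_diff_Node cone_complex_def cone_module_simps by auto
  have "\<delta> (j + 1) y = \<zero>\<^bsub>?C\<^esub>" using e2 diff_carr[OF xc(2)] by simp
  then obtain w where w: "w \<in> htors R ?A (r - 1)" "\<delta> j w = y"
    using neg y unfolding tors_coh_nz_def by auto
  have wc: "w \<in> carrier ?A" using w Dcarr unfolding htors_def by blast
  have xw: "x \<oplus>\<^bsub>?A\<^esub> z \<odot>\<^bsub>?A\<^esub> w \<in> htors R ?A r" by (rule htors_add[OF pregr x z_htors[OF w(1)]])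
  have "\<delta> j (x \<oplus>\<^bsub>?A\<^esub> z \<odot>\<^bsub>?A\<^esub> w) = \<zero>\<^bsub>?B\<^esub>"
    using xc wc w(2) e1 z_carr by (simp add: diff_add diff_smult)
  then obtain v where v: "v \<in> htors R (D (j - 1)) r" "\<delta> (j - 1) v = x \<oplus>\<^bsub>?A\<^esub> z \<odot>\<^bsub>?A\<^esub> w"
    using neg xw unfolding tors_coh_nz_def by blast
  have "Node v (\<ominus>\<^bsub>?A\<^esub> w) \<in> htors R (cone_complex D (j - 1)) r"
    unfolding cone_complex_def htors_cone using v htors_minus[OF pregr w(1)] by simp
  moreover have "cone_diff z D \<delta> (j - 1) (Node v (\<ominus>\<^bsub>?A\<^esub> w)) = u"
  proof -
    have "x \<oplus>\<^bsub>?A\<^esub> z \<odot>\<^bsub>?A\<^esub> w \<oplus>\<^bsub>?A\<^esub> z \<odot>\<^bsub>?A\<^esub> (\<ominus>\<^bsub>?A\<^esub> w) = x"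
      using xc wc z_carr by (simp add: A.smult_r_minus A.M.a_assoc A.M.r_neg)
    moreover have "\<ominus>\<^bsub>?B\<^esub> \<delta> j (\<ominus>\<^bsub>?A\<^esub> w) = y"
      using diff_minus[OF wc] w(2) xc by simp
    ultimately show ?thesis unfolding cone_diff_Node xy using v(2) by simp
  qed
  ultimately show False using u(3) by blast
qed

end

section \<open>Lifting along complexes of injectives\<close>

text \<open>The situation after \<open>i\<close> cones: \<open>D\<close> is a complex of injectives that is exact in positive
  cohomological degrees and, in large internal degrees, also in negative ones, and
  \<open>H\<^sup>0(D) = M/Q\<close>.\<close>
locale koszul_stage = injective_complex R D \<delta>
  for R :: "'a graded_ring" (structure) and D :: "int \<Rightarrow> ('a, 'x) graded_module" and \<delta> +
  fixes M :: "('a, 'm) graded_module" and \<epsilon> :: "'m \<Rightarrow> 'x" and Q :: "int \<Rightarrow> 'm set"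
    and N low :: int
  assumes Mgr: "pregraded R M"
    and low: "j < low \<Longrightarrow> carrier (D j) = {\<zero>\<^bsub>D j\<^esub>}"
    and exact_pos: "0 \<le> j \<Longrightarrow> x \<in> mdeg (D (j + 1)) r \<Longrightarrow> \<delta> (j + 1) x = \<zero>\<^bsub>D (j + 1 + 1)\<^esub> \<Longrightarrow>
      \<exists>w\<in>mdeg (D j) r. \<delta> j w = x"
    and exact_neg: "j + 1 < 0 \<Longrightarrow> N \<le> r \<Longrightarrow> x \<in> mdeg (D (j + 1)) r \<Longrightarrow>
      \<delta> (j + 1) x = \<zero>\<^bsub>D (j + 1 + 1)\<^esub> \<Longrightarrow> \<exists>w\<in>mdeg (D j) r. \<delta> j w = x"
    and eps: "\<epsilon> \<in> graded_hom R M (D 0)"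
    and eps_cocycle: "m \<in> carrier M \<Longrightarrow> \<delta> 0 (\<epsilon> m) = \<zero>\<^bsub>D 1\<^esub>"
    and eps_surj: "x \<in> mdeg (D 0) r \<Longrightarrow> \<delta> 0 x = \<zero>\<^bsub>D 1\<^esub> \<Longrightarrow>
      \<exists>m\<in>mdeg M r. \<exists>w\<in>mdeg (D (-1)) r. x = \<epsilon> m \<oplus>\<^bsub>D 0\<^esub> \<delta> (-1) w"
    and eps_kernel: "m \<in> mdeg M r \<Longrightarrow> (\<exists>w\<in>mdeg (D (-1)) r. \<delta> (-1) w = \<epsilon> m) \<longleftrightarrow> m \<in> Q r"
begin

declare [[simproc del: int_combine_numerals]]

text \<open>Splitting from the left end. If h is given at j, then 1 - \<delta> h kills the cocycles
  of D(j+1) in degrees at least N, so there it factors through the next differential; injectivity of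
  D(j+1) extends the factor from the boundaries to all of D(j+2). Exactness is used only at places j
  + 1 < 0, and the last map obtained leads from D(0) to D(-1).\<close>

lemma lifting_homotopy:
  assumes "j < 0"
  shows "\<exists>h. partial_hom R (D (j + 1)) (D j) (mdeg (D (j + 1))) h \<and>
     (\<forall>r\<ge>N. \<forall>w\<in>mdeg (D j) r. \<delta> j (h r (\<delta> j w)) = \<delta> j w)"
proof -
  let ?H = "\<lambda>j. \<exists>h. partial_hom R (D (j + 1)) (D j) (mdeg (D (j + 1))) h \<and>
     (\<forall>r\<ge>N. \<forall>w\<in>mdeg (D j) r. \<delta> j (h r (\<delta> j w)) = \<delta> j w)"
  have base: "?H j" if "j < low" for j
  proof -
    interpret A: module R "D j" by (rule Dmod)
    interpret B: module R "D (j + 1)" by (rule Dmod)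
    have "partial_hom R (D (j + 1)) (D j) (mdeg (D (j + 1))) (\<lambda>_ _. \<zero>\<^bsub>D j\<^esub>)"
      unfolding partial_hom_def using Ddeg_zero Ddeg_add Ddeg_smult rdeg_carr by auto
    moreover have "\<delta> j \<zero>\<^bsub>D j\<^esub> = \<delta> j w" if "w \<in> mdeg (D j) r" for w r
      using low[OF \<open>j < low\<close>] Dcarr[OF that] by simp
    ultimately show ?thesis by blast
  qed
  have step: "?H (j + 1)" if H: "?H j" and j: "j + 1 < 0" for j
  proof -
    let ?A = "D j" and ?B = "D (j + 1)" and ?C = "D (j + 1 + 1)"
    interpret A: module R ?A by (rule Dmod)
    interpret B: module R ?B by (rule Dmod)
    interpret C: module R ?C by (rule Dmod)
    obtain h where h: "partial_hom R ?B ?A (mdeg ?B) h"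
      and hd: "\<And>r w. r \<ge> N \<Longrightarrow> w \<in> mdeg ?A r \<Longrightarrow> \<delta> j (h r (\<delta> j w)) = \<delta> j w" using H by blast
    note h1 = partial_homD(5)[OF h] and h2 = partial_homD(6)[OF h] and h3 = partial_homD(7)[OF h]
    \<comment> \<open>The map 1 - \<delta> h, which is to be factored through the next
      differential.\<close>
    define p where "p = (\<lambda>r x. x \<oplus>\<^bsub>?B\<^esub> \<ominus>\<^bsub>?B\<^esub> \<delta> j (h r x))"
    have hc: "h r x \<in> carrier ?A" if "x \<in> mdeg ?B r" for r x using Dcarr[OF h1[OF that]] .
    have pd: "p r x \<in> mdeg ?B r" if "x \<in> mdeg ?B r" for r x
      unfolding p_def using Ddeg_add Ddeg_minus diff_deg h1 that by blast
    have p2: "p r (x \<oplus>\<^bsub>?B\<^esub> y) = p r x \<oplus>\<^bsub>?B\<^esub> p r y" if xy: "x \<in> mdeg ?B r" "y \<in> mdeg ?B r" for r x y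
    proof -
      have "\<delta> j (h r (x \<oplus>\<^bsub>?B\<^esub> y)) = \<delta> j (h r x) \<oplus>\<^bsub>?B\<^esub> \<delta> j (h r y)"
        using h2[OF xy] diff_add[OF hc[OF xy(1)] hc[OF xy(2)]] by simp
      then show ?thesis
        using Dcarr[OF xy(1)] Dcarr[OF xy(2)] diff_carr[OF hc[OF xy(1)]] diff_carr[OF hc[OF xy(2)]]
        by (simp add: p_def B.M.minus_add B.M.a_ac)
    qed
    have p3: "p (int n + r) (a \<odot>\<^bsub>?B\<^esub> x) = a \<odot>\<^bsub>?B\<^esub> p r x" if a: "a \<in> rdeg R n" and x: "x \<in> mdeg ?B r" for n r a x
      using h3[OF a x] diff_smult[OF rdeg_carr[OF a] hc[OF x]] Dcarr[OF x] diff_carr[OF hc[OF x]] rdeg_carr[OF a]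
      by (simp add: p_def B.smult_r_distr B.smult_r_minus)
    \<comment> \<open>Here exactness enters: a cocycle x is some \<delta> w, and \<delta> h \<delta>
      w = \<delta> w.\<close>
    have p0: "p r x = \<zero>\<^bsub>?B\<^esub>" if r: "N \<le> r" and x: "x \<in> mdeg ?B r" "\<delta> (j + 1) x = \<zero>\<^bsub>?C\<^esub>" for r x
    proof -
      obtain w where w: "w \<in> mdeg ?A r" "\<delta> j w = x" using exact_neg[OF j r x] by blast
      then have "\<delta> j (h r x) = x" using hd[OF r w(1)] by simp
      then show ?thesis using Dcarr[OF x(1)] by (simp add: p_def B.M.r_neg)
    qed
    have pwd: "p r x = p r y" if r: "N \<le> r" and x: "x \<in> mdeg ?B r" and y: "y \<in> mdeg ?B r"
      and e: "\<delta> (j + 1) x = \<delta> (j + 1) y" for r x y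
    proof -
      note c = Dcarr[OF x] Dcarr[OF y]
      let ?d = "x \<oplus>\<^bsub>?B\<^esub> \<ominus>\<^bsub>?B\<^esub> y"
      have d: "?d \<in> mdeg ?B r" by (rule Ddeg_add[OF x Ddeg_minus[OF y]])
      have "\<delta> (j + 1) ?d = \<zero>\<^bsub>?C\<^esub>"
        using c e diff_carr[OF c(2)] by (simp add: diff_add diff_minus C.M.r_neg)
      then have "p r ?d = \<zero>\<^bsub>?B\<^esub>" by (rule p0[OF r d])
      moreover have "x = ?d \<oplus>\<^bsub>?B\<^esub> y" using c by (simp add: B.M.a_assoc B.M.l_neg)
      ultimately have "p r x = \<zero>\<^bsub>?B\<^esub> \<oplus>\<^bsub>?B\<^esub> p r y" using p2[OF d y] by metis
      then show ?thesis using Dcarr[OF pd[OF y]] by simp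
    qed
    \<comment> \<open>Boundaries in degrees at least N and zero below. This is closed under R
      because R has no elements of negative degree.\<close>
    define S where "S = (\<lambda>r. if N \<le> r then \<delta> (j + 1) ` mdeg ?B r else {\<zero>\<^bsub>?C\<^esub>})"
    define q where "q = (\<lambda>r y. if N \<le> r then p r (SOME x. x \<in> mdeg ?B r \<and> \<delta> (j + 1) x = y) else \<zero>\<^bsub>?B\<^esub>)"
    have q: "q r (\<delta> (j + 1) x) = p r x" if r: "N \<le> r" and x: "x \<in> mdeg ?B r" for r x
    proof -
      let ?P = "\<lambda>x'. x' \<in> mdeg ?B r \<and> \<delta> (j + 1) x' = \<delta> (j + 1) x"
      have "?P (SOME x'. ?P x')" by (rule someI[of ?P x]) (use x in blast)
      then show ?thesis unfolding q_def using pwd[OF r _ x] r by simp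
    qed
    have "partial_hom R ?C ?B S q"
      unfolding partial_hom_def
    proof (intro allI conjI ballI)
      fix r
      show "S r \<subseteq> mdeg ?C r" using diff_deg Ddeg_zero by (auto simp: S_def)
      show S0: "\<zero>\<^bsub>?C\<^esub> \<in> S r" for r
        using diff_zero[of "j + 1"] Ddeg_zero[of "j + 1" r] by (auto simp: S_def image_iff) metis
      have q0: "q r \<zero>\<^bsub>?C\<^esub> = \<zero>\<^bsub>?B\<^esub>" for r
      proof (cases "N \<le> r")
        case True
        then show ?thesis using q[OF True Ddeg_zero] p0[OF True Ddeg_zero] diff_zero[of "j + 1"] by simp
      qed (simp add: q_def)
      fix x assume x: "x \<in> S r"
      show "q r x \<in> mdeg ?B r"
        using x q pd Ddeg_zero q0 by (auto simp: S_def split: if_splits)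
      show "a \<odot>\<^bsub>?C\<^esub> x \<in> S (int n + r)" "q (int n + r) (a \<odot>\<^bsub>?C\<^esub> x) = a \<odot>\<^bsub>?B\<^esub> q r x"
        if a: "a \<in> rdeg R n" for n a
      proof -
        have "a \<odot>\<^bsub>?C\<^esub> x \<in> S (int n + r) \<and> q (int n + r) (a \<odot>\<^bsub>?C\<^esub> x) = a \<odot>\<^bsub>?B\<^esub> q r x"
        proof (cases "N \<le> r")
          case True
          then obtain v where v: "v \<in> mdeg ?B r" "x = \<delta> (j + 1) v" using x by (auto simp: S_def)
          have "a \<odot>\<^bsub>?C\<^esub> x = \<delta> (j + 1) (a \<odot>\<^bsub>?B\<^esub> v)"
            using diff_smult[OF rdeg_carr[OF a] Dcarr[OF v(1)]] v by simp
          moreover have "N \<le> int n + r" using True by simp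
          ultimately show ?thesis
            using q[OF True v(1)] q[OF _ Ddeg_smult[OF a v(1)]] p3[OF a v(1)] v Ddeg_smult[OF a v(1)]
            by (auto simp: S_def)
        next
          case False
          then have "x = \<zero>\<^bsub>?C\<^esub>" using x by (simp add: S_def)
          then show ?thesis using rdeg_carr[OF a] S0 q0 by simp
        qed
        then show "a \<odot>\<^bsub>?C\<^esub> x \<in> S (int n + r)" "q (int n + r) (a \<odot>\<^bsub>?C\<^esub> x) = a \<odot>\<^bsub>?B\<^esub> q r x" by blast+
      qed
      fix y assume y: "y \<in> S r"
      have "x \<oplus>\<^bsub>?C\<^esub> y \<in> S r \<and> q r (x \<oplus>\<^bsub>?C\<^esub> y) = q r x \<oplus>\<^bsub>?B\<^esub> q r y"
      proof (cases "N \<le> r")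
        case True
        then obtain v w where v: "v \<in> mdeg ?B r" "x = \<delta> (j + 1) v" "w \<in> mdeg ?B r" "y = \<delta> (j + 1) w"
          using x y by (auto simp: S_def)
        have "x \<oplus>\<^bsub>?C\<^esub> y = \<delta> (j + 1) (v \<oplus>\<^bsub>?B\<^esub> w)"
          using diff_add[OF Dcarr[OF v(1)] Dcarr[OF v(3)]] v by simp
        then show ?thesis
          using q[OF True v(1)] q[OF True v(3)] q[OF True Ddeg_add[OF v(1,3)]] p2[OF v(1,3)] v
            Ddeg_add[OF v(1,3)] True by (auto simp: S_def)
      next
        case False
        then have "x = \<zero>\<^bsub>?C\<^esub>" "y = \<zero>\<^bsub>?C\<^esub>" using x y by (simp_all add: S_def)
        then show ?thesis using S0 q0 by simp
      qed
      then show "x \<oplus>\<^bsub>?C\<^esub> y \<in> S r" "q r (x \<oplus>\<^bsub>?C\<^esub> y) = q r x \<oplus>\<^bsub>?B\<^esub> q r y" by blast+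
    qed
    then obtain g where g: "partial_hom R ?C ?B (mdeg ?C) g" "\<And>r x. x \<in> S r \<Longrightarrow> g r x = q r x"
      by (rule baer_extension[OF pregr pregr baer]) blast
    \<comment> \<open>g \<delta> w = w - \<delta> h w, and the second term is a cocycle.\<close>
    have "\<delta> (j + 1) (g r (\<delta> (j + 1) w)) = \<delta> (j + 1) w" if r: "r \<ge> N" and w: "w \<in> mdeg ?B r" for r w
    proof -
      have "g r (\<delta> (j + 1) w) = p r w" using g(2)[of "\<delta> (j + 1) w" r] q[OF r w] w r by (simp add: S_def)
      then show ?thesis using Dcarr[OF w] diff_carr[OF hc[OF w]] diff2[OF hc[OF w]] diff_carr[OF Dcarr[OF w]]
        by (simp add: p_def diff_add diff_minus)
    qed
    then show ?thesis using g(1) by blast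
  qed
  \<comment> \<open>The induction starts just left of \<open>low\<close>, where the module is zero
    and the zero map serves as h.\<close>
  have "low - 1 + int k < 0 \<Longrightarrow> ?H (low - 1 + int k)" for k
  proof (induction k)
    case 0
    show ?case by (rule base) simp
  next
    case (Suc k)
    have e: "low - 1 + int (Suc k) = (low - 1 + int k) + 1" by simp
    show ?case unfolding e by (rule step) (use Suc in auto)
  qed
  then have "?H j" if "low - 1 \<le> j" using that assms zle_iff_zadd[of "low - 1" j] by auto
  then show ?thesis using base by (cases "j < low") auto
qed

text \<open>Baer's condition for \<open>R\<^bsub>\<ge>n\<^esub> \<subseteq> R\<close> is applied to
  \<open>a \<mapsto> h (a s)\<close>, where \<open>h\<close> is the lifting homotopy.\<close>
lemma boundary_modulo_torsion:
  assumes j: "j < 0" and s: "s \<in> mdeg (D (j + 1)) r"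
    and bd: "\<And>k a. k \<ge> n \<Longrightarrow> a \<in> rdeg R k \<Longrightarrow> \<exists>v\<in>mdeg (D j) (int k + r). \<delta> j v = a \<odot>\<^bsub>D (j + 1)\<^esub> s"
  shows "\<exists>w\<in>mdeg (D j) r. s \<oplus>\<^bsub>D (j + 1)\<^esub> \<ominus>\<^bsub>D (j + 1)\<^esub> \<delta> j w \<in> htors R (D (j + 1)) r"
proof -
  let ?A = "D j" and ?B = "D (j + 1)"
  interpret A: module R ?A by (rule Dmod)
  interpret B: module R ?B by (rule Dmod)
  obtain h where h: "partial_hom R ?B ?A (mdeg ?B) h"
    and hd: "\<And>r w. r \<ge> N \<Longrightarrow> w \<in> mdeg ?A r \<Longrightarrow> \<delta> j (h r (\<delta> j w)) = \<delta> j w"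
    using lifting_homotopy[OF j] by blast
  note h1 = partial_homD(5)[OF h] and h2 = partial_homD(6)[OF h] and h3 = partial_homD(7)[OF h]
  note sc = Dcarr[OF s]
  \<comment> \<open>From degree n on the products a s are boundaries; from N - r on their degree is
    at least N, where h lifts boundaries.\<close>
  define n' where "n' = max n (nat (N - r))"
  \<comment> \<open>The ideal of elements of degree at least \<open>n'\<close>, with the grading of
    R(-r).\<close>
  define I where "I = (\<lambda>k. if int n' \<le> k - r then zdeg R (k - r) else {\<zero>})"
  have Iz: "a \<in> I k \<Longrightarrow> a \<in> zdeg R (k - r)" for a k
    using zdeg_add_simps(2) by (auto simp: I_def split: if_splits)
  have Is: "a \<in> I k \<Longrightarrow> a \<odot>\<^bsub>?B\<^esub> s \<in> mdeg ?B k" for a k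
    using zdeg_smult[OF pregr Iz s] .
  have "\<exists>w\<in>mdeg ?A r. \<forall>k. \<forall>a\<in>I k. h k (a \<odot>\<^bsub>?B\<^esub> s) = a \<odot>\<^bsub>?A\<^esub> w"
  proof (rule baer_injectiveD[OF baer], unfold ideal_hom_def, intro conjI ballI allI)
    fix k
    show "I k \<subseteq> zdeg R (k - r)" using Iz by blast
    show "\<zero> \<in> I k" using zdeg_add_simps(2) by (simp add: I_def)
    show "h k (a \<odot>\<^bsub>?B\<^esub> s) \<in> mdeg ?A k" if "a \<in> I k" for a using h1[OF Is[OF that]] .
    fix a assume a: "a \<in> I k"
    note ac = zdeg_carr[OF Iz[OF a]]
    show "a \<oplus> b \<in> I k" if "b \<in> I k" for b
      using a that zdeg_add_simps(3) by (auto simp: I_def split: if_splits)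
    show "h k ((a \<oplus> b) \<odot>\<^bsub>?B\<^esub> s) = h k (a \<odot>\<^bsub>?B\<^esub> s) \<oplus>\<^bsub>?A\<^esub> h k (b \<odot>\<^bsub>?B\<^esub> s)" if b: "b \<in> I k" for b
      using h2[OF Is[OF a] Is[OF b]] B.smult_l_distr[OF ac zdeg_carr[OF Iz[OF b]] sc] by simp
    fix n b assume b: "b \<in> rdeg R n"
    show "b \<otimes> a \<in> I (int n + k)"
    proof (cases "int n' \<le> k - r")
      case True
      have "b \<otimes> a \<in> zdeg R (int n + k - r)" using zdeg_mult[OF b Iz[OF a]] by (simp add: algebra_simps)
      then show ?thesis using True by (simp add: I_def)
    next
      case False
      then have "a = \<zero>" using a by (simp add: I_def)
      then show ?thesis using rdeg_carr[OF b] zdeg_add_simps(2) by (simp add: I_def)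
    qed
    show "h (int n + k) ((b \<otimes> a) \<odot>\<^bsub>?B\<^esub> s) = b \<odot>\<^bsub>?A\<^esub> h k (a \<odot>\<^bsub>?B\<^esub> s)"
      using h3[OF b Is[OF a]] B.smult_assoc1[OF rdeg_carr[OF b] ac sc] by simp
  qed
  then obtain w where w: "w \<in> mdeg ?A r" and hw: "\<And>k a. a \<in> I k \<Longrightarrow> h k (a \<odot>\<^bsub>?B\<^esub> s) = a \<odot>\<^bsub>?A\<^esub> w" by blast
  note wc = Dcarr[OF w]
  \<comment> \<open>For such a one has a s = \<delta> (h (a s)) = \<delta> (a w) = a \<delta>
    w.\<close>
  have "a \<odot>\<^bsub>?B\<^esub> (s \<oplus>\<^bsub>?B\<^esub> \<ominus>\<^bsub>?B\<^esub> \<delta> j w) = \<zero>\<^bsub>?B\<^esub>" if k: "k \<ge> n'" and a: "a \<in> rdeg R k" for k a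
  proof -
    note ac = rdeg_carr[OF a]
    obtain v where v: "v \<in> mdeg ?A (int k + r)" "\<delta> j v = a \<odot>\<^bsub>?B\<^esub> s"
      using bd[OF _ a] k by (auto simp: n'_def)
    have "int k + r \<ge> N" using k by (auto simp: n'_def)
    then have "\<delta> j (h (int k + r) (a \<odot>\<^bsub>?B\<^esub> s)) = a \<odot>\<^bsub>?B\<^esub> s" using hd v by metis
    moreover have "a \<in> I (int k + r)" using k a by (simp add: I_def zdeg_int)
    ultimately have "\<delta> j (a \<odot>\<^bsub>?A\<^esub> w) = a \<odot>\<^bsub>?B\<^esub> s" using hw by metis
    then have "a \<odot>\<^bsub>?B\<^esub> \<delta> j w = a \<odot>\<^bsub>?B\<^esub> s" using diff_smult[OF ac wc] by simp
    then show ?thesis using ac sc diff_carr[OF wc] by (simp add: B.smult_r_distr B.smult_r_minus B.M.r_neg)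
  qed
  moreover have "s \<oplus>\<^bsub>?B\<^esub> \<ominus>\<^bsub>?B\<^esub> \<delta> j w \<in> mdeg ?B r" by (rule Ddeg_add[OF s Ddeg_minus[OF diff_deg[OF w]]])
  ultimately show ?thesis using w unfolding htors_def by blast
qed

lemma Mmod: "module R M" by (rule pregradedD(1)[OF Mgr])

lemmas eps_carr = graded_homD(1)[OF eps]
lemmas eps_smult = graded_homD(3)[OF eps]
lemmas eps_deg = graded_homD(4)[OF eps]
lemmas Mcarr = pregradedD(9)[OF Mgr]
lemmas Mdeg_smult = pregradedD(7)[OF Mgr]

text \<open>The socle condition says that a \<epsilon> m is a boundary for every a of positive
  degree, so \<open>boundary_modulo_torsion\<close> applies with n = 1 and makes \<epsilon> m -
  \<delta> w torsion for some w. The class of this cocycle is nonzero, since otherwise \<epsilon> m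
  itself would be a boundary and m would lie in Q.\<close>

lemma socle_tors_coh:
  assumes m: "m \<in> mdeg M r" "m \<notin> Q r" and soc: "\<And>s a. s \<ge> 1 \<Longrightarrow> a \<in> rdeg R s \<Longrightarrow> a \<odot>\<^bsub>M\<^esub> m \<in> Q (int s + r)"
  shows "tors_coh_nz R D \<delta> 0 r"
proof -
  interpret A: module R "D (-1)" by (rule Dmod)
  interpret B: module R "D 0" by (rule Dmod)
  interpret C: module R "D 1" by (rule Dmod)
  note mc = Mcarr[OF m(1)]
  have "\<exists>w\<in>mdeg (D (-1)) r. \<epsilon> m \<oplus>\<^bsub>D (-1 + 1)\<^esub> \<ominus>\<^bsub>D (-1 + 1)\<^esub> \<delta> (-1) w \<in> htors R (D (-1 + 1)) r"
  proof (rule boundary_modulo_torsion)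
    show "\<epsilon> m \<in> mdeg (D (-1 + 1)) r" using eps_deg[OF m(1)] by simp
    fix k a assume k: "1 \<le> (k::nat)" and a: "a \<in> rdeg R k"
    have "\<epsilon> (a \<odot>\<^bsub>M\<^esub> m) = a \<odot>\<^bsub>D 0\<^esub> \<epsilon> m" using eps_smult[OF rdeg_carr[OF a] mc] .
    then show "\<exists>v\<in>mdeg (D (-1)) (int k + r). \<delta> (-1) v = a \<odot>\<^bsub>D (-1 + 1)\<^esub> \<epsilon> m"
      using eps_kernel[OF Mdeg_smult[OF a m(1)]] soc[OF k a] by simp
  qed simp
  then obtain w where w: "w \<in> mdeg (D (-1)) r" and t: "\<epsilon> m \<oplus>\<^bsub>D 0\<^esub> \<ominus>\<^bsub>D 0\<^esub> \<delta> (-1) w \<in> htors R (D 0) r" by auto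
  let ?x = "\<epsilon> m \<oplus>\<^bsub>D 0\<^esub> \<ominus>\<^bsub>D 0\<^esub> \<delta> (-1) w"
  note wc = Dcarr[OF w]
  have dwc: "\<delta> (-1) w \<in> carrier (D 0)" using diff_carr[OF wc] by simp
  have "\<delta> 0 (\<delta> (-1) w) = \<zero>\<^bsub>D 1\<^esub>" using diff2[OF wc] by simp
  then have "\<delta> 0 ?x = \<zero>\<^bsub>D 1\<^esub>"
    using graded_homD(2)[OF diff[of 0] eps_carr[OF mc] B.M.a_inv_closed[OF dwc]] eps_cocycle[OF mc]
      graded_hom_minus[OF diff[of 0] Dmod Dmod dwc] by simp
  moreover have "\<delta> (-1) v \<noteq> ?x" if v: "v \<in> htors R (D (-1)) r" for v
  proof
    assume e: "\<delta> (-1) v = ?x"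
    have vd: "v \<in> mdeg (D (-1)) r" using v unfolding htors_def by blast
    have "\<delta> (-1) (v \<oplus>\<^bsub>D (-1)\<^esub> w) = ?x \<oplus>\<^bsub>D 0\<^esub> \<delta> (-1) w"
      using diff_add[OF Dcarr[OF vd] wc] e by simp
    also have "\<dots> = \<epsilon> m" using eps_carr[OF mc] dwc by (simp add: B.M.a_assoc B.M.l_neg)
    finally have "m \<in> Q r" using eps_kernel[OF m(1)] Ddeg_add[OF vd w] by blast
    then show False using m by blast
  qed
  ultimately show ?thesis using t unfolding tors_coh_nz_def by auto
qed

text \<open>The degree may rise: a torsion cocycle x is multiplied by a homogeneous a of largest
  degree for which a x is not a boundary, and a x then represents a socle element. This requires
  that x is no boundary in D at all, not merely no boundary of a torsion element.\<close>

lemma tors_coh_socle: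
  assumes "tors_coh_nz R D \<delta> 0 r"
  shows "\<exists>k\<ge>r. \<exists>m\<in>mdeg M k. m \<notin> Q k \<and> (\<forall>s\<ge>1. \<forall>a\<in>rdeg R s. a \<odot>\<^bsub>M\<^esub> m \<in> Q (int s + k))"
proof -
  interpret A: module R "D (-1)" by (rule Dmod)
  interpret B: module R "D 0" by (rule Dmod)
  interpret C: module R "D 1" by (rule Dmod)
  interpret M: module R M by (rule Mmod)
  have d1: "\<delta> (-1) \<in> graded_hom R (D (-1)) (D 0)" using diff[of "-1"] by simp
  note d1D = graded_homD[OF d1]
  have d0: "\<delta> 0 \<in> graded_hom R (D 0) (D 1)" using diff[of 0] by simp
  note d0D = graded_homD[OF d0]
  obtain x where x: "x \<in> htors R (D 0) r" "\<delta> 0 x = \<zero>\<^bsub>D 1\<^esub>"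
    and xnb: "\<And>w. w \<in> htors R (D (-1)) r \<Longrightarrow> \<delta> (-1) w \<noteq> x" using assms unfolding tors_coh_nz_def by auto
  have xd: "x \<in> mdeg (D 0) r" using x(1) unfolding htors_def by blast
  note xc = Dcarr[OF xd]
  obtain n where n: "\<And>s a. s \<ge> n \<Longrightarrow> a \<in> rdeg R s \<Longrightarrow> a \<odot>\<^bsub>D 0\<^esub> x = \<zero>\<^bsub>D 0\<^esub>" using x(1) unfolding htors_def by blast
  define bd where "bd = (\<lambda>k. \<delta> (-1) ` mdeg (D (-1)) k)"
  have bd_add: "u \<oplus>\<^bsub>D 0\<^esub> v \<in> bd k" if "u \<in> bd k" "v \<in> bd k" for u v k
    using that d1D(2)[OF Dcarr Dcarr] Ddeg_add[of _ "-1" k] unfolding bd_def by (auto simp: image_iff) metis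
  have bd_min: "\<ominus>\<^bsub>D 0\<^esub> u \<in> bd k" if "u \<in> bd k" for u k
    using that graded_hom_minus[OF d1 Dmod Dmod Dcarr] Ddeg_minus[of _ "-1" k] unfolding bd_def by (auto simp: image_iff) metis
  have bd_smult: "a \<odot>\<^bsub>D 0\<^esub> u \<in> bd (int s + k)" if u: "u \<in> bd k" and a: "a \<in> rdeg R s" for u k a s
  proof -
    obtain v where v: "v \<in> mdeg (D (-1)) k" "u = \<delta> (-1) v" using u unfolding bd_def by blast
    then show ?thesis using d1D(3)[OF rdeg_carr[OF a] Dcarr[OF v(1)]] Ddeg_smult[OF a v(1)]
      unfolding bd_def by (metis imageI)
  qed
  have bdc: "u \<in> bd k \<Longrightarrow> u \<in> carrier (D 0)" for u k unfolding bd_def using d1D(1) Dcarr by blast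
  have bd0: "\<zero>\<^bsub>D 0\<^esub> \<in> bd k" for k
    unfolding bd_def using graded_hom_zero[OF d1 Dmod Dmod] Ddeg_zero[of "-1" k] by (metis imageI)
  have eps_bd: "m \<in> mdeg M k \<Longrightarrow> \<epsilon> m \<in> bd k \<longleftrightarrow> m \<in> Q k" for m k
    using eps_kernel[of m k] unfolding bd_def by (auto simp: image_iff eq_commute)
  \<comment> \<open>If x = \<delta> y, then for a of large degree a y is a cocycle in cohomological
    degree -1 and hence a boundary. So y - \<delta> w is torsion for some w, and it still has
    boundary x.\<close>
  have xb: "x \<notin> bd r"
  proof
    assume "x \<in> bd r"
    then obtain y where y: "y \<in> mdeg (D (-1)) r" "\<delta> (-1) y = x" unfolding bd_def by blast
    note yc = Dcarr[OF y(1)]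
    have "\<exists>w\<in>mdeg (D (-2)) r. y \<oplus>\<^bsub>D (-2 + 1)\<^esub> \<ominus>\<^bsub>D (-2 + 1)\<^esub> \<delta> (-2) w \<in> htors R (D (-2 + 1)) r"
    proof (rule boundary_modulo_torsion)
      show "y \<in> mdeg (D (-2 + 1)) r" using y by simp
      \<comment> \<open>From degree n on a kills x; from N - r on the degree of a y is large enough
        for exactness.\<close>
      fix k a assume k: "k \<ge> max n (nat (N - r))" and a: "a \<in> rdeg R k"
      have "\<delta> (-1) (a \<odot>\<^bsub>D (-1)\<^esub> y) = \<zero>\<^bsub>D 0\<^esub>" using d1D(3)[OF rdeg_carr[OF a] yc] y(2) n[OF _ a] k by simp
      moreover have "N \<le> int k + r" using k by auto
      ultimately show "\<exists>v\<in>mdeg (D (-2)) (int k + r). \<delta> (-2) v = a \<odot>\<^bsub>D (-2 + 1)\<^esub> y"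
        using exact_neg[of "-2" "int k + r" "a \<odot>\<^bsub>D (-1)\<^esub> y"] Ddeg_smult[OF a y(1)] by simp
    qed simp
    then obtain w where w: "w \<in> mdeg (D (-2)) r" "y \<oplus>\<^bsub>D (-1)\<^esub> \<ominus>\<^bsub>D (-1)\<^esub> \<delta> (-2) w \<in> htors R (D (-1)) r" by auto
    have wc: "\<delta> (-2) w \<in> carrier (D (-1))" using diff_carr[OF Dcarr[OF w(1)]] by simp
    have "\<delta> (-1) (\<delta> (-2) w) = \<zero>\<^bsub>D 0\<^esub>" using diff2[OF Dcarr[OF w(1)]] by simp
    then have "\<delta> (-1) (y \<oplus>\<^bsub>D (-1)\<^esub> \<ominus>\<^bsub>D (-1)\<^esub> \<delta> (-2) w) = x"
      using d1D(2)[OF yc A.M.a_inv_closed[OF wc]] graded_hom_minus[OF d1 Dmod Dmod wc] y(2) xc by simp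
    then show False using xnb w(2) by blast
  qed
  \<comment> \<open>\<open>P\<close> holds at 0, with a = 1, and fails beyond n, where a x = 0; so
    there is a largest s.\<close>
  define P where "P = (\<lambda>s. \<exists>a\<in>rdeg R s. a \<odot>\<^bsub>D 0\<^esub> x \<notin> bd (int s + r))"
  have P0: "P 0" unfolding P_def using xb xc rdeg_one by (intro bexI[of _ \<one>]) auto
  have Pn: "P s \<Longrightarrow> s \<le> n" for s unfolding P_def using n[of s] bd0 by (metis nat_le_linear)
  define s where "s = (GREATEST s. P s)"
  have Ps: "P s" unfolding s_def using GreatestI_nat[of P 0 n] P0 Pn by blast
  have smax: "P s' \<Longrightarrow> s' \<le> s" for s' unfolding s_def using Greatest_le_nat[of P s' n] Pn by blast
  obtain a where a: "a \<in> rdeg R s" "a \<odot>\<^bsub>D 0\<^esub> x \<notin> bd (int s + r)" using Ps unfolding P_def by blast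
  note ac = rdeg_carr[OF a(1)]
  have "\<delta> 0 (a \<odot>\<^bsub>D 0\<^esub> x) = \<zero>\<^bsub>D 1\<^esub>" using d0D(3)[OF ac xc] x(2) ac by simp
  then obtain m w where m: "m \<in> mdeg M (int s + r)" and w: "w \<in> mdeg (D (-1)) (int s + r)"
    and e: "a \<odot>\<^bsub>D 0\<^esub> x = \<epsilon> m \<oplus>\<^bsub>D 0\<^esub> \<delta> (-1) w" using eps_surj[OF Ddeg_smult[OF a(1) xd]] by blast
  have wb: "\<delta> (-1) w \<in> bd (int s + r)" using w unfolding bd_def by blast
  have mQ: "m \<notin> Q (int s + r)"
  proof
    assume "m \<in> Q (int s + r)"
    then have "a \<odot>\<^bsub>D 0\<^esub> x \<in> bd (int s + r)" using eps_bd[OF m] bd_add[OF _ wb] e by simp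
    then show False using a by blast
  qed
  note em = eps_carr[OF Mcarr[OF m]]
  have "b \<odot>\<^bsub>M\<^esub> m \<in> Q (int k + (int s + r))" if k: "k \<ge> 1" and b: "b \<in> rdeg R k" for k b
  proof -
    note bc = rdeg_carr[OF b]
    \<comment> \<open>b a has larger degree than a, so b a x is a boundary, and with it b \<epsilon>
      m = b a x - b \<delta> w.\<close>
    have "\<not> P (k + s)" using smax[of "k + s"] k by auto
    then have "(b \<otimes> a) \<odot>\<^bsub>D 0\<^esub> x \<in> bd (int (k + s) + r)" using rdeg_mult[OF b a(1)] unfolding P_def by blast
    then have 1: "b \<odot>\<^bsub>D 0\<^esub> (a \<odot>\<^bsub>D 0\<^esub> x) \<in> bd (int k + (int s + r))"
      using bc ac xc by (simp add: B.smult_assoc1 add.assoc)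
    have 2: "\<ominus>\<^bsub>D 0\<^esub> (b \<odot>\<^bsub>D 0\<^esub> \<delta> (-1) w) \<in> bd (int k + (int s + r))" by (rule bd_min[OF bd_smult[OF wb b]])
    have "b \<odot>\<^bsub>D 0\<^esub> (a \<odot>\<^bsub>D 0\<^esub> x) \<oplus>\<^bsub>D 0\<^esub> \<ominus>\<^bsub>D 0\<^esub> (b \<odot>\<^bsub>D 0\<^esub> \<delta> (-1) w) = b \<odot>\<^bsub>D 0\<^esub> \<epsilon> m"
      unfolding e using bc em bdc[OF wb] by (simp add: B.smult_r_distr B.M.a_assoc B.M.r_neg)
    also have "\<dots> = \<epsilon> (b \<odot>\<^bsub>M\<^esub> m)" using eps_smult[OF bc Mcarr[OF m]] by simp
    finally have "\<epsilon> (b \<odot>\<^bsub>M\<^esub> m) \<in> bd (int k + (int s + r))" using bd_add[OF 1 2] by simp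
    then show ?thesis using eps_bd[OF Mdeg_smult[OF b m]] by simp
  qed
  then show ?thesis using m mQ by (intro exI[of _ "int s + r"]) auto
qed

end

section \<open>Torsion and powers of the irrelevant ideal\<close>

context graded_ring_base
begin

lemma irrelevant_induct [consumes 1, case_names hom add]:
  assumes x: "x \<in> irrelevant_ideal R" and Q: "\<And>n a. n \<ge> 1 \<Longrightarrow> a \<in> rdeg R n \<Longrightarrow> P a"
    and Qa: "\<And>u v. u \<in> carrier R \<Longrightarrow> v \<in> carrier R \<Longrightarrow> P u \<Longrightarrow> P v \<Longrightarrow> P (u \<oplus> v)"
  shows "P x"
proof -
  obtain F c where F: "finite F" "F \<subseteq> {1..}" "\<forall>n\<in>F. c n \<in> rdeg R n" "x = (\<Oplus>n\<in>F. c n)"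
    using x unfolding irrelevant_ideal_def by blast
  have "finite F \<Longrightarrow> F \<subseteq> {1..} \<Longrightarrow> \<forall>n\<in>F. c n \<in> rdeg R n \<Longrightarrow> P (\<Oplus>n\<in>F. c n)" for F
  proof (induction F rule: finite_induct)
    case empty
    show ?case using Q[of 1 \<zero>] rdeg_add_simps(2) by simp
  next
    case (insert n F)
    have c: "c n \<in> carrier R" "c \<in> F \<rightarrow> carrier R" using insert.prems rdeg_carr by auto
    have "P (c n \<oplus> (\<Oplus>n\<in>F. c n))" using Qa[OF c(1) finsum_closed[OF c(2)] Q[of n "c n"]] insert by simp
    then show ?case using insert.hyps c by simp
  qed
  then show ?thesis using F by blast
qed

text \<open>Both families of summands are padded with zeros to the union of their index
  sets.\<close>

lemma irrelevant_add:
  assumes "x \<in> irrelevant_ideal R" "y \<in> irrelevant_ideal R"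
  shows "x \<oplus> y \<in> irrelevant_ideal R"
proof -
  obtain F c where F: "finite F" "F \<subseteq> {1..}" "\<forall>n\<in>F. c n \<in> rdeg R n" "x = (\<Oplus>n\<in>F. c n)"
    using assms unfolding irrelevant_ideal_def by blast
  obtain G b where G: "finite G" "G \<subseteq> {1..}" "\<forall>n\<in>G. b n \<in> rdeg R n" "y = (\<Oplus>n\<in>G. b n)"
    using assms unfolding irrelevant_ideal_def by blast
  let ?c = "\<lambda>n. if n \<in> F then c n else \<zero>" and ?b = "\<lambda>n. if n \<in> G then b n else \<zero>"
  have cb: "\<And>n. ?c n \<in> rdeg R n" "\<And>n. ?b n \<in> rdeg R n" using F(3) G(3) rdeg_add_simps(2) by auto
  then have cbc: "\<And>n. ?c n \<in> carrier R" "\<And>n. ?b n \<in> carrier R" using rdeg_carr by blast+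
  have FGc: "\<forall>n\<in>F. c n \<in> carrier R" "\<forall>n\<in>G. b n \<in> carrier R" using F(3) G(3) rdeg_carr by blast+
  have "x = (\<Oplus>n\<in>F \<union> G. ?c n)" unfolding F(4)
    by (rule add.finprod_mono_neutral_cong_left) (use F G FGc in auto)
  moreover have "y = (\<Oplus>n\<in>F \<union> G. ?b n)" unfolding G(4)
    by (rule add.finprod_mono_neutral_cong_left) (use F G FGc in auto)
  ultimately have "x \<oplus> y = (\<Oplus>n\<in>F \<union> G. ?c n \<oplus> ?b n)" using cbc by (subst finsum_addf) auto
  moreover have "finite (F \<union> G)" "F \<union> G \<subseteq> {1..}" "\<forall>n\<in>F \<union> G. ?c n \<oplus> ?b n \<in> rdeg R n"
    using F G rdeg_add_simps(3)[OF cb(1) cb(2)] by auto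
  ultimately show ?thesis unfolding irrelevant_ideal_def mem_Collect_eq
    by (intro exI[of _ "F \<union> G"] exI[of _ "\<lambda>n. ?c n \<oplus> ?b n"]) auto
qed

lemma irrelevant_hom: "n \<ge> 1 \<Longrightarrow> a \<in> rdeg R n \<Longrightarrow> a \<in> irrelevant_ideal R"
  unfolding irrelevant_ideal_def mem_Collect_eq
  by (intro exI[of _ "{n}"] exI[of _ "\<lambda>_. a"]) (auto simp: rdeg_carr)

lemma irrelevant_carr: "x \<in> irrelevant_ideal R \<Longrightarrow> x \<in> carrier R"
  by (induction x rule: irrelevant_induct) auto

lemma irrelevant_is_ideal: "ideal (irrelevant_ideal R) R"
proof -
  have mul: "a \<otimes> x \<in> irrelevant_ideal R" if a: "a \<in> carrier R" and x: "x \<in> irrelevant_ideal R" for a x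
    using a
  proof (induction a rule: homogeneous_induct)
    case (hom n a)
    from x show ?case
    proof (induction x rule: irrelevant_induct)
      case (hom k b)
      show ?case by (rule irrelevant_hom[OF _ rdeg_mult[OF \<open>a \<in> rdeg R n\<close> hom(2)]]) (use hom in simp)
    next
      case (add u v)
      then show ?case using irrelevant_add rdeg_carr[OF \<open>a \<in> rdeg R n\<close>] by (simp add: r_distr)
    qed
  next
    case (add u v)
    then show ?case using irrelevant_add irrelevant_carr[OF x] by (simp add: l_distr)
  qed
  have neg: "\<ominus> x \<in> irrelevant_ideal R" if x: "x \<in> irrelevant_ideal R" for x
    using mul[of "\<ominus> \<one>" x] that irrelevant_carr[OF x] by (simp add: l_minus)
  show ?thesis
  proof (rule idealI)
    show "ring R" by (rule ring_axioms)
    have "\<zero> \<in> irrelevant_ideal R" using irrelevant_hom[of 1 \<zero>] rdeg_add_simps(2) by blast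
    then show "subgroup (irrelevant_ideal R) (add_monoid R)"
      by (intro add.subgroupI) (use irrelevant_carr irrelevant_add neg in auto)
    show "x \<otimes> a \<in> irrelevant_ideal R" if "a \<in> irrelevant_ideal R" "x \<in> carrier R" for a x
      using mul that by blast
    then show "a \<otimes> x \<in> irrelevant_ideal R" if "a \<in> irrelevant_ideal R" "x \<in> carrier R" for a x
      using m_comm[OF irrelevant_carr[OF that(1)] that(2)] that by simp
  qed
qed

abbreviation Ipow :: "nat \<Rightarrow> 'a set" where
  "Ipow n \<equiv> irrelevant_ideal R [^]\<^bsub>ideals_set R\<^esub> n"

lemma Ipow_ideal: "ideal (Ipow n) R"
proof -
  interpret IS: comm_monoid "ideals_set R" by (rule ideals_set_is_comm_monoid)
  have "irrelevant_ideal R \<in> carrier (ideals_set R)"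
    using irrelevant_is_ideal by (simp add: ideals_set_def)
  then show ?thesis using IS.nat_pow_closed[of "irrelevant_ideal R" n] by (simp add: ideals_set_def)
qed

lemma Ipow_add: "ideal_prod R (Ipow m) (Ipow n) = Ipow (m + n)"
proof -
  interpret IS: comm_monoid "ideals_set R" by (rule ideals_set_is_comm_monoid)
  have "irrelevant_ideal R \<in> carrier (ideals_set R)"
    using irrelevant_is_ideal by (simp add: ideals_set_def)
  from IS.nat_pow_mult[OF this, of m n] show ?thesis by (simp add: ideals_set_def)
qed

lemma Ipow_0: "Ipow 0 = carrier R"
  and Ipow_Suc: "Ipow (Suc n) = ideal_prod R (Ipow n) (irrelevant_ideal R)"
  by (simp_all add: ideals_set_def)

lemma Ipow_antimono:
  assumes "n \<le> s"
  shows "Ipow s \<subseteq> Ipow n"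
proof -
  have "Ipow s = ideal_prod R (Ipow n) (Ipow (s - n))" using Ipow_add[of n "s - n"] assms by simp
  then show ?thesis using ideal_prod_inter[OF Ipow_ideal Ipow_ideal] by blast
qed

text \<open>R_+^n is spanned by products of n elements of positive degree, which have components
  only in degrees at least n. The induction varies x: for a product i j with j in R_+, the element j
  x is annihilated by all degrees from n on, since j raises degrees by at least one, and the
  induction hypothesis applies to j x.\<close>

lemma Ipow_annihilates:
  assumes U: "pregraded R U"
  shows "x \<in> carrier U \<Longrightarrow> (\<And>k a. k \<ge> n \<Longrightarrow> a \<in> rdeg R k \<Longrightarrow> a \<odot>\<^bsub>U\<^esub> x = \<zero>\<^bsub>U\<^esub>) \<Longrightarrow> a \<in> Ipow n \<Longrightarrow>
    a \<odot>\<^bsub>U\<^esub> x = \<zero>\<^bsub>U\<^esub>"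
proof (induction n arbitrary: x a)
  case 0
  interpret U: module R U by (rule pregradedD(1)[OF U])
  have "a \<in> carrier R" using 0(3) unfolding Ipow_0 .
  then show ?case
  proof (induction a rule: homogeneous_induct)
    case (add u v)
    then show ?case using 0(1) by (simp add: U.smult_l_distr)
  qed (use 0(2) in auto)
next
  case (Suc n)
  interpret U: module R U by (rule pregradedD(1)[OF U])
  have c: "i \<in> carrier R" if "i \<in> Ipow n" for i n using ideal.Icarr[OF Ipow_ideal that] .
  have "a \<in> ideal_prod R (Ipow n) (irrelevant_ideal R)" using Suc.prems by (simp only: Ipow_Suc)
  then have "a \<in> carrier R \<and> a \<odot>\<^bsub>U\<^esub> x = \<zero>\<^bsub>U\<^esub>"
  proof (induction a rule: ideal_prod.induct)
    case (prod i j)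
    have jc: "j \<in> carrier R" using prod irrelevant_carr by blast
    have "b \<odot>\<^bsub>U\<^esub> (j \<odot>\<^bsub>U\<^esub> x) = \<zero>\<^bsub>U\<^esub>" if k: "k \<ge> n" and b: "b \<in> rdeg R k" for k b
      using prod(2)
    proof (induction j rule: irrelevant_induct)
      case (hom m a)
      have "(b \<otimes> a) \<odot>\<^bsub>U\<^esub> x = \<zero>\<^bsub>U\<^esub>"
        by (rule Suc.prems(2)[OF _ rdeg_mult[OF b hom(2)]]) (use k hom in simp)
      then show ?case using rdeg_carr[OF b] rdeg_carr[OF hom(2)] Suc.prems(1) by (simp add: U.smult_assoc1)
    next
      case (add u v)
      then show ?case using rdeg_carr[OF b] Suc.prems(1) by (simp add: U.smult_l_distr U.smult_r_distr)
    qed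
    then have "i \<odot>\<^bsub>U\<^esub> (j \<odot>\<^bsub>U\<^esub> x) = \<zero>\<^bsub>U\<^esub>"
      using Suc.IH[OF U.smult_closed[OF jc Suc.prems(1)] _ prod(1)] by blast
    then show ?case using c[OF prod(1)] jc Suc.prems(1) by (simp add: U.smult_assoc1)
  next
    case (sum s1 s2)
    then show ?case using Suc.prems(1) by (simp add: U.smult_l_distr)
  qed
  then show ?case by blast
qed

text \<open>Generation in degree 1 enters here. The elements whose component of degree s lies in
  R_+^s for every s form a subring that contains R_0 and R_1, so they exhaust R.\<close>

lemma rdeg_Ipow:
  assumes std: "standard_graded R" and a: "a \<in> rdeg R s" and "n \<le> s"
  shows "a \<in> Ipow n"
proof -
  have "direct_sum_decomp R (rdeg R)" using graded unfolding graded_cring_def by blast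
  then obtain p where p: "grading_projections R (rdeg R) p"
    using grading_projections_exist by blast
  define T where "T = {x \<in> carrier R. \<forall>s. p s x \<in> Ipow s}"
  note I = ideal.axioms(1)[OF Ipow_ideal]
  have Tadd: "x \<oplus> y \<in> T" if "x \<in> T" "y \<in> T" for x y
    using that additive_subgroup.a_closed[OF I] unfolding T_def by (simp add: gp_add[OF p])
  have T0: "\<zero> \<in> T" using additive_subgroup.zero_closed[OF I] unfolding T_def by (simp add: gp_zero[OF p])
  have Tneg: "\<ominus> x \<in> T" if "x \<in> T" for x
    using that additive_subgroup.a_inv_closed[OF I] unfolding T_def by (simp add: gp_minus[OF p])
  have Thom: "a \<in> T" if "a \<in> rdeg R k" "a \<in> Ipow k" for a k
  proof -
    have "p s a \<in> Ipow s" for s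
      using that gp_same[OF p that(1)] gp_other[OF p that(1), of s] additive_subgroup.zero_closed[OF I]
      by (cases "s = k") auto
    then show ?thesis using that rdeg_carr unfolding T_def by blast
  qed
  have Tc: "x \<in> carrier R" if "x \<in> T" for x using that unfolding T_def by blast
  have Tmul: "x \<otimes> y \<in> T" if x: "x \<in> T" and y: "y \<in> T" for x y
  proof -
    have hy: "c \<otimes> y \<in> T" if c: "c \<in> rdeg R k" "c \<in> Ipow k" for c k
    proof -
      have "y \<in> carrier R \<and> c \<otimes> y \<in> T"
      proof (rule gp_induct[OF p Tc[OF y]])
        fix n
        have e: "p n y \<in> Ipow n" "p n y \<in> rdeg R n" using y gp_proj[OF p Tc[OF y]] unfolding T_def by auto
        have "c \<otimes> p n y \<in> Ipow (k + n)"
          using ideal_prod.prod[OF c(2) e(1), of R] Ipow_add by simp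
        then show "p n y \<in> carrier R \<and> c \<otimes> p n y \<in> T"
          using Thom[OF rdeg_mult[OF c(1) e(2)]] rdeg_carr[OF e(2)] by blast
      next
        show "\<zero> \<in> carrier R \<and> c \<otimes> \<zero> \<in> T" using T0 rdeg_carr[OF c(1)] by simp
      qed (use Tadd rdeg_carr[OF c(1)] in \<open>auto simp: r_distr\<close>)
      then show ?thesis by blast
    qed
    have "x \<in> carrier R \<and> x \<otimes> y \<in> T"
    proof (rule gp_induct[OF p Tc[OF x]])
      fix n
      have "p n x \<in> Ipow n" "p n x \<in> rdeg R n" using x gp_proj[OF p Tc[OF x]] unfolding T_def by auto
      then show "p n x \<in> carrier R \<and> p n x \<otimes> y \<in> T" using hy rdeg_carr by blast
    next
      show "\<zero> \<in> carrier R \<and> \<zero> \<otimes> y \<in> T" using T0 Tc[OF y] by simp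
    qed (use Tadd Tc[OF y] in \<open>auto simp: l_distr\<close>)
    then show ?thesis by blast
  qed
  have R0: "a \<in> T" if "a \<in> rdeg R 0" for a
    using Thom[OF that] rdeg_carr[OF that] unfolding Ipow_0 by blast
  have R1: "a \<in> T" if "a \<in> rdeg R 1" for a
  proof (rule Thom[OF that])
    have "\<one> \<in> Ipow 0" unfolding Ipow_0 by simp
    then have "\<one> \<otimes> a \<in> ideal_prod R (Ipow 0) (irrelevant_ideal R)"
      by (rule ideal_prod.prod) (use irrelevant_hom[OF _ that] in simp)
    then show "a \<in> Ipow 1" using rdeg_carr[OF that] Ipow_Suc[of 0] by simp
  qed
  have "x \<in> T" if "x \<in> generate_ring R (rdeg R 0 \<union> rdeg R 1)" for x
    using that by (induction x rule: generate_ring.induct) (use R0 R1 rdeg_one Tadd Tneg Tmul in auto)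
  then have "a \<in> T" using std rdeg_carr[OF a] unfolding standard_graded_def by blast
  then have "p s a \<in> Ipow s" unfolding T_def by blast
  then have "a \<in> Ipow s" unfolding gp_same[OF p a] .
  then show ?thesis using Ipow_antimono[OF assms(3)] by blast
qed

lemma smult_projection:
  fixes U :: "('a, 'u) graded_module"
  assumes U: "is_graded_module R U" and p: "grading_projections U (mdeg U) p"
    and a: "a \<in> rdeg R s" and x: "x \<in> carrier U"
  shows "p (int s + r) (a \<odot>\<^bsub>U\<^esub> x) = a \<odot>\<^bsub>U\<^esub> p r x"
proof -
  have pU: "pregraded R U" by (rule is_graded_module_pregraded[OF U])
  interpret U: module R U by (rule pregradedD(1)[OF pU])
  note ac = rdeg_carr[OF a]
  have hom: "p (int s + r) (a \<odot>\<^bsub>U\<^esub> c) = a \<odot>\<^bsub>U\<^esub> p r c" if c: "c \<in> mdeg U k" for c k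
    using U.M.gp_same[OF p c] U.M.gp_other[OF p c, of r] U.M.gp_same[OF p pregradedD(7)[OF pU a c]]
      U.M.gp_other[OF p pregradedD(7)[OF pU a c], of "int s + r"] ac by (cases "r = k") auto
  show ?thesis
  proof (rule U.M.gp_induct[OF p x])
    show "p (int s + r) (a \<odot>\<^bsub>U\<^esub> p n x) = a \<odot>\<^bsub>U\<^esub> p r (p n x)" for n
      by (rule hom[OF U.M.gp_proj[OF p x]])
    show "p (int s + r) (a \<odot>\<^bsub>U\<^esub> \<zero>\<^bsub>U\<^esub>) = a \<odot>\<^bsub>U\<^esub> p r \<zero>\<^bsub>U\<^esub>" using hom[OF pregradedD(4)[OF pU]] .
  qed (use ac U.M.gp_carr[OF p] in \<open>simp add: U.smult_r_distr U.M.gp_add[OF p]\<close>)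
qed

lemma hom_projection:
  fixes U :: "('a, 'u) graded_module" and V :: "('a, 'v) graded_module"
  assumes U: "is_graded_module R U" and V: "is_graded_module R V" and f: "f \<in> graded_hom R U V"
    and p: "grading_projections U (mdeg U) p" and q: "grading_projections V (mdeg V) q"
    and x: "x \<in> carrier U"
  shows "q r (f x) = f (p r x)"
proof -
  have pU: "pregraded R U" by (rule is_graded_module_pregraded[OF U])
  have pV: "pregraded R V" by (rule is_graded_module_pregraded[OF V])
  interpret U: module R U by (rule pregradedD(1)[OF pU])
  interpret V: module R V by (rule pregradedD(1)[OF pV])
  have hom: "q r (f c) = f (p r c)" if c: "c \<in> mdeg U k" for c k
    using U.M.gp_same[OF p c] U.M.gp_other[OF p c, of r] V.M.gp_same[OF q graded_homD(4)[OF f c]]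
      V.M.gp_other[OF q graded_homD(4)[OF f c], of r] graded_hom_zero[OF f U.module_axioms V.module_axioms]
    by (cases "r = k") auto
  show ?thesis
  proof (rule U.M.gp_induct[OF p x])
    show "q r (f (p n x)) = f (p r (p n x))" for n by (rule hom[OF U.M.gp_proj[OF p x]])
    show "q r (f \<zero>\<^bsub>U\<^esub>) = f (p r \<zero>\<^bsub>U\<^esub>)" using hom[OF pregradedD(4)[OF pU]] .
  qed (use graded_homD(1,2)[OF f] U.M.gp_carr[OF p] in
      \<open>simp add: U.M.gp_add[OF p] V.M.gp_add[OF q]\<close>)
qed

lemma graded_module_projections:
  fixes U :: "('a, 'u) graded_module"
  assumes "is_graded_module R U"
  obtains p where "grading_projections U (mdeg U) p"
  using assms abelian_group.grading_projections_exist[OF pregradedD(8)[OF is_graded_module_pregraded[OF assms]]]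
  unfolding is_graded_module_def by blast

text \<open>The component of degree r of any preimage is again a preimage. This turns exactness of
  the resolution into exactness in each degree.\<close>

lemma hom_image_homogeneous:
  fixes U :: "('a, 'u) graded_module" and V :: "('a, 'v) graded_module"
  assumes U: "is_graded_module R U" and V: "is_graded_module R V" and f: "f \<in> graded_hom R U V"
    and x: "x \<in> carrier U" and y: "f x \<in> mdeg V r"
  shows "\<exists>x'\<in>mdeg U r. f x' = f x"
proof -
  obtain p where p: "grading_projections U (mdeg U) p" by (rule graded_module_projections[OF U])
  obtain q where q: "grading_projections V (mdeg V) q" by (rule graded_module_projections[OF V])
  have aU: "abelian_group U" "abelian_group V"
    using U V by (auto intro: pregradedD(8) is_graded_module_pregraded)
  have "f (p r x) = f x"
    using hom_projection[OF U V f p q x, of r] abelian_group.gp_same[OF aU(2) q y] by simp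
  then show ?thesis using abelian_group.gp_proj[OF aU(1) p x] by blast
qed

text \<open>Being killed by a power of R_+ and being killed by all large degrees agree: one
  direction is \<open>rdeg_Ipow\<close>, the other \<open>Ipow_annihilates\<close>. The second claim
  holds because multiplication by a homogeneous element merely shifts components, so a component is
  annihilated whenever the whole element is.\<close>

lemma torsion_homogeneous:
  fixes U :: "('a, 'u) graded_module"
  assumes std: "standard_graded R" and U: "is_graded_module R U"
  shows "x \<in> mdeg U r \<Longrightarrow> x \<in> torsion R (irrelevant_ideal R) U \<longleftrightarrow> x \<in> htors R U r"
    and "grading_projections U (mdeg U) p \<Longrightarrow> x \<in> torsion R (irrelevant_ideal R) U \<Longrightarrow>
      p r x \<in> htors R U r"
proof -
  have pU: "pregraded R U" by (rule is_graded_module_pregraded[OF U])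
  interpret U: module R U by (rule pregradedD(1)[OF pU])
  have ann: "\<exists>n. \<forall>s\<ge>n. \<forall>a\<in>rdeg R s. a \<odot>\<^bsub>U\<^esub> x = \<zero>\<^bsub>U\<^esub>"
    if t: "x \<in> torsion R (irrelevant_ideal R) U" for x
  proof -
    obtain n where "\<forall>a \<in> Ipow n. a \<odot>\<^bsub>U\<^esub> x = \<zero>\<^bsub>U\<^esub>" using t unfolding torsion_def by blast
    then show ?thesis using rdeg_Ipow[OF std] by blast
  qed
  show "x \<in> torsion R (irrelevant_ideal R) U \<longleftrightarrow> x \<in> htors R U r" if x: "x \<in> mdeg U r" for x r
  proof
    show "x \<in> torsion R (irrelevant_ideal R) U \<Longrightarrow> x \<in> htors R U r"
      using ann x unfolding htors_def by blast
    assume "x \<in> htors R U r"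
    then obtain n where "\<And>s a. s \<ge> n \<Longrightarrow> a \<in> rdeg R s \<Longrightarrow> a \<odot>\<^bsub>U\<^esub> x = \<zero>\<^bsub>U\<^esub>" unfolding htors_def by blast
    then have "\<forall>a\<in>Ipow n. a \<odot>\<^bsub>U\<^esub> x = \<zero>\<^bsub>U\<^esub>" using Ipow_annihilates[OF pU pregradedD(9)[OF pU x]] by blast
    then show "x \<in> torsion R (irrelevant_ideal R) U"
      using pregradedD(9)[OF pU x] unfolding torsion_def by blast
  qed
  assume p: "grading_projections U (mdeg U) p" and x: "x \<in> torsion R (irrelevant_ideal R) U"
  have xc: "x \<in> carrier U" using x unfolding torsion_def by blast
  obtain n where n: "\<And>s a. s \<ge> n \<Longrightarrow> a \<in> rdeg R s \<Longrightarrow> a \<odot>\<^bsub>U\<^esub> x = \<zero>\<^bsub>U\<^esub>" using ann[OF x] by blast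
  have "a \<odot>\<^bsub>U\<^esub> p r x = \<zero>\<^bsub>U\<^esub>" if "s \<ge> n" "a \<in> rdeg R s" for s a
    using smult_projection[OF U p that(2) xc, of r] n[OF that] U.M.gp_zero[OF p] by simp
  then show "p r x \<in> htors R U r" using U.M.gp_proj[OF p xc] unfolding htors_def by blast
qed

end

section \<open>The Koszul complex of the resolution\<close>

context
  fixes R :: "'a graded_ring" (structure) and D :: "int \<Rightarrow> ('a, 'e ktree) graded_module" and \<delta> z
    and M :: "('a, 'm) graded_module" and \<epsilon> Q N low
  assumes st: "koszul_stage R D \<delta> M \<epsilon> Q N low" and z: "z \<in> rdeg R 1"
begin

interpretation koszul_stage R D \<delta> M \<epsilon> Q N low by (rule st)

declare [[simproc del: int_combine_numerals]]

text \<open>This and the next two lemmas are the diagram chase shared by both exactness claims of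
  \<open>cone_stage\<close>: a cocycle (x, y) has y closed; if y = \<delta> w, then x + z w is
  closed; if that equals \<delta> v, then (x, y) is the image of (v, -w).\<close>

lemma cone_cocycle:
  assumes x: "x \<in> mdeg (D (j + 1)) r" and y: "y \<in> mdeg (D (j + 1 + 1)) (r - 1)"
    and c: "cone_diff z D \<delta> (j + 1) (Node x y) = \<zero>\<^bsub>cone_complex D (j + 1 + 1)\<^esub>"
  shows "\<delta> (j + 1 + 1) y = \<zero>\<^bsub>D (j + 1 + 1 + 1)\<^esub>"
    and "\<delta> (j + 1) x \<oplus>\<^bsub>D (j + 1 + 1)\<^esub> z \<odot>\<^bsub>D (j + 1 + 1)\<^esub> y = \<zero>\<^bsub>D (j + 1 + 1)\<^esub>"
proof -
  interpret C: module R "D (j + 1 + 1 + 1)" by (rule Dmod)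
  have e: "\<delta> (j + 1) x \<oplus>\<^bsub>D (j + 1 + 1)\<^esub> z \<odot>\<^bsub>D (j + 1 + 1)\<^esub> y = \<zero>\<^bsub>D (j + 1 + 1)\<^esub>"
    "\<ominus>\<^bsub>D (j + 1 + 1 + 1)\<^esub> \<delta> (j + 1 + 1) y = \<zero>\<^bsub>D (j + 1 + 1 + 1)\<^esub>"
    using c unfolding cone_diff_Node[OF injective_complex_axioms z] cone_complex_def cone_module_simps by auto
  show "\<delta> (j + 1) x \<oplus>\<^bsub>D (j + 1 + 1)\<^esub> z \<odot>\<^bsub>D (j + 1 + 1)\<^esub> y = \<zero>\<^bsub>D (j + 1 + 1)\<^esub>" by (rule e)
  show "\<delta> (j + 1 + 1) y = \<zero>\<^bsub>D (j + 1 + 1 + 1)\<^esub>" using e(2) diff_carr[OF Dcarr[OF y]] by simp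
qed

lemma cone_cocycle_reduce:
  assumes x: "x \<in> mdeg (D (j + 1)) r" and w: "w \<in> mdeg (D (j + 1)) (r - 1)"
    and c: "\<delta> (j + 1) x \<oplus>\<^bsub>D (j + 1 + 1)\<^esub> z \<odot>\<^bsub>D (j + 1 + 1)\<^esub> \<delta> (j + 1) w = \<zero>\<^bsub>D (j + 1 + 1)\<^esub>"
  shows "x \<oplus>\<^bsub>D (j + 1)\<^esub> z \<odot>\<^bsub>D (j + 1)\<^esub> w \<in> mdeg (D (j + 1)) r"
    and "\<delta> (j + 1) (x \<oplus>\<^bsub>D (j + 1)\<^esub> z \<odot>\<^bsub>D (j + 1)\<^esub> w) = \<zero>\<^bsub>D (j + 1 + 1)\<^esub>"
proof -
  interpret B: module R "D (j + 1)" by (rule Dmod)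
  show "x \<oplus>\<^bsub>D (j + 1)\<^esub> z \<odot>\<^bsub>D (j + 1)\<^esub> w \<in> mdeg (D (j + 1)) r"
    by (rule Ddeg_add[OF x z_deg[OF injective_complex_axioms z w]])
  show "\<delta> (j + 1) (x \<oplus>\<^bsub>D (j + 1)\<^esub> z \<odot>\<^bsub>D (j + 1)\<^esub> w) = \<zero>\<^bsub>D (j + 1 + 1)\<^esub>"
    using c Dcarr[OF x] Dcarr[OF w] rdeg_carr[OF z] by (simp add: diff_add diff_smult)
qed

lemma cone_boundary:
  assumes x: "x \<in> mdeg (D (j + 1)) r" and w: "w \<in> mdeg (D (j + 1)) (r - 1)"
    and v: "v \<in> mdeg (D j) r" and e: "\<delta> j v = x \<oplus>\<^bsub>D (j + 1)\<^esub> z \<odot>\<^bsub>D (j + 1)\<^esub> w"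
  shows "\<exists>u\<in>mdeg (cone_complex D j) r. cone_diff z D \<delta> j u = Node x (\<delta> (j + 1) w)"
proof (intro bexI)
  interpret B: module R "D (j + 1)" by (rule Dmod)
  interpret C: module R "D (j + 1 + 1)" by (rule Dmod)
  note c = Dcarr[OF x] Dcarr[OF w] rdeg_carr[OF z] diff_carr[OF Dcarr[OF w]]
  show "Node v (\<ominus>\<^bsub>D (j + 1)\<^esub> w) \<in> mdeg (cone_complex D j) r"
    unfolding cone_complex_def cone_module_simps using v Ddeg_minus[OF w] by blast
  show "cone_diff z D \<delta> j (Node v (\<ominus>\<^bsub>D (j + 1)\<^esub> w)) = Node x (\<delta> (j + 1) w)"
    unfolding cone_diff_Node[OF injective_complex_axioms z] e
    using c by (simp add: B.smult_r_minus B.M.a_assoc B.M.r_neg diff_minus)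
qed

text \<open>The long exact sequence of the cone, now without torsion. Its cohomology in degree 0 is
  the cokernel of z on M/Q because H^1(D) = 0. In degree -1 the kernel of z on M/Q is the only new
  contribution, and \<open>filt\<close> makes it vanish in large degrees. The bound grows by 1
  because the second component of an element of degree r has degree r - 1; the left end moves by 1
  because that component lies in D(j+1).\<close>

lemma cone_stage:
  assumes Qsub: "\<And>r. Q r \<subseteq> mdeg M r"
    and Q': "\<And>r. Q' r = {q \<oplus>\<^bsub>M\<^esub> z \<odot>\<^bsub>M\<^esub> m | q m. q \<in> Q r \<and> m \<in> mdeg M (r - 1)}"
    and filt: "\<And>r m. r \<ge> r0 \<Longrightarrow> m \<in> mdeg M r \<Longrightarrow> z \<odot>\<^bsub>M\<^esub> m \<in> Q (r + 1) \<Longrightarrow> m \<in> Q r"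
  shows "koszul_stage R (cone_complex D) (cone_diff z D \<delta>) M (\<lambda>m. Node (\<epsilon> m) \<zero>\<^bsub>D 1\<^esub>) Q'
    (max N r0 + 1) (low - 1)"
proof -
  note ic = injective_complex_axioms
  interpret K: injective_complex R "cone_complex D" "cone_diff z D \<delta>"
    by (rule cone_injective_complex[OF ic z])
  note zc = rdeg_carr[OF z]
  interpret A: module R "D (-1)" by (rule Dmod)
  interpret B: module R "D 0" by (rule Dmod)
  interpret C: module R "D 1" by (rule Dmod)
  interpret C2: module R "D 2" by (rule Dmod)
  interpret M: module R M by (rule Mmod)
  have d1: "\<delta> (-1) \<in> graded_hom R (D (-1)) (D 0)" using diff[of "-1"] by simp
  note d1D = graded_homD[OF d1]
  have d0: "\<delta> 0 \<in> graded_hom R (D 0) (D 1)" using diff[of 0] by simp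
  note d0D = graded_homD[OF d0]
  have d2: "\<delta> 1 \<in> graded_hom R (D 1) (D 2)" using diff[of 1] by simp
  have cdiff0: "cone_diff z D \<delta> 0 (Node x y) = Node (\<delta> 0 x \<oplus>\<^bsub>D 1\<^esub> z \<odot>\<^bsub>D 1\<^esub> y) (\<ominus>\<^bsub>D 2\<^esub> \<delta> 1 y)" for x y
    using cone_diff_Node[OF ic z, of 0 x y] by simp
  have cdiff1: "cone_diff z D \<delta> (-1) (Node x y) = Node (\<delta> (-1) x \<oplus>\<^bsub>D 0\<^esub> z \<odot>\<^bsub>D 0\<^esub> y) (\<ominus>\<^bsub>D 1\<^esub> \<delta> 0 y)" for x y
    using cone_diff_Node[OF ic z, of "-1" x y] by simp
  have cone0: "cone_complex D 0 = cone_module (D 0) (D 1)" "cone_complex D 1 = cone_module (D 1) (D 2)"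
    "cone_complex D (-1) = cone_module (D (-1)) (D 0)"
    by (simp_all add: cone_complex_def)
  have zdeg0: "z \<odot>\<^bsub>D j\<^esub> y \<in> mdeg (D j) r" if "y \<in> mdeg (D j) (r - 1)" for j y r
    by (rule z_deg[OF ic z that])
  have Q0: "\<zero>\<^bsub>M\<^esub> \<in> Q r" for r
  proof -
    have "\<delta> (-1) \<zero>\<^bsub>D (-1)\<^esub> = \<epsilon> \<zero>\<^bsub>M\<^esub>"
      using graded_hom_zero[OF d1 Dmod Dmod] graded_hom_zero[OF eps Mmod Dmod] by simp
    then show ?thesis using eps_kernel[OF pregradedD(4)[OF Mgr]] Ddeg_zero by blast
  qed
  show ?thesis
  proof (unfold_locales)
    show "pregraded R M" by (rule Mgr)
    show "carrier (cone_complex D j) = {\<zero>\<^bsub>cone_complex D j\<^esub>}" if "j < low - 1" for j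
    proof -
      have "carrier (D j) = {\<zero>\<^bsub>D j\<^esub>}" "carrier (D (j + 1)) = {\<zero>\<^bsub>D (j + 1)\<^esub>}" using low that by auto
      then show ?thesis by (auto simp: cone_complex_def cone_module_def)
    qed
    show "\<exists>w\<in>mdeg (cone_complex D j) r. cone_diff z D \<delta> j w = u"
      if j: "0 \<le> j" and u: "u \<in> mdeg (cone_complex D (j + 1)) r"
        and c: "cone_diff z D \<delta> (j + 1) u = \<zero>\<^bsub>cone_complex D (j + 1 + 1)\<^esub>" for j u r
    proof -
      obtain x y where xy: "u = Node x y" "x \<in> mdeg (D (j + 1)) r" "y \<in> mdeg (D (j + 1 + 1)) (r - 1)"
        using u cone_module_cases(2) unfolding cone_complex_def by blast
      note cc = cone_cocycle[OF xy(2,3) c[unfolded xy(1)]]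
      obtain w where w: "w \<in> mdeg (D (j + 1)) (r - 1)" "\<delta> (j + 1) w = y"
        using exact_pos[OF _ xy(3) cc(1)] j by auto
      note rr = cone_cocycle_reduce[OF xy(2) w(1) cc(2)[folded w(2)]]
      obtain v where "v \<in> mdeg (D j) r" "\<delta> j v = x \<oplus>\<^bsub>D (j + 1)\<^esub> z \<odot>\<^bsub>D (j + 1)\<^esub> w"
        using exact_pos[OF j rr] by blast
      from cone_boundary[OF xy(2) w(1) this] show ?thesis using xy(1) w(2) by simp
    qed
    show "\<exists>w\<in>mdeg (cone_complex D j) r. cone_diff z D \<delta> j w = u"
      if j: "j + 1 < 0" and r: "max N r0 + 1 \<le> r" and u: "u \<in> mdeg (cone_complex D (j + 1)) r"
        and c: "cone_diff z D \<delta> (j + 1) u = \<zero>\<^bsub>cone_complex D (j + 1 + 1)\<^esub>" for j u r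
    proof -
      obtain x y where xy: "u = Node x y" "x \<in> mdeg (D (j + 1)) r" "y \<in> mdeg (D (j + 1 + 1)) (r - 1)"
        using u cone_module_cases(2) unfolding cone_complex_def by blast
      note cc = cone_cocycle[OF xy(2,3) c[unfolded xy(1)]]
      have "\<exists>w\<in>mdeg (D (j + 1)) (r - 1). \<delta> (j + 1) w = y"
      proof (cases "j + 1 + 1 < 0")
        case True
        show ?thesis by (rule exact_neg[OF True _ xy(3) cc(1)]) (use r in auto)
      next
        case False
        \<comment> \<open>The critical place: y lies in D(0), where a cocycle is a boundary only up
          to an element of M.\<close>
        then have j2: "j + 1 = -1" using j by simp
        have x: "x \<in> mdeg (D (-1)) r" and y: "y \<in> mdeg (D 0) (r - 1)"
          and dy: "\<delta> 0 y = \<zero>\<^bsub>D 1\<^esub>" and dx: "\<delta> (-1) x \<oplus>\<^bsub>D 0\<^esub> z \<odot>\<^bsub>D 0\<^esub> y = \<zero>\<^bsub>D 0\<^esub>"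
          using xy(2,3) cc unfolding j2 by simp_all
        obtain m t where m: "m \<in> mdeg M (r - 1)" and t: "t \<in> mdeg (D (-1)) (r - 1)"
          and yt: "y = \<epsilon> m \<oplus>\<^bsub>D 0\<^esub> \<delta> (-1) t" using eps_surj[OF y dy] by blast
        note cs = Dcarr[OF x] Dcarr[OF t] d1D(1)[OF Dcarr[OF x]] d1D(1)[OF Dcarr[OF t]] eps_carr[OF Mcarr[OF m]]
        \<comment> \<open>\<delta> x + z y = 0 and y = \<epsilon> m + \<delta> t exhibit \<epsilon>
          (z m) as the boundary of this element, so z m lies in Q.\<close>
        let ?s = "\<ominus>\<^bsub>D (-1)\<^esub> (x \<oplus>\<^bsub>D (-1)\<^esub> z \<odot>\<^bsub>D (-1)\<^esub> t)"
        have sd: "x \<oplus>\<^bsub>D (-1)\<^esub> z \<odot>\<^bsub>D (-1)\<^esub> t \<in> mdeg (D (-1)) r"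
          by (rule Ddeg_add[OF x zdeg0[OF t]])
        have "\<delta> (-1) (x \<oplus>\<^bsub>D (-1)\<^esub> z \<odot>\<^bsub>D (-1)\<^esub> t) = \<delta> (-1) x \<oplus>\<^bsub>D 0\<^esub> z \<odot>\<^bsub>D 0\<^esub> \<delta> (-1) t"
          using d1D(2)[OF cs(1) A.smult_closed[OF zc cs(2)]] d1D(3)[OF zc cs(2)] by simp
        moreover have "z \<odot>\<^bsub>D 0\<^esub> \<epsilon> m \<oplus>\<^bsub>D 0\<^esub> (\<delta> (-1) x \<oplus>\<^bsub>D 0\<^esub> z \<odot>\<^bsub>D 0\<^esub> \<delta> (-1) t) = \<zero>\<^bsub>D 0\<^esub>"
          using dx cs zc unfolding yt by (simp add: B.smult_r_distr B.M.a_ac)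
        ultimately have "\<delta> (-1) ?s = \<epsilon> (z \<odot>\<^bsub>M\<^esub> m)"
          using graded_hom_minus[OF d1 Dmod Dmod Dcarr[OF sd]] eps_smult[OF zc Mcarr[OF m]] cs zc
          by (metis B.M.minus_equality B.M.a_closed B.smult_closed)
        moreover have zm: "z \<odot>\<^bsub>M\<^esub> m \<in> mdeg M r" using Mdeg_smult[OF z m] by simp
        ultimately have "z \<odot>\<^bsub>M\<^esub> m \<in> Q (r - 1 + 1)"
          using eps_kernel[OF zm] Ddeg_minus[OF sd] by auto
        \<comment> \<open>m has degree r - 1, which is at least \<open>r0\<close> by the choice of
          the new bound.\<close>
        then have "m \<in> Q (r - 1)" by (intro filt[OF _ m]) (use r in auto)
        then obtain t' where t': "t' \<in> mdeg (D (-1)) (r - 1)" "\<delta> (-1) t' = \<epsilon> m" using eps_kernel[OF m] by blast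
        have "\<delta> (-1) (t' \<oplus>\<^bsub>D (-1)\<^esub> t) = y" unfolding yt
          using d1D(2)[OF Dcarr[OF t'(1)] cs(2)] t'(2) by simp
        then show ?thesis unfolding j2 using Ddeg_add[OF t'(1) t] by blast
      qed
      then obtain w where w: "w \<in> mdeg (D (j + 1)) (r - 1)" "\<delta> (j + 1) w = y" by blast
      note rr = cone_cocycle_reduce[OF xy(2) w(1) cc(2)[folded w(2)]]
      have "N \<le> r" using r by simp
      then obtain v where "v \<in> mdeg (D j) r" "\<delta> j v = x \<oplus>\<^bsub>D (j + 1)\<^esub> z \<odot>\<^bsub>D (j + 1)\<^esub> w"
        using exact_neg[OF j _ rr] by blast
      from cone_boundary[OF xy(2) w(1) this] show ?thesis using xy(1) w(2) by simp
    qed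
    show "(\<lambda>m. Node (\<epsilon> m) \<zero>\<^bsub>D 1\<^esub>) \<in> graded_hom R M (cone_complex D 0)"
      unfolding graded_hom_def cone0
      using eps_carr graded_homD(2,3,4)[OF eps] Ddeg_zero by (auto simp: cone_module_simps)
    show "cone_diff z D \<delta> 0 (Node (\<epsilon> m) \<zero>\<^bsub>D 1\<^esub>) = \<zero>\<^bsub>cone_complex D 1\<^esub>" if "m \<in> carrier M" for m
      unfolding cdiff0 cone0 cone_module_simps
      using eps_cocycle[OF that] graded_hom_zero[OF d2 Dmod Dmod] zc by simp
    show "\<exists>m\<in>mdeg M r. \<exists>w\<in>mdeg (cone_complex D (-1)) r.
        u = Node (\<epsilon> m) \<zero>\<^bsub>D 1\<^esub> \<oplus>\<^bsub>cone_complex D 0\<^esub> cone_diff z D \<delta> (-1) w"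
      if u: "u \<in> mdeg (cone_complex D 0) r" and c: "cone_diff z D \<delta> 0 u = \<zero>\<^bsub>cone_complex D 1\<^esub>" for u r
    proof -
      obtain x y where xy: "u = Node x y" "x \<in> mdeg (D 0) r" "y \<in> mdeg (D 1) (r - 1)"
        using u cone_module_cases(2) unfolding cone0 by blast
      have "\<ominus>\<^bsub>D 2\<^esub> \<delta> 1 y = \<zero>\<^bsub>D 2\<^esub>" and dx: "\<delta> 0 x \<oplus>\<^bsub>D 1\<^esub> z \<odot>\<^bsub>D 1\<^esub> y = \<zero>\<^bsub>D 1\<^esub>"
        using c unfolding xy(1) cdiff0 cone0 cone_module_simps by auto
      then have "\<delta> 1 y = \<zero>\<^bsub>D 2\<^esub>" using graded_homD(1)[OF d2 Dcarr[OF xy(3)]] by simp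
      \<comment> \<open>H^1(D) = 0 allows the second component to be removed; what remains is the
        cocycle x + z w in D(0).\<close>
      then obtain w where w: "w \<in> mdeg (D 0) (r - 1)" "\<delta> 0 w = y" using exact_pos[of 0 y "r - 1"] xy(3) by auto
      note cs = Dcarr[OF xy(2)] Dcarr[OF w(1)] zc
      have xw: "x \<oplus>\<^bsub>D 0\<^esub> z \<odot>\<^bsub>D 0\<^esub> w \<in> mdeg (D 0) r" by (rule Ddeg_add[OF xy(2) zdeg0[OF w(1)]])
      have "\<delta> 0 (x \<oplus>\<^bsub>D 0\<^esub> z \<odot>\<^bsub>D 0\<^esub> w) = \<zero>\<^bsub>D 1\<^esub>"
        using d0D(2)[OF cs(1) B.smult_closed[OF zc cs(2)]] d0D(3)[OF zc cs(2)] w(2) dx by simp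
      then obtain m v where m: "m \<in> mdeg M r" and v: "v \<in> mdeg (D (-1)) r"
        and e: "x \<oplus>\<^bsub>D 0\<^esub> z \<odot>\<^bsub>D 0\<^esub> w = \<epsilon> m \<oplus>\<^bsub>D 0\<^esub> \<delta> (-1) v" using eps_surj[OF xw] by blast
      note cs2 = eps_carr[OF Mcarr[OF m]] d1D(1)[OF Dcarr[OF v]]
      have "\<epsilon> m \<oplus>\<^bsub>D 0\<^esub> (\<delta> (-1) v \<oplus>\<^bsub>D 0\<^esub> z \<odot>\<^bsub>D 0\<^esub> (\<ominus>\<^bsub>D 0\<^esub> w)) = x"
      proof -
        have "\<epsilon> m \<oplus>\<^bsub>D 0\<^esub> (\<delta> (-1) v \<oplus>\<^bsub>D 0\<^esub> z \<odot>\<^bsub>D 0\<^esub> (\<ominus>\<^bsub>D 0\<^esub> w)) =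
            (\<epsilon> m \<oplus>\<^bsub>D 0\<^esub> \<delta> (-1) v) \<oplus>\<^bsub>D 0\<^esub> \<ominus>\<^bsub>D 0\<^esub> (z \<odot>\<^bsub>D 0\<^esub> w)"
          using cs cs2 by (simp add: B.smult_r_minus B.M.a_assoc)
        also have "\<dots> = x" unfolding e[symmetric] using cs by (simp add: B.M.a_assoc B.M.r_neg)
        finally show ?thesis .
      qed
      moreover have "\<zero>\<^bsub>D 1\<^esub> \<oplus>\<^bsub>D 1\<^esub> \<ominus>\<^bsub>D 1\<^esub> \<delta> 0 (\<ominus>\<^bsub>D 0\<^esub> w) = y"
        using graded_hom_minus[OF d0 Dmod Dmod cs(2)] w(2) Dcarr[OF xy(3)] by simp
      ultimately have "u = Node (\<epsilon> m) \<zero>\<^bsub>D 1\<^esub> \<oplus>\<^bsub>cone_complex D 0\<^esub> cone_diff z D \<delta> (-1) (Node v (\<ominus>\<^bsub>D 0\<^esub> w))"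
        unfolding xy(1) cdiff1 cone0 cone_module_simps by simp
      moreover have "Node v (\<ominus>\<^bsub>D 0\<^esub> w) \<in> mdeg (cone_complex D (-1)) r"
        unfolding cone0 cone_module_simps using v Ddeg_minus[OF w(1)] by simp
      ultimately show ?thesis using m by blast
    qed
    show "(\<exists>w\<in>mdeg (cone_complex D (-1)) r. cone_diff z D \<delta> (-1) w = Node (\<epsilon> m) \<zero>\<^bsub>D 1\<^esub>) \<longleftrightarrow> m \<in> Q' r"
      if m: "m \<in> mdeg M r" for m r
    proof
      assume "\<exists>w\<in>mdeg (cone_complex D (-1)) r. cone_diff z D \<delta> (-1) w = Node (\<epsilon> m) \<zero>\<^bsub>D 1\<^esub>"
      then obtain u where u: "u \<in> mdeg (cone_complex D (-1)) r"
        "cone_diff z D \<delta> (-1) u = Node (\<epsilon> m) \<zero>\<^bsub>D 1\<^esub>" by blast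
      obtain v w where vw: "u = Node v w" "v \<in> mdeg (D (-1)) r" "w \<in> mdeg (D 0) (r - 1)"
        using cone_module_cases(2) u(1) unfolding cone0 by blast
      have e1: "\<delta> (-1) v \<oplus>\<^bsub>D 0\<^esub> z \<odot>\<^bsub>D 0\<^esub> w = \<epsilon> m" and "\<ominus>\<^bsub>D 1\<^esub> \<delta> 0 w = \<zero>\<^bsub>D 1\<^esub>"
        using u(2) unfolding vw(1) cdiff1 by auto
      then have "\<delta> 0 w = \<zero>\<^bsub>D 1\<^esub>" using d0D(1)[OF Dcarr[OF vw(3)]] by simp
      \<comment> \<open>Since w is closed it comes from M up to a boundary, and \<epsilon> (m - z
        m') becomes \<delta> (v + z t).\<close>
      then obtain m' t where m': "m' \<in> mdeg M (r - 1)" and t: "t \<in> mdeg (D (-1)) (r - 1)"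
        and w: "w = \<epsilon> m' \<oplus>\<^bsub>D 0\<^esub> \<delta> (-1) t" using eps_surj[OF vw(3)] by blast
      note cs = Dcarr[OF vw(2)] Dcarr[OF t] d1D(1)[OF Dcarr[OF vw(2)]] d1D(1)[OF Dcarr[OF t]]
        eps_carr[OF Mcarr[OF m']] Mcarr[OF m'] Mcarr[OF m] zc
      let ?q = "m \<oplus>\<^bsub>M\<^esub> \<ominus>\<^bsub>M\<^esub> (z \<odot>\<^bsub>M\<^esub> m')"
      have zm: "z \<odot>\<^bsub>M\<^esub> m' \<in> mdeg M r" using Mdeg_smult[OF z m'] by simp
      have qd: "?q \<in> mdeg M r" by (rule pregradedD(5)[OF Mgr m pregradedD(6)[OF Mgr zm]])
      have "\<epsilon> ?q = \<epsilon> m \<oplus>\<^bsub>D 0\<^esub> \<ominus>\<^bsub>D 0\<^esub> (z \<odot>\<^bsub>D 0\<^esub> \<epsilon> m')"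
        using graded_homD(2)[OF eps cs(7) M.M.a_inv_closed[OF Mcarr[OF zm]]]
          graded_hom_minus[OF eps Mmod Dmod Mcarr[OF zm]] eps_smult[OF zc cs(6)] by simp
      also have "\<dots> = \<delta> (-1) v \<oplus>\<^bsub>D 0\<^esub> z \<odot>\<^bsub>D 0\<^esub> \<delta> (-1) t"
      proof -
        have "\<epsilon> m = (\<delta> (-1) v \<oplus>\<^bsub>D 0\<^esub> z \<odot>\<^bsub>D 0\<^esub> \<delta> (-1) t) \<oplus>\<^bsub>D 0\<^esub> z \<odot>\<^bsub>D 0\<^esub> \<epsilon> m'"
          unfolding e1[symmetric] w using cs by (simp add: B.smult_r_distr B.M.a_ac)
        then show ?thesis using cs by (simp add: B.M.a_assoc B.M.r_neg)
      qed
      also have "\<dots> = \<delta> (-1) (v \<oplus>\<^bsub>D (-1)\<^esub> z \<odot>\<^bsub>D (-1)\<^esub> t)"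
        using d1D(2)[OF cs(1) A.smult_closed[OF zc cs(2)]] d1D(3)[OF zc cs(2)] by simp
      finally have "?q \<in> Q r" using eps_kernel[OF qd] Ddeg_add[OF vw(2) zdeg0[OF t]] by metis
      moreover have "m = ?q \<oplus>\<^bsub>M\<^esub> z \<odot>\<^bsub>M\<^esub> m'" using cs by (simp add: M.M.a_assoc M.M.l_neg)
      ultimately show "m \<in> Q' r" unfolding Q' using m' by blast
    next
      assume "m \<in> Q' r"
      then obtain q m' where q: "q \<in> Q r" "m' \<in> mdeg M (r - 1)" "m = q \<oplus>\<^bsub>M\<^esub> z \<odot>\<^bsub>M\<^esub> m'" unfolding Q' by blast
      have qd: "q \<in> mdeg M r" using q Qsub by blast
      obtain v where v: "v \<in> mdeg (D (-1)) r" "\<delta> (-1) v = \<epsilon> q" using eps_kernel[OF qd] q by blast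
      have "\<epsilon> m = \<epsilon> q \<oplus>\<^bsub>D 0\<^esub> z \<odot>\<^bsub>D 0\<^esub> \<epsilon> m'"
        using graded_homD(2)[OF eps Mcarr[OF qd] M.smult_closed[OF zc Mcarr[OF q(2)]]]
          eps_smult[OF zc Mcarr[OF q(2)]] q(3) by simp
      \<comment> \<open>v accounts for the summand q of m, and \<epsilon> m' as second component
        contributes z m'.\<close>
      then have "cone_diff z D \<delta> (-1) (Node v (\<epsilon> m')) = Node (\<epsilon> m) \<zero>\<^bsub>D 1\<^esub>"
        unfolding cdiff1 using v(2) eps_cocycle[OF Mcarr[OF q(2)]] by simp
      moreover have "Node v (\<epsilon> m') \<in> mdeg (cone_complex D (-1)) r"
        unfolding cone0 cone_module_simps using v eps_deg[OF q(2)] by simp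
      ultimately show "\<exists>w\<in>mdeg (cone_complex D (-1)) r. cone_diff z D \<delta> (-1) w = Node (\<epsilon> m) \<zero>\<^bsub>D 1\<^esub>" by blast
    qed
  qed
qed

end

section \<open>The resolution as a complex indexed by the integers\<close>

definition leaf_module :: "('a, 'e) graded_module \<Rightarrow> ('a, 'e ktree) graded_module" where
  "leaf_module E = \<lparr>carrier = Leaf ` carrier E, monoid.mult = (\<lambda>_ _. Leaf \<zero>\<^bsub>E\<^esub>), one = Leaf \<zero>\<^bsub>E\<^esub>,
     ring.zero = Leaf \<zero>\<^bsub>E\<^esub>, add = (\<lambda>u v. Leaf (leaf_val u \<oplus>\<^bsub>E\<^esub> leaf_val v)),
     smult = (\<lambda>a u. Leaf (a \<odot>\<^bsub>E\<^esub> leaf_val u)), mdeg = (\<lambda>r. Leaf ` mdeg E r)\<rparr>"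

definition trivial_module :: "'e \<Rightarrow> ('a, 'e) graded_module" where
  "trivial_module c = \<lparr>carrier = {c}, monoid.mult = (\<lambda>_ _. c), one = c, ring.zero = c,
     add = (\<lambda>_ _. c), smult = (\<lambda>_ _. c), mdeg = (\<lambda>_. {c})\<rparr>"

text \<open>The zero modules in negative degrees are the places that later cones fill. Their single
  element is borrowed from E(0) in order to stay within the type.\<close>

definition base_complex :: "(nat \<Rightarrow> ('a, 'e) graded_module) \<Rightarrow> int \<Rightarrow> ('a, 'e ktree) graded_module" where
  "base_complex E j = leaf_module (if 0 \<le> j then E (nat j) else trivial_module \<zero>\<^bsub>E 0\<^esub>)"

definition base_diff :: "(nat \<Rightarrow> ('a, 'e) graded_module) \<Rightarrow> (nat \<Rightarrow> 'e \<Rightarrow> 'e) \<Rightarrow> int \<Rightarrow> 'e ktree \<Rightarrow> 'e ktree" where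
  "base_diff E d j u = Leaf (if 0 \<le> j then d (nat j) (leaf_val u) else \<zero>\<^bsub>E 0\<^esub>)"

lemma leaf_module_simps:
  "Leaf x \<in> carrier (leaf_module E) \<longleftrightarrow> x \<in> carrier E"
  "\<zero>\<^bsub>leaf_module E\<^esub> = Leaf \<zero>\<^bsub>E\<^esub>"
  "Leaf x \<oplus>\<^bsub>leaf_module E\<^esub> Leaf y = Leaf (x \<oplus>\<^bsub>E\<^esub> y)"
  "a \<odot>\<^bsub>leaf_module E\<^esub> Leaf x = Leaf (a \<odot>\<^bsub>E\<^esub> x)"
  "Leaf x \<in> mdeg (leaf_module E) r \<longleftrightarrow> x \<in> mdeg E r"
  by (auto simp: leaf_module_def)

lemma leaf_module_cases:
  "u \<in> carrier (leaf_module E) \<Longrightarrow> \<exists>x\<in>carrier E. u = Leaf x"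
  "u \<in> mdeg (leaf_module E) r \<Longrightarrow> \<exists>x\<in>mdeg E r. u = Leaf x"
  by (auto simp: leaf_module_def)

context graded_ring_base
begin

lemma leaf_module_pregraded:
  assumes U: "pregraded R U"
  shows "pregraded R (leaf_module U)"
proof -
  interpret U: module R U by (rule pregradedD(1)[OF U])
  let ?L = "leaf_module U"
  have ab: "abelian_group ?L"
  proof (rule abelian_groupI)
    fix u assume "u \<in> carrier ?L"
    then obtain x where u: "u = Leaf x" "x \<in> carrier U" using leaf_module_cases(1) by blast
    then show "\<exists>v\<in>carrier ?L. v \<oplus>\<^bsub>?L\<^esub> u = \<zero>\<^bsub>?L\<^esub>"
      by (intro bexI[of _ "Leaf (\<ominus>\<^bsub>U\<^esub> x)"]) (auto simp: leaf_module_simps U.M.l_neg)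
  qed (auto dest!: leaf_module_cases(1) simp: leaf_module_simps U.M.a_ac)
  have mod: "module R ?L"
    by (rule moduleI[OF is_cring ab])
      (auto dest!: leaf_module_cases(1) simp: leaf_module_simps U.smult_l_distr
        U.smult_r_distr U.smult_assoc1)
  interpret L: module R ?L by (rule mod)
  have neg: "\<ominus>\<^bsub>?L\<^esub> (Leaf x) = Leaf (\<ominus>\<^bsub>U\<^esub> x)" if "x \<in> carrier U" for x
    by (rule L.M.minus_equality) (use that in \<open>auto simp: leaf_module_simps U.M.l_neg\<close>)
  have "subgroup (mdeg ?L r) (add_monoid ?L)" for r
  proof (rule L.M.add.subgroupI)
    have "Leaf \<zero>\<^bsub>U\<^esub> \<in> mdeg ?L r" using pregradedD(4)[OF U] by (simp add: leaf_module_simps)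
    then show "mdeg ?L r \<noteq> {}" by blast
    show "mdeg ?L r \<subseteq> carrier ?L"
      using pregradedD(3)[OF U] by (auto simp: leaf_module_def)
    fix u assume "u \<in> mdeg ?L r"
    then obtain x where u: "u = Leaf x" "x \<in> mdeg U r" using leaf_module_cases(2) by blast
    show "\<ominus>\<^bsub>?L\<^esub> u \<in> mdeg ?L r"
      using u neg pregradedD(9)[OF U u(2)] pregradedD(6)[OF U u(2)] by (simp add: leaf_module_simps)
    fix v assume "v \<in> mdeg ?L r"
    then obtain y where v: "v = Leaf y" "y \<in> mdeg U r" using leaf_module_cases(2) by blast
    show "u \<oplus>\<^bsub>?L\<^esub> v \<in> mdeg ?L r"
      using u v pregradedD(5)[OF U u(2) v(2)] by (simp add: leaf_module_simps)
  qed
  moreover have "a \<odot>\<^bsub>?L\<^esub> u \<in> mdeg ?L (int n + r)" if a: "a \<in> rdeg R n" and u0: "u \<in> mdeg ?L r" for a n u r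
    using leaf_module_cases(2)[OF u0] pregradedD(7)[OF U a] by (auto simp: leaf_module_simps)
  ultimately show ?thesis using mod unfolding pregraded_def by blast
qed

lemma leaf_module_baer:
  assumes U: "baer_injective R U"
  shows "baer_injective R (leaf_module U)"
  unfolding baer_injective_def
proof (intro allI impI)
  let ?L = "leaf_module U"
  fix r I \<phi>
  assume A: "ideal_hom R ?L r I \<phi>"
  note I = ideal_homD(1-4)[OF A] and phi = ideal_homD(5-7)[OF A]
  define f where "f = (\<lambda>k a. leaf_val (\<phi> k a))"
  have fg: "\<phi> k a = Leaf (f k a)" "f k a \<in> mdeg U k" if "a \<in> I k" for k a
    using leaf_module_cases(2)[OF phi(1)[OF that]] by (auto simp: f_def)
  have add: "f k (a \<oplus> b) = f k a \<oplus>\<^bsub>U\<^esub> f k b" if "a \<in> I k" "b \<in> I k" for k a b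
    using phi(2)[OF that] fg(1)[OF that(1)] fg(1)[OF that(2)] fg(1)[OF I(3)[OF that]]
    by (simp add: leaf_module_simps)
  have mul: "f (int n + k) (b \<otimes> a) = b \<odot>\<^bsub>U\<^esub> f k a" if "b \<in> rdeg R n" "a \<in> I k" for k a b n
    using phi(3)[OF that] fg(1)[OF that(2)] fg(1)[OF I(4)[OF that]]
    by (simp add: leaf_module_simps)
  have "\<exists>x\<in>mdeg U r. \<forall>k. \<forall>a\<in>I k. f k a = a \<odot>\<^bsub>U\<^esub> x"
    by (rule baer_injectiveD[OF U], unfold ideal_hom_def)
      (intro conjI allI ballI I fg(2) add mul; assumption)
  then obtain x where x: "x \<in> mdeg U r" "\<And>k a. a \<in> I k \<Longrightarrow> f k a = a \<odot>\<^bsub>U\<^esub> x" by blast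
  have "\<phi> k a = a \<odot>\<^bsub>?L\<^esub> Leaf x" if "a \<in> I k" for k a
    using fg(1)[OF that] x(2)[OF that] by (simp add: leaf_module_simps)
  moreover have "Leaf x \<in> mdeg ?L r" using x by (simp add: leaf_module_simps)
  ultimately show "\<exists>u\<in>mdeg ?L r. \<forall>k. \<forall>a\<in>I k. \<phi> k a = a \<odot>\<^bsub>?L\<^esub> u" by blast
qed

lemma trivial_module_pregraded:
  fixes c :: 'e
  shows "pregraded R (trivial_module c)"
proof -
  let ?T = "trivial_module c :: ('a, 'e) graded_module"
  have ab: "abelian_group ?T"
    by (rule abelian_groupI) (auto simp: trivial_module_def)
  have mod: "module R ?T"
    by (rule moduleI[OF is_cring ab]) (auto simp: trivial_module_def)
  interpret T: module R ?T by (rule mod)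
  have c: "carrier ?T = {c}" "mdeg ?T r = {c}" for r
    by (simp_all add: trivial_module_def)
  have "subgroup (carrier ?T) (add_monoid ?T)"
    using T.M.add.subgroup_self by simp
  then have "subgroup (mdeg ?T r) (add_monoid ?T)" for r
    unfolding c .
  moreover have "a \<odot>\<^bsub>?T\<^esub> x \<in> mdeg ?T r" for a x r
    by (simp add: trivial_module_def)
  ultimately show ?thesis using mod unfolding pregraded_def by blast
qed

lemma trivial_module_baer: "baer_injective R (trivial_module c)"
  unfolding baer_injective_def
  by (intro allI impI bexI[of _ c]) (auto simp: trivial_module_def ideal_hom_def)

lemma htors_leaf: "htors R (leaf_module U) r = Leaf ` htors R U r"
proof -
  have "Leaf x \<in> htors R (leaf_module U) r \<longleftrightarrow> x \<in> htors R U r" for x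
    unfolding htors_def by (simp add: leaf_module_simps)
  moreover have "\<exists>x. u = Leaf x" if "u \<in> htors R (leaf_module U) r" for u
    using that leaf_module_cases(2)[of u U r] unfolding htors_def by blast
  ultimately show ?thesis by blast
qed

context
  fixes M :: "('a, 'm) graded_module" and \<epsilon> :: "'m \<Rightarrow> 'e" and E :: "nat \<Rightarrow> ('a, 'e) graded_module"
    and d :: "nat \<Rightarrow> 'e \<Rightarrow> 'e"
  assumes res: "graded_injective_resolution R M \<epsilon> E d" and M: "is_graded_module R M"
begin

lemma res_inj: "graded_injective R (E i)"
  and res_eps: "\<epsilon> \<in> graded_hom R M (E 0)"
  and res_diff: "d i \<in> graded_hom R (E i) (E (Suc i))"
  and res_eps_inj: "inj_on \<epsilon> (carrier M)"
  and res_eps_image: "\<epsilon> ` carrier M = {x \<in> carrier (E 0). d 0 x = \<zero>\<^bsub>E 1\<^esub>}"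
  and res_exact: "d i ` carrier (E i) = {x \<in> carrier (E (Suc i)). d (Suc i) x = \<zero>\<^bsub>E (Suc (Suc i))\<^esub>}"
  using res unfolding graded_injective_resolution_def a_kernel_def' by blast+

lemma res_graded: "is_graded_module R (E i)"
  using res_inj[of i] unfolding graded_injective_def by blast

text \<open>Start of the induction over the cones, with nothing divided out of M. Both constants are
  0: the complex vanishes left of 0, so exactness there holds in all internal degrees.\<close>

lemma base_stage:
  "koszul_stage R (base_complex E) (base_diff E d) M (\<lambda>m. Leaf (\<epsilon> m)) (\<lambda>_. {\<zero>\<^bsub>M\<^esub>}) 0 0"
proof (unfold_locales)
  note Epg = is_graded_module_pregraded[OF res_graded]
  have E0: "module R (E i)" for i by (rule pregradedD(1)[OF Epg])
  have base_pos: "base_complex E j = leaf_module (E (nat j))" if "0 \<le> j" for j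
    using that by (simp add: base_complex_def)
  have base_neg: "base_complex E j = leaf_module (trivial_module \<zero>\<^bsub>E 0\<^esub>)" if "j < 0" for j
    using that by (simp add: base_complex_def)
  have neg_carr: "carrier (base_complex E j) = {Leaf \<zero>\<^bsub>E 0\<^esub>}" "mdeg (base_complex E j) r = {Leaf \<zero>\<^bsub>E 0\<^esub>}"
    "\<zero>\<^bsub>base_complex E j\<^esub> = Leaf \<zero>\<^bsub>E 0\<^esub>" if "j < 0" for j r
    using that by (auto simp: base_neg leaf_module_def trivial_module_def)
  have zero0: "d i \<zero>\<^bsub>E i\<^esub> = \<zero>\<^bsub>E (Suc i)\<^esub>" for i by (rule graded_hom_zero[OF res_diff E0 E0])
  show "pregraded R M" by (rule is_graded_module_pregraded[OF M])
  show pg: "pregraded R (base_complex E j)" for j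
    unfolding base_complex_def by (intro leaf_module_pregraded) (use Epg trivial_module_pregraded in auto)
  show "baer_injective R (base_complex E j)" for j
    unfolding base_complex_def
    by (intro leaf_module_baer) (use graded_injective_baer[OF res_inj] trivial_module_baer in auto)
  show "base_diff E d j \<in> graded_hom R (base_complex E j) (base_complex E (j + 1))" for j
  proof (cases "0 \<le> j")
    case True
    then have n: "nat (j + 1) = Suc (nat j)" by simp
    note f = graded_homD[OF res_diff[of "nat j"]]
    show ?thesis
      unfolding graded_hom_def using True f
      by (auto simp: base_pos base_diff_def n leaf_module_simps dest!: leaf_module_cases)
  next
    case False
    have z: "\<zero>\<^bsub>base_complex E (j + 1)\<^esub> = Leaf \<zero>\<^bsub>E 0\<^esub>"
      using False by (cases "j + 1 < 0") (auto simp: neg_carr base_pos leaf_module_simps)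
    interpret B: module R "base_complex E (j + 1)" by (rule pregradedD(1)[OF pg])
    have c: "base_diff E d j = (\<lambda>_. \<zero>\<^bsub>base_complex E (j + 1)\<^esub>)" using False z by (auto simp: base_diff_def)
    show ?thesis unfolding graded_hom_def c using pregradedD(4)[OF pg] by auto
  qed
  show "base_diff E d (j + 1) (base_diff E d j x) = \<zero>\<^bsub>base_complex E (j + 1 + 1)\<^esub>"
    if xc: "x \<in> carrier (base_complex E j)" for j x
  proof (cases "0 \<le> j")
    case True
    then have n: "nat (j + 1) = Suc (nat j)" "nat (j + 1 + 1) = Suc (Suc (nat j))" by auto
    obtain y where y: "x = Leaf y" "y \<in> carrier (E (nat j))"
      using xc True leaf_module_cases(1) by (auto simp: base_pos)
    then have "d (Suc (nat j)) (d (nat j) y) = \<zero>\<^bsub>E (Suc (Suc (nat j)))\<^esub>" using res_exact[of "nat j"] by blast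
    then show ?thesis using True y n base_pos[of "j + 1 + 1"] by (simp add: base_diff_def leaf_module_simps)
  next
    case False
    show ?thesis
    proof (cases "j + 1 < 0")
      case True
      show ?thesis
      proof (cases "j + 1 + 1 < 0")
        case True
        then show ?thesis using neg_carr(3)[OF True] by (simp add: base_diff_def)
      next
        case False
        then have "j + 1 + 1 = 0" using True by simp
        then show ?thesis using True base_pos[of 0] by (simp add: base_diff_def leaf_module_simps)
      qed
    next
      case F2: False
      then have "j = -1" using False by simp
      then show ?thesis using zero0[of 0] base_pos[of 1] by (simp add: base_diff_def leaf_module_simps)
    qed
  qed
  show "carrier (base_complex E j) = {\<zero>\<^bsub>base_complex E j\<^esub>}" if "j < 0" for j
    using neg_carr[OF that] by simp
  show "\<exists>w\<in>mdeg (base_complex E j) r. base_diff E d j w = x"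
    if j: "0 \<le> j" and x: "x \<in> mdeg (base_complex E (j + 1)) r"
      and c: "base_diff E d (j + 1) x = \<zero>\<^bsub>base_complex E (j + 1 + 1)\<^esub>" for j x r
  proof -
    let ?i = "nat j"
    have n: "nat (j + 1) = Suc ?i" "nat (j + 1 + 1) = Suc (Suc ?i)" using j by auto
    obtain y where y: "x = Leaf y" "y \<in> mdeg (E (Suc ?i)) r"
      using x j leaf_module_cases(2)[of x "E (Suc ?i)" r] by (auto simp: base_pos n)
    have "d (Suc ?i) y = \<zero>\<^bsub>E (Suc (Suc ?i))\<^esub>"
      using c j y n base_pos[of "j + 1 + 1"] by (simp add: base_diff_def leaf_module_simps)
    then have "y \<in> d ?i ` carrier (E ?i)" unfolding res_exact using pregradedD(9)[OF Epg y(2)] by blast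
    then obtain w where w: "w \<in> carrier (E ?i)" "d ?i w = y" by blast
    \<comment> \<open>The resolution provides a preimage without a degree; its component of degree r
      replaces it.\<close>
    obtain w' where "w' \<in> mdeg (E ?i) r" "d ?i w' = y"
      using hom_image_homogeneous[OF res_graded res_graded res_diff w(1)] w(2) y(2) by auto
    then show ?thesis using j y by (intro bexI[of _ "Leaf w'"]) (auto simp: base_pos base_diff_def leaf_module_simps)
  qed
  show "\<exists>w\<in>mdeg (base_complex E j) r. base_diff E d j w = x"
    if "j + 1 < 0" "0 \<le> r" "x \<in> mdeg (base_complex E (j + 1)) r" for j x r
    using that neg_carr(2)[of "j + 1" r] neg_carr(2)[of j r] by (auto simp: base_diff_def)
  show "(\<lambda>m. Leaf (\<epsilon> m)) \<in> graded_hom R M (base_complex E 0)"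
    unfolding graded_hom_def using graded_homD[OF res_eps] by (auto simp: base_pos leaf_module_simps)
  show "base_diff E d 0 (Leaf (\<epsilon> m)) = \<zero>\<^bsub>base_complex E 1\<^esub>" if "m \<in> carrier M" for m
    using res_eps_image that by (auto simp: base_pos base_diff_def leaf_module_simps)
  show "\<exists>m\<in>mdeg M r. \<exists>w\<in>mdeg (base_complex E (-1)) r.
      x = Leaf (\<epsilon> m) \<oplus>\<^bsub>base_complex E 0\<^esub> base_diff E d (-1) w"
    if x: "x \<in> mdeg (base_complex E 0) r" and c: "base_diff E d 0 x = \<zero>\<^bsub>base_complex E 1\<^esub>" for x r
  proof -
    obtain y where y: "x = Leaf y" "y \<in> mdeg (E 0) r" using x leaf_module_cases(2)[of x "E 0" r] by (auto simp: base_pos)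
    interpret B: module R "E 0" by (rule E0)
    have "d 0 y = \<zero>\<^bsub>E 1\<^esub>" using c y by (simp add: base_pos base_diff_def leaf_module_simps)
    then have "y \<in> \<epsilon> ` carrier M" unfolding res_eps_image using pregradedD(9)[OF Epg y(2)] by blast
    then obtain m where m: "m \<in> carrier M" "\<epsilon> m = y" by blast
    obtain m' where m': "m' \<in> mdeg M r" "\<epsilon> m' = y"
      using hom_image_homogeneous[OF M res_graded res_eps m(1)] m(2) y(2) by auto
    have "x = Leaf (\<epsilon> m') \<oplus>\<^bsub>base_complex E 0\<^esub> base_diff E d (-1) (Leaf \<zero>\<^bsub>E 0\<^esub>)"
      using y m' pregradedD(9)[OF Epg y(2)] by (simp add: base_pos base_diff_def leaf_module_simps)
    then show ?thesis using m' neg_carr(2)[of "-1" r] by auto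
  qed
  show "(\<exists>w\<in>mdeg (base_complex E (-1)) r. base_diff E d (-1) w = Leaf (\<epsilon> m)) \<longleftrightarrow> m \<in> {\<zero>\<^bsub>M\<^esub>}"
    if m: "m \<in> mdeg M r" for m r
  proof -
    have Mp: "pregraded R M" by (rule is_graded_module_pregraded[OF M])
    have e0: "\<epsilon> \<zero>\<^bsub>M\<^esub> = \<zero>\<^bsub>E 0\<^esub>" by (rule graded_hom_zero[OF res_eps pregradedD(1)[OF Mp] E0])
    have "\<epsilon> m = \<epsilon> \<zero>\<^bsub>M\<^esub> \<longleftrightarrow> m = \<zero>\<^bsub>M\<^esub>"
      by (rule inj_on_eq_iff[OF res_eps_inj pregradedD(9)[OF Mp m] pregradedD(9)[OF Mp pregradedD(4)[OF Mp]]])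
    then have "\<epsilon> m = \<zero>\<^bsub>E 0\<^esub> \<longleftrightarrow> m \<in> {\<zero>\<^bsub>M\<^esub>}" unfolding e0 by simp
    moreover have "(\<exists>w\<in>mdeg (base_complex E (-1)) r. base_diff E d (-1) w = Leaf (\<epsilon> m)) \<longleftrightarrow> \<zero>\<^bsub>E 0\<^esub> = \<epsilon> m"
      by (simp add: base_diff_def neg_carr(2))
    ultimately show ?thesis by metis
  qed
qed

end

end

section \<open>Regularity and socles\<close>

text \<open>Order theory on the table h. Along an antidiagonal, \<open>lower\<close> trades one step
  in j for one step in i at the cost of 1, which gives h 0 j + j <= h j 0 and bounds row 0 by column
  0. Conversely \<open>upper\<close>, by induction on i, bounds the whole triangle i + j <= t by row
  0.\<close>

lemma max_diagonal:
  fixes h :: "nat \<Rightarrow> nat \<Rightarrow> ereal"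
  assumes lower: "\<And>i j. i < t \<Longrightarrow> h i (Suc j) + 1 \<le> h (Suc i) j"
    and upper: "\<And>i j. i < t \<Longrightarrow> h (Suc i) j \<le> max (h i j) (h i (Suc j) + 1)"
  shows "(MAX j\<in>{0..t}. h 0 j + ereal (real j)) = (MAX i\<in>{0..t}. h i 0)"
    and "(MAX j\<in>{0..t}. h 0 j) = (MAX i\<in>{0..t}. h i 0 - ereal (real i))"
proof -
  have split: "h i (Suc j) + ereal (real (Suc j)) = h i (Suc j) + 1 + ereal (real j)" for i j
    by (simp add: add.assoc one_ereal_def)
  have low: "h i j + ereal (real j) \<le> h (i + j) 0" if "i + j \<le> t" for i j
    using that
  proof (induction j arbitrary: i)
    case (Suc j)
    have "h i (Suc j) + ereal (real (Suc j)) \<le> h (Suc i) j + ereal (real j)"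
      unfolding split by (rule add_right_mono) (use lower Suc.prems in auto)
    also have "\<dots> \<le> h (Suc i + j) 0" by (rule Suc.IH) (use Suc.prems in simp)
    finally show ?case by simp
  qed (simp add: zero_ereal_def[symmetric])
  define x where "x = (MAX j\<in>{0..t}. h 0 j + ereal (real j))"
  define y where "y = (MAX j\<in>{0..t}. h 0 j)"
  have x: "h 0 j + ereal (real j) \<le> x" and y: "h 0 j \<le> y" if "j \<le> t" for j
    unfolding x_def y_def using that by (auto intro!: Max_ge)
  \<comment> \<open>Both entries supplied by \<open>upper\<close> stay inside the triangle, and the
    extra 1 is absorbed because the second one sits at Suc j.\<close>
  have up1: "h i j + ereal (real j) \<le> x" if "i + j \<le> t" for i j
    using that
  proof (induction i arbitrary: j)
    case (Suc i)
    have "h (Suc i) j + ereal (real j) \<le> max (h i j) (h i (Suc j) + 1) + ereal (real j)"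
      by (rule add_right_mono) (use upper Suc.prems in auto)
    also have "\<dots> \<le> x"
      using Suc.IH[of j] Suc.IH[of "Suc j"] Suc.prems unfolding split by (auto simp: max_def)
    finally show ?case .
  qed (use x in auto)
  \<comment> \<open>Without the weight j every row passed may add 1, which accounts for the summand
    i.\<close>
  have up2: "h i j \<le> y + ereal (real i)" if "i + j \<le> t" for i j
    using that
  proof (induction i arbitrary: j)
    case (Suc i)
    have "ereal (real (Suc i)) = ereal (real i) + 1" by (simp add: one_ereal_def add.commute)
    then have e: "y + ereal (real (Suc i)) = y + ereal (real i) + 1" by (simp only: add.assoc)
    have "h i j \<le> y + ereal (real i)" using Suc.IH[of j] Suc.prems by simp
    also have "\<dots> \<le> y + ereal (real (Suc i))" by (rule add_left_mono) simp
    finally have 1: "h i j \<le> y + ereal (real (Suc i))" .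
    have 2: "h i (Suc j) + 1 \<le> y + ereal (real (Suc i))"
      unfolding e by (rule add_right_mono) (use Suc.IH[of "Suc j"] Suc.prems in simp)
    show ?case using upper[of i j] Suc.prems 1 2 by (meson Suc_le_lessD add_leE le_trans max.boundedI order_trans)
  qed (use y in \<open>auto simp: zero_ereal_def[symmetric]\<close>)
  have "x = (MAX i\<in>{0..t}. h i 0)"
  proof (rule antisym)
    show "x \<le> (MAX i\<in>{0..t}. h i 0)" unfolding x_def
    proof (rule Max.boundedI)
      fix a assume "a \<in> (\<lambda>j. h 0 j + ereal (real j)) ` {0..t}"
      then obtain j where j: "j \<le> t" "a = h 0 j + ereal (real j)" by auto
      have "a \<le> h j 0" using low[of 0 j] j by simp
      also have "\<dots> \<le> (MAX i\<in>{0..t}. h i 0)" using j by (auto intro!: Max_ge)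
      finally show "a \<le> (MAX i\<in>{0..t}. h i 0)" .
    qed auto
    show "(MAX i\<in>{0..t}. h i 0) \<le> x"
      by (rule Max.boundedI) (use up1[of _ 0] in \<open>auto simp: zero_ereal_def[symmetric]\<close>)
  qed
  then show "(MAX j\<in>{0..t}. h 0 j + ereal (real j)) = (MAX i\<in>{0..t}. h i 0)" unfolding x_def .
  have "y = (MAX i\<in>{0..t}. h i 0 - ereal (real i))"
  proof (rule antisym)
    show "y \<le> (MAX i\<in>{0..t}. h i 0 - ereal (real i))" unfolding y_def
    proof (rule Max.boundedI)
      fix a assume "a \<in> h 0 ` {0..t}"
      then obtain j where j: "j \<le> t" "a = h 0 j" by auto
      have "a \<le> h j 0 - ereal (real j)" using low[of 0 j] j by (simp add: ereal_le_minus)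
      also have "\<dots> \<le> (MAX i\<in>{0..t}. h i 0 - ereal (real i))" using j by (auto intro!: Max_ge)
      finally show "a \<le> (MAX i\<in>{0..t}. h i 0 - ereal (real i))" .
    qed auto
    show "(MAX i\<in>{0..t}. h i 0 - ereal (real i)) \<le> y"
      by (rule Max.boundedI) (use up2[of _ 0] in \<open>auto simp: ereal_minus_le\<close>)
  qed
  then show "(MAX j\<in>{0..t}. h 0 j) = (MAX i\<in>{0..t}. h i 0 - ereal (real i))" unfolding y_def .
qed

section \<open>Nonzero components of graded subquotients\<close>

lemma (in abelian_group) coset_eq_iff:
  assumes "subgroup N (add_monoid G)" "x \<in> carrier G"
  shows "N +> x = N \<longleftrightarrow> x \<in> N"
  using a_coset_join1[OF _ assms(2,1)] a_coset_join2[OF assms(2,1)] by auto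

text \<open>Local cohomology and \<open>colon_quot\<close> both have this shape; from here on cosets
  are replaced by elements of S outside N.\<close>

lemma graded_quot_nonzero_iff:
  assumes "abelian_group M" "subgroup N (add_monoid M)" "mdeg M r \<subseteq> carrier M"
    "\<zero>\<^bsub>M\<^esub> \<in> mdeg M r" "\<zero>\<^bsub>M\<^esub> \<in> S"
  shows "mdeg (graded_quot (graded_sub M S) N) r \<noteq> {\<zero>\<^bsub>graded_quot (graded_sub M S) N\<^esub>} \<longleftrightarrow>
    (\<exists>x\<in>mdeg M r. x \<in> S \<and> x \<notin> N)"
proof -
  interpret abelian_group M by (rule assms)
  have coset: "N +>\<^bsub>graded_sub M S\<^esub> x = N +>\<^bsub>M\<^esub> x" for x
    by (simp add: a_r_coset_def' graded_sub_def)
  have "mdeg (graded_quot (graded_sub M S) N) r = (\<lambda>x. N +>\<^bsub>M\<^esub> x) ` (mdeg M r \<inter> S)"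
    unfolding graded_quot_def by (simp add: coset) (simp add: graded_sub_def)
  moreover have "\<zero>\<^bsub>graded_quot (graded_sub M S) N\<^esub> = N" by (simp add: graded_quot_def)
  moreover have "(\<lambda>x. N +>\<^bsub>M\<^esub> x) ` (mdeg M r \<inter> S) = {N} \<longleftrightarrow> (\<forall>x\<in>mdeg M r \<inter> S. x \<in> N)"
    using coset_eq_iff[OF assms(2)] assms(3,4,5) by auto
  ultimately show ?thesis by auto
qed

section \<open>The iterated cones and the submodules Q_i M\<close>

fun koszul_complex :: "(nat \<Rightarrow> 'a) \<Rightarrow> (nat \<Rightarrow> ('a, 'e) graded_module) \<Rightarrow> (nat \<Rightarrow> 'e \<Rightarrow> 'e) \<Rightarrow> nat \<Rightarrow>
    (int \<Rightarrow> ('a, 'e ktree) graded_module) \<times> (int \<Rightarrow> 'e ktree \<Rightarrow> 'e ktree)" where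
  "koszul_complex z E d 0 = (base_complex E, base_diff E d)"
| "koszul_complex z E d (Suc i) =
     (cone_complex (fst (koszul_complex z E d i)),
      cone_diff (z (Suc i)) (fst (koszul_complex z E d i)) (snd (koszul_complex z E d i)))"

text \<open>Q_i M built up one generator at a time, in step with the cones.\<close>

fun seq_sum :: "('a, 'm, 'y) module_scheme \<Rightarrow> (nat \<Rightarrow> 'a) \<Rightarrow> nat \<Rightarrow> 'm set" where
  "seq_sum M z 0 = {\<zero>\<^bsub>M\<^esub>}"
| "seq_sum M z (Suc i) = {q \<oplus>\<^bsub>M\<^esub> z (Suc i) \<odot>\<^bsub>M\<^esub> m | q m. q \<in> seq_sum M z i \<and> m \<in> carrier M}"

context module
begin

lemma seq_sum_submodule:
  assumes "\<And>k. k \<in> {1..i} \<Longrightarrow> z k \<in> carrier R"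
  shows "submodule (seq_sum M z i) R M"
  using assms
proof (induction i)
  case 0
  show ?case by (rule submoduleI) auto
next
  case (Suc i)
  interpret S: submodule "seq_sum M z i" R M by (rule Suc.IH) (use Suc.prems in auto)
  note E = submoduleE[OF S.submodule_axioms]
  have zc: "z (Suc i) \<in> carrier R" using Suc.prems by simp
  have q: "q \<in> carrier M" if "q \<in> seq_sum M z i" for q using E(1) that by blast
  have z0: "\<zero>\<^bsub>M\<^esub> \<in> seq_sum M z i" using S.one_closed by simp
  show ?case
  proof (rule submoduleI)
    show "seq_sum M z (Suc i) \<subseteq> carrier M" using q zc by auto
    show "\<zero>\<^bsub>M\<^esub> \<in> seq_sum M z (Suc i)"
      using z0 zc by (auto intro!: exI[of _ "\<zero>\<^bsub>M\<^esub>"])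
    fix a assume "a \<in> seq_sum M z (Suc i)"
    then obtain q1 m1 where a: "a = q1 \<oplus>\<^bsub>M\<^esub> z (Suc i) \<odot>\<^bsub>M\<^esub> m1" "q1 \<in> seq_sum M z i" "m1 \<in> carrier M" by auto
    have "\<ominus>\<^bsub>M\<^esub> a = \<ominus>\<^bsub>M\<^esub> q1 \<oplus>\<^bsub>M\<^esub> z (Suc i) \<odot>\<^bsub>M\<^esub> (\<ominus>\<^bsub>M\<^esub> m1)"
      using a q zc by (simp add: M.minus_add smult_r_minus)
    then show "\<ominus>\<^bsub>M\<^esub> a \<in> seq_sum M z (Suc i)" using E(3)[OF a(2)] a(3) by auto
    fix b assume "b \<in> seq_sum M z (Suc i)"
    then obtain q2 m2 where b: "b = q2 \<oplus>\<^bsub>M\<^esub> z (Suc i) \<odot>\<^bsub>M\<^esub> m2" "q2 \<in> seq_sum M z i" "m2 \<in> carrier M" by auto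
    have "a \<oplus>\<^bsub>M\<^esub> b = (q1 \<oplus>\<^bsub>M\<^esub> q2) \<oplus>\<^bsub>M\<^esub> z (Suc i) \<odot>\<^bsub>M\<^esub> (m1 \<oplus>\<^bsub>M\<^esub> m2)"
      using a b q zc by (simp add: smult_r_distr M.a_ac)
    then show "a \<oplus>\<^bsub>M\<^esub> b \<in> seq_sum M z (Suc i)" using E(5)[OF a(2) b(2)] a(3) b(3) by auto
  next
    fix a x assume a: "a \<in> carrier R" and "x \<in> seq_sum M z (Suc i)"
    then obtain q m where x: "x = q \<oplus>\<^bsub>M\<^esub> z (Suc i) \<odot>\<^bsub>M\<^esub> m" "q \<in> seq_sum M z i" "m \<in> carrier M" by auto
    have "a \<odot>\<^bsub>M\<^esub> (z (Suc i) \<odot>\<^bsub>M\<^esub> m) = z (Suc i) \<odot>\<^bsub>M\<^esub> (a \<odot>\<^bsub>M\<^esub> m)"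
      using a zc x by (metis smult_assoc1 R.m_comm)
    then have "a \<odot>\<^bsub>M\<^esub> x = a \<odot>\<^bsub>M\<^esub> q \<oplus>\<^bsub>M\<^esub> z (Suc i) \<odot>\<^bsub>M\<^esub> (a \<odot>\<^bsub>M\<^esub> m)"
      using a x q zc by (simp add: smult_r_distr)
    then show "a \<odot>\<^bsub>M\<^esub> x \<in> seq_sum M z (Suc i)" using E(4)[OF a x(2)] a x(3) by auto
  qed
qed

end

context graded_ring_base
begin

text \<open>For one inclusion, the ring elements that carry M into \<open>seq_sum M z i\<close> form
  an ideal containing the generators. For the other, a submodule that contains all products absorbs
  the summands one after the other.\<close>

lemma ideal_times_seq_sum:
  fixes M :: "('a, 'm) graded_module"
  assumes M: "module R M" and z: "\<And>k. k \<in> {1..i} \<Longrightarrow> z k \<in> carrier R"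
  shows "ideal_times_module R (seq_ideal R z i) M = seq_sum M z i"
proof -
  interpret M: module R M by (rule M)
  have sub: "submodule (seq_sum M z k) R M" if "k \<le> i" for k
    by (rule M.seq_sum_submodule) (use z that in auto)
  have zs: "z ` {1..i} \<subseteq> carrier R" using z by auto
  interpret S: submodule "seq_sum M z i" R M by (rule sub) simp
  note E = M.submoduleE[OF S.submodule_axioms]
  have z0: "\<zero>\<^bsub>M\<^esub> \<in> seq_sum M z k" if "k \<le> i" for k
    using subgroup.one_closed[OF submodule.axioms(1)[OF sub[OF that]]] by simp
  let ?J = "{q \<in> carrier R. \<forall>e\<in>carrier M. q \<odot>\<^bsub>M\<^esub> e \<in> seq_sum M z i}"
  have mono: "seq_sum M z k \<subseteq> seq_sum M z k'" if "k \<le> k'" "k' \<le> i" for k k'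
    using that
  proof (induction k' rule: dec_induct)
    case (step n)
    have "seq_sum M z n \<subseteq> seq_sum M z (Suc n)"
    proof
      fix q assume q: "q \<in> seq_sum M z n"
      then have "q = q \<oplus>\<^bsub>M\<^esub> z (Suc n) \<odot>\<^bsub>M\<^esub> \<zero>\<^bsub>M\<^esub>"
        using M.submoduleE(1)[OF sub[of n]] step z by auto
      then show "q \<in> seq_sum M z (Suc n)" using q by auto
    qed
    then show ?case using step by auto
  qed simp
  have "ideal ?J R"
  proof (rule idealI)
    show "ring R" by (rule ring_axioms)
    show "subgroup ?J (add_monoid R)"
    proof (rule add.subgroupI)
      show "?J \<noteq> {}" using z0[of i] by (auto intro!: exI[of _ \<zero>])
    qed (use E in \<open>auto simp: M.smult_l_distr M.smult_l_minus\<close>)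
    show "x \<otimes> a \<in> ?J" if "a \<in> ?J" "x \<in> carrier R" for a x
      using that E(4) by (auto simp: M.smult_assoc1)
    then show "a \<otimes> x \<in> ?J" if "a \<in> ?J" "x \<in> carrier R" for a x
      using m_comm[of a x] that by auto
  qed
  moreover have "z ` {1..i} \<subseteq> ?J"
  proof
    fix q assume "q \<in> z ` {1..i}"
    then obtain n where n: "q = z n" "1 \<le> n" "n \<le> i" by auto
    then obtain k where k: "q = z (Suc k)" "Suc k \<le> i" by (cases n) auto
    have "z (Suc k) \<odot>\<^bsub>M\<^esub> e \<in> seq_sum M z i" if "e \<in> carrier M" for e
    proof -
      have "\<zero>\<^bsub>M\<^esub> \<oplus>\<^bsub>M\<^esub> z (Suc k) \<odot>\<^bsub>M\<^esub> e \<in> seq_sum M z (Suc k)" using z0[of k] k that by auto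
      then show ?thesis using mono[OF k(2) le_refl] that z k by auto
    qed
    then show "q \<in> ?J" using k z by auto
  qed
  ultimately have "Idl (z ` {1..i}) \<subseteq> ?J" by (rule genideal_minimal)
  then have "{q \<odot>\<^bsub>M\<^esub> e |q e. q \<in> seq_ideal R z i \<and> e \<in> carrier M} \<subseteq> seq_sum M z i"
    unfolding seq_ideal_def by blast
  then have 1: "ideal_times_module R (seq_ideal R z i) M \<subseteq> seq_sum M z i"
    unfolding ideal_times_module_def submodule_span_def using S.submodule_axioms by blast
  have "seq_sum M z i \<subseteq> T"
    if T: "submodule T R M" "{q \<odot>\<^bsub>M\<^esub> e |q e. q \<in> seq_ideal R z i \<and> e \<in> carrier M} \<subseteq> T" for T
  proof -
    note TE = M.submoduleE[OF T(1)]
    have "k \<le> i \<Longrightarrow> seq_sum M z k \<subseteq> T" for k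
    proof (induction k)
      case 0
      show ?case using subgroup.one_closed[OF submodule.axioms(1)[OF T(1)]] by simp
    next
      case (Suc k)
      have "z (Suc k) \<in> seq_ideal R z i" unfolding seq_ideal_def using genideal_self[OF zs] Suc.prems by auto
      then have "z (Suc k) \<odot>\<^bsub>M\<^esub> m \<in> T" if "m \<in> carrier M" for m using T(2) that by blast
      then show ?case using Suc TE(5) by auto
    qed
    then show ?thesis by simp
  qed
  then show ?thesis using 1 unfolding ideal_times_module_def submodule_span_def by blast
qed

text \<open>A linear form shifts degrees by one, so the component of q + z m in degree r is that of
  q plus z times the component of m in degree r - 1.\<close>

lemma seq_sum_projection:
  fixes M :: "('a, 'm) graded_module"
  assumes M: "is_graded_module R M" and p: "grading_projections M (mdeg M) p"
    and z: "\<And>k. k \<in> {1..i} \<Longrightarrow> z k \<in> rdeg R 1" and x: "x \<in> seq_sum M z i"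
  shows "p r x \<in> seq_sum M z i"
  using z x
proof (induction i arbitrary: x)
  case 0
  then show ?case
    using abelian_group.gp_zero[OF pregradedD(8)[OF is_graded_module_pregraded[OF M]] p] by simp
next
  case (Suc i)
  interpret M: module R M by (rule pregradedD(1)[OF is_graded_module_pregraded[OF M]])
  obtain q m where x: "x = q \<oplus>\<^bsub>M\<^esub> z (Suc i) \<odot>\<^bsub>M\<^esub> m" "q \<in> seq_sum M z i" "m \<in> carrier M"
    using Suc.prems by auto
  have zs: "z (Suc i) \<in> rdeg R 1" using Suc.prems by simp
  have "submodule (seq_sum M z i) R M" by (rule M.seq_sum_submodule) (use Suc.prems(1) rdeg_carr in force)
  then have qc: "q \<in> carrier M" using M.submoduleE(1) x(2) by blast
  have "p r x = p r q \<oplus>\<^bsub>M\<^esub> z (Suc i) \<odot>\<^bsub>M\<^esub> p (r - 1) m"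
    using smult_projection[OF M p zs x(3), of "r - 1"] x qc rdeg_carr[OF zs] by (simp add: M.M.gp_add[OF p])
  moreover have "p r q \<in> seq_sum M z i" by (rule Suc.IH[OF _ x(2)]) (use Suc.prems in auto)
  ultimately show ?case using M.M.gp_carr[OF p x(3)] by auto
qed

text \<open>Delivers the description of Q' that \<open>cone_stage\<close> asks for: taking
  components, both summands of a homogeneous element can be chosen homogeneous.\<close>

lemma seq_sum_homogeneous:
  fixes M :: "('a, 'm) graded_module"
  assumes M: "is_graded_module R M" and z: "\<And>k. k \<in> {1..Suc i} \<Longrightarrow> z k \<in> rdeg R 1"
  shows "mdeg M r \<inter> seq_sum M z (Suc i) =
    {q \<oplus>\<^bsub>M\<^esub> z (Suc i) \<odot>\<^bsub>M\<^esub> m | q m. q \<in> mdeg M r \<inter> seq_sum M z i \<and> m \<in> mdeg M (r - 1)}"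
    (is "?A = ?B")
proof
  have Mp: "pregraded R M" by (rule is_graded_module_pregraded[OF M])
  interpret M: module R M by (rule pregradedD(1)[OF Mp])
  have zs: "z (Suc i) \<in> rdeg R 1" using z by simp
  obtain p where p: "grading_projections M (mdeg M) p" by (rule graded_module_projections[OF M])
  show "?A \<subseteq> ?B"
  proof
    fix x assume x: "x \<in> ?A"
    then obtain q m where e: "x = q \<oplus>\<^bsub>M\<^esub> z (Suc i) \<odot>\<^bsub>M\<^esub> m" "q \<in> seq_sum M z i" "m \<in> carrier M" by auto
    have "submodule (seq_sum M z i) R M" by (rule M.seq_sum_submodule) (use z rdeg_carr in force)
    then have qc: "q \<in> carrier M" using M.submoduleE(1) e(2) by blast
    have "p r x = p r q \<oplus>\<^bsub>M\<^esub> z (Suc i) \<odot>\<^bsub>M\<^esub> p (r - 1) m"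
      using smult_projection[OF M p zs e(3), of "r - 1"] e qc rdeg_carr[OF zs] by (simp add: M.M.gp_add[OF p])
    moreover have "p r x = x" using M.M.gp_same[OF p] x by blast
    moreover have "p r q \<in> mdeg M r \<inter> seq_sum M z i"
      using M.M.gp_proj[OF p qc] seq_sum_projection[OF M p _ e(2)] z by auto
    ultimately show "x \<in> ?B" using M.M.gp_proj[OF p e(3), of "r - 1"] by auto
  qed
  show "?B \<subseteq> ?A"
  proof
    fix x assume "x \<in> ?B"
    then obtain q m where e: "x = q \<oplus>\<^bsub>M\<^esub> z (Suc i) \<odot>\<^bsub>M\<^esub> m" "q \<in> mdeg M r" "q \<in> seq_sum M z i" "m \<in> mdeg M (r - 1)"
      by auto
    have "z (Suc i) \<odot>\<^bsub>M\<^esub> m \<in> mdeg M r" using pregradedD(7)[OF Mp zs e(4)] by simp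
    then show "x \<in> ?A" using e pregradedD(5)[OF Mp e(2)] pregradedD(9)[OF Mp e(4)] by auto
  qed
qed

text \<open>If z m lies in N, then the union that defines z times the coset of m collapses to N, so
  this coset is annihilated by z and must be zero in large degrees.\<close>

lemma filter_regular_quotD:
  fixes M :: "('a, 'm) graded_module"
  assumes M: "pregraded R M" and N: "submodule N R M" and z: "z \<in> carrier R"
    and f: "filter_regular R (graded_quot M N) z"
  shows "\<exists>r0. \<forall>r\<ge>r0. \<forall>m\<in>mdeg M r. z \<odot>\<^bsub>M\<^esub> m \<in> N \<longrightarrow> m \<in> N"
proof -
  interpret M: module R M by (rule pregradedD(1)[OF M])
  interpret N: submodule N R M by (rule N)
  note NE = M.submoduleE[OF N]
  let ?Q = "graded_quot M N"
  obtain r0 where r0: "\<And>r. r \<ge> r0 \<Longrightarrow>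
      mdeg (graded_sub ?Q {e \<in> carrier ?Q. z \<odot>\<^bsub>?Q\<^esub> e = \<zero>\<^bsub>?Q\<^esub>}) r = {\<zero>\<^bsub>?Q\<^esub>}"
    using f unfolding filter_regular_def by blast
  have "m \<in> N" if r: "r \<ge> r0" and m: "m \<in> mdeg M r" and zm: "z \<odot>\<^bsub>M\<^esub> m \<in> N" for r m
  proof -
    have mc: "m \<in> carrier M" by (rule pregradedD(9)[OF M m])
    let ?C = "N +>\<^bsub>M\<^esub> m"
    have C: "?C = {n \<oplus>\<^bsub>M\<^esub> m | n. n \<in> N}" by (auto simp: a_r_coset_def')
    have "N +>\<^bsub>M\<^esub> (z \<odot>\<^bsub>M\<^esub> x) = N" if x: "x \<in> ?C" for x
    proof -
      obtain n where n: "n \<in> N" "x = n \<oplus>\<^bsub>M\<^esub> m" using x C by blast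
      have nc: "n \<in> carrier M" using n NE(1) by blast
      have "z \<odot>\<^bsub>M\<^esub> x \<in> N" using NE(5)[OF NE(4)[OF z n(1)] zm] n nc mc z by (simp add: M.smult_r_distr)
      then show ?thesis using M.M.coset_eq_iff[OF N.subgroup_axioms] NE(1) by blast
    qed
    moreover have "?C \<noteq> {}" using NE(2) C by auto
    ultimately have "(\<Union>x\<in>?C. N +>\<^bsub>M\<^esub> (z \<odot>\<^bsub>M\<^esub> x)) = N" by auto
    then have "?C \<in> {e \<in> carrier ?Q. z \<odot>\<^bsub>?Q\<^esub> e = \<zero>\<^bsub>?Q\<^esub>}"
      using mc by (auto simp: graded_quot_def A_RCOSETS_def')
    moreover have "?C \<in> mdeg ?Q r" using m by (simp add: graded_quot_def)
    ultimately have "?C \<in> {\<zero>\<^bsub>?Q\<^esub>}" unfolding r0[OF r, symmetric] by (simp add: graded_sub_def)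
    then have "?C = N" by (simp add: graded_quot_def)
    then show ?thesis using M.M.coset_eq_iff[OF N.subgroup_axioms mc] by blast
  qed
  then show ?thesis by blast
qed

section \<open>Local cohomology in terms of homogeneous torsion\<close>

lemma torsion_subgroup:
  fixes U :: "('a, 'u) graded_module"
  assumes U: "pregraded R U"
  shows "subgroup (torsion R (irrelevant_ideal R) U) (add_monoid U)"
proof -
  interpret U: module R U by (rule pregradedD(1)[OF U])
  have Ic: "a \<in> Ipow n \<Longrightarrow> a \<in> carrier R" for a n by (rule ideal.Icarr[OF Ipow_ideal])
  show ?thesis
  proof (rule U.M.add.subgroupI)
    have "\<zero>\<^bsub>U\<^esub> \<in> torsion R (irrelevant_ideal R) U"
      unfolding torsion_def using Ic[of _ 1] by (auto intro!: exI[of _ 1])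
    then show "torsion R (irrelevant_ideal R) U \<noteq> {}" by blast
    fix x assume x: "x \<in> torsion R (irrelevant_ideal R) U"
    then obtain n where n: "\<And>a. a \<in> Ipow n \<Longrightarrow> a \<odot>\<^bsub>U\<^esub> x = \<zero>\<^bsub>U\<^esub>" and xc: "x \<in> carrier U"
      unfolding torsion_def by blast
    have "\<forall>a\<in>Ipow n. a \<odot>\<^bsub>U\<^esub> (\<ominus>\<^bsub>U\<^esub> x) = \<zero>\<^bsub>U\<^esub>" using n Ic xc by (simp add: U.smult_r_minus)
    then show "\<ominus>\<^bsub>U\<^esub> x \<in> torsion R (irrelevant_ideal R) U" unfolding torsion_def using xc by blast
    fix y assume y: "y \<in> torsion R (irrelevant_ideal R) U"
    then obtain m where m: "\<And>a. a \<in> Ipow m \<Longrightarrow> a \<odot>\<^bsub>U\<^esub> y = \<zero>\<^bsub>U\<^esub>" and yc: "y \<in> carrier U"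
      unfolding torsion_def by blast
    have "a \<odot>\<^bsub>U\<^esub> (x \<oplus>\<^bsub>U\<^esub> y) = \<zero>\<^bsub>U\<^esub>" if a: "a \<in> Ipow (max n m)" for a
    proof -
      have "a \<in> Ipow n" "a \<in> Ipow m" using a Ipow_antimono[of n "max n m"] Ipow_antimono[of m "max n m"] by auto
      then show ?thesis using n m Ic[OF a] xc yc by (simp add: U.smult_r_distr)
    qed
    then show "x \<oplus>\<^bsub>U\<^esub> y \<in> torsion R (irrelevant_ideal R) U" unfolding torsion_def using xc yc by blast
  qed (auto simp: torsion_def)
qed

lemma hom_image_subgroup:
  assumes U: "module R U" and V: "module R V" and f: "f \<in> graded_hom R U V"
    and H: "subgroup H (add_monoid U)"
  shows "subgroup (f ` H) (add_monoid V)"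
proof -
  interpret U: module R U by (rule U)
  interpret V: module R V by (rule V)
  note HD = U.M.subgroup_addD[OF H]
  have Hc: "x \<in> H \<Longrightarrow> x \<in> carrier U" for x using HD(1) by blast
  show ?thesis
  proof (rule V.M.add.subgroupI)
    show "f ` H \<subseteq> carrier V" using graded_homD(1)[OF f] Hc by blast
    show "f ` H \<noteq> {}" using HD(2) by blast
    fix x assume "x \<in> f ` H"
    then obtain u where u: "u \<in> H" "x = f u" by blast
    show "\<ominus>\<^bsub>V\<^esub> x \<in> f ` H" using graded_hom_minus[OF f U V Hc[OF u(1)]] HD(4)[OF u(1)] u(2) by (metis imageI)
    fix y assume "y \<in> f ` H"
    then obtain v where v: "v \<in> H" "y = f v" by blast
    show "x \<oplus>\<^bsub>V\<^esub> y \<in> f ` H"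
      using graded_homD(2)[OF f Hc[OF u(1)] Hc[OF v(1)]] HD(3)[OF u(1) v(1)] u(2) v(2) by (metis imageI)
  qed
qed

text \<open>The derived functor is formed with all torsion elements, the cone argument with
  homogeneous ones. They agree in degree r because a torsion preimage of a homogeneous element can
  be replaced by its component of degree r.\<close>

lemma local_cohomology_nonzero_iff:
  fixes M :: "('a, 'm) graded_module" and E :: "nat \<Rightarrow> ('a, 'e) graded_module"
  assumes std: "standard_graded R" and res: "graded_injective_resolution R M \<epsilon> E d"
    and M: "is_graded_module R M"
  shows "mdeg (local_cohomology R E d i) r \<noteq> {\<zero>\<^bsub>local_cohomology R E d i\<^esub>} \<longleftrightarrow>
    tors_coh_nz R (base_complex E) (base_diff E d) (int i) r"
proof -
  note g = res_graded[OF res M]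
  note Epg = is_graded_module_pregraded[OF g]
  note E0 = pregradedD(1)[OF Epg] and dh = res_diff[OF res M]
  let ?T = "\<lambda>k. torsion R (irrelevant_ideal R) (E k)"
  define B where "B = (case i of 0 \<Rightarrow> {\<zero>\<^bsub>E 0\<^esub>} | Suc k \<Rightarrow> d k ` ?T k)"
  define Z where "Z = {e \<in> ?T i. d i e = \<zero>\<^bsub>E (Suc i)\<^esub>}"
  have lc: "local_cohomology R E d i = graded_quot (graded_sub (E i) Z) B"
    unfolding local_cohomology_def B_def Z_def by (simp add: Let_def)
  have aE: "abelian_group (E k)" for k by (rule pregradedD(8)[OF Epg])
  have B: "subgroup B (add_monoid (E i))"
  proof (cases i)
    case 0
    interpret A: abelian_group "E 0" by (rule aE)
    show ?thesis using 0 A.add.triv_subgroup by (simp add: B_def)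
  next
    case (Suc k)
    then show ?thesis using hom_image_subgroup[OF E0 E0 dh torsion_subgroup[OF Epg]] by (simp add: B_def)
  qed
  have Z0: "\<zero>\<^bsub>E i\<^esub> \<in> Z"
    using abelian_group.subgroup_addD(2)[OF aE torsion_subgroup[OF Epg]] graded_hom_zero[OF dh E0 E0]
    by (simp add: Z_def)
  have "mdeg (local_cohomology R E d i) r \<noteq> {\<zero>\<^bsub>local_cohomology R E d i\<^esub>} \<longleftrightarrow>
      (\<exists>x\<in>mdeg (E i) r. x \<in> Z \<and> x \<notin> B)"
    unfolding lc by (rule graded_quot_nonzero_iff[OF aE B pregradedD(3)[OF Epg] pregradedD(4)[OF Epg] Z0])
  also have "\<dots> \<longleftrightarrow> (\<exists>x\<in>htors R (E i) r. d i x = \<zero>\<^bsub>E (Suc i)\<^esub> \<and> x \<notin> B)"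
    using torsion_homogeneous(1)[OF std g, of _ i r] unfolding Z_def htors_def by blast
  also have "\<dots> \<longleftrightarrow> tors_coh_nz R (base_complex E) (base_diff E d) (int i) r"
  proof -
    have b: "base_complex E (int k) = leaf_module (E k)" for k by (simp add: base_complex_def)
    have b1: "base_complex E (int i + 1) = leaf_module (E (Suc i))"
      using b[of "Suc i"] by (simp add: add.commute)
    have bnd: "x \<notin> B \<longleftrightarrow> (\<forall>w\<in>htors R (base_complex E (int i - 1)) r. base_diff E d (int i - 1) w \<noteq> Leaf x)"
      if x: "x \<in> mdeg (E i) r" for x
    proof (cases i)
      case 0
      \<comment> \<open>The zero module in degree -1 yields exactly the boundaries that
        \<open>local_cohomology\<close> prescribes for i = 0.\<close>
      have "htors R (base_complex E (-1)) r = {Leaf \<zero>\<^bsub>E 0\<^esub>}"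
        by (auto simp: htors_def base_complex_def leaf_module_def trivial_module_def)
      then show ?thesis using 0 by (auto simp: B_def base_diff_def)
    next
      case (Suc k)
      have h: "htors R (base_complex E (int k)) r = Leaf ` htors R (E k) r"
        unfolding b by (rule htors_leaf)
      have "(\<exists>w\<in>?T k. d k w = x) \<longleftrightarrow> (\<exists>w\<in>htors R (E k) r. d k w = x)"
      proof
        assume "\<exists>w\<in>?T k. d k w = x"
        then obtain w where w: "w \<in> ?T k" "d k w = x" by blast
        have wc: "w \<in> carrier (E k)" using w unfolding torsion_def by blast
        obtain p where p: "grading_projections (E k) (mdeg (E k)) p" by (rule graded_module_projections[OF g])
        obtain q where q: "grading_projections (E i) (mdeg (E i)) q" by (rule graded_module_projections[OF g])
        have "d k (p r w) = q r x" using hom_projection[OF g g dh p q[unfolded Suc] wc] w(2) by simp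
        also have "\<dots> = x" by (rule abelian_group.gp_same[OF aE q x])
        finally show "\<exists>w\<in>htors R (E k) r. d k w = x" using torsion_homogeneous(2)[OF std g p w(1)] by blast
      next
        assume "\<exists>w\<in>htors R (E k) r. d k w = x"
        then show "\<exists>w\<in>?T k. d k w = x" using torsion_homogeneous(1)[OF std g] unfolding htors_def by blast
      qed
      then show ?thesis using Suc h by (auto simp: B_def base_diff_def)
    qed
    have "(\<exists>x\<in>htors R (E i) r. d i x = \<zero>\<^bsub>E (Suc i)\<^esub> \<and> x \<notin> B) \<longleftrightarrow>
        (\<exists>x\<in>htors R (E i) r. base_diff E d (int i) (Leaf x) = \<zero>\<^bsub>base_complex E (int i + 1)\<^esub> \<and>
          (\<forall>w\<in>htors R (base_complex E (int i - 1)) r. base_diff E d (int i - 1) w \<noteq> Leaf x))"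
      using bnd unfolding b1 by (auto simp: base_diff_def leaf_module_simps htors_def)
    also have "\<dots> \<longleftrightarrow> tors_coh_nz R (base_complex E) (base_diff E d) (int i) r"
      unfolding tors_coh_nz_def b htors_leaf bex_simps ..
    finally show ?thesis .
  qed
  finally show ?thesis .
qed

text \<open>Induction along the sequence from \<open>base_stage\<close> through
  \<open>cone_stage\<close>. The bounds change with i, but later only their existence
  matters.\<close>

lemma koszul_complex_stage:
  fixes M :: "('a, 'm) graded_module" and E :: "nat \<Rightarrow> ('a, 'e) graded_module"
  assumes res: "graded_injective_resolution R M \<epsilon> E d" and M: "is_graded_module R M"
    and z: "\<And>k. k \<in> {1..t} \<Longrightarrow> z k \<in> rdeg R 1" and fr: "filter_regular_seq R M z t"
  shows "i \<le> t \<Longrightarrow> \<exists>e N low. koszul_stage R (fst (koszul_complex z E d i)) (snd (koszul_complex z E d i))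
    M e (\<lambda>r. mdeg M r \<inter> seq_sum M z i) N low"
proof (induction i)
  case 0
  have "(\<lambda>r. mdeg M r \<inter> seq_sum M z 0) = (\<lambda>_. {\<zero>\<^bsub>M\<^esub>})"
    using pregradedD(4)[OF is_graded_module_pregraded[OF M]] by auto
  then show ?case using base_stage[OF res M] by auto
next
  case (Suc i)
  have Mp: "pregraded R M" by (rule is_graded_module_pregraded[OF M])
  interpret M: module R M by (rule pregradedD(1)[OF Mp])
  obtain e N low where st: "koszul_stage R (fst (koszul_complex z E d i)) (snd (koszul_complex z E d i))
    M e (\<lambda>r. mdeg M r \<inter> seq_sum M z i) N low" using Suc by auto
  have zs: "z (Suc i) \<in> rdeg R 1" using z Suc.prems by simp
  have zc: "z k \<in> carrier R" if "k \<in> {1..i}" for k using z[of k] that Suc.prems by auto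
  have N: "ideal_times_module R (seq_ideal R z i) M = seq_sum M z i"
    by (rule ideal_times_seq_sum[OF M.module_axioms zc])
  have "filter_regular R (graded_quot M (seq_sum M z i)) (z (Suc i))"
    using fr Suc.prems unfolding filter_regular_seq_def N[symmetric] by simp
  moreover have "submodule (seq_sum M z i) R M" by (rule M.seq_sum_submodule[OF zc])
  ultimately obtain r0 where r0: "\<And>r m. r \<ge> r0 \<Longrightarrow> m \<in> mdeg M r \<Longrightarrow> z (Suc i) \<odot>\<^bsub>M\<^esub> m \<in> seq_sum M z i \<Longrightarrow>
      m \<in> seq_sum M z i"
    using filter_regular_quotD[OF Mp _ rdeg_carr[OF zs]] by blast
  have "koszul_stage R (fst (koszul_complex z E d (Suc i))) (snd (koszul_complex z E d (Suc i))) M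
    (\<lambda>m. Node (e m) \<zero>\<^bsub>fst (koszul_complex z E d i) 1\<^esub>) (\<lambda>r. mdeg M r \<inter> seq_sum M z (Suc i))
    (max N r0 + 1) (low - 1)"
    unfolding koszul_complex.simps fst_conv snd_conv
  proof (rule cone_stage[OF st zs])
    show "mdeg M r \<inter> seq_sum M z (Suc i) =
        {q \<oplus>\<^bsub>M\<^esub> z (Suc i) \<odot>\<^bsub>M\<^esub> m |q m. q \<in> mdeg M r \<inter> seq_sum M z i \<and> m \<in> mdeg M (r - 1)}" for r
      by (rule seq_sum_homogeneous[OF M]) (use z Suc.prems in auto)
  qed (use r0 in auto)
  then show ?case by blast
qed

text \<open>Annihilation by R_+ modulo Q_i M can be tested on homogeneous elements of positive
  degree, since these generate R_+ additively. The condition obtained is the one in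
  \<open>socle_tors_coh\<close> and \<open>tors_coh_socle\<close>.\<close>

lemma colon_quot_nonzero_iff:
  fixes M :: "('a, 'm) graded_module"
  assumes M: "is_graded_module R M" and z: "\<And>k. k \<in> {1..i} \<Longrightarrow> z k \<in> rdeg R 1"
  shows "mdeg (colon_quot R M z i) r \<noteq> {\<zero>\<^bsub>colon_quot R M z i\<^esub>} \<longleftrightarrow>
    (\<exists>m\<in>mdeg M r. m \<notin> mdeg M r \<inter> seq_sum M z i \<and>
      (\<forall>s\<ge>1. \<forall>a\<in>rdeg R s. a \<odot>\<^bsub>M\<^esub> m \<in> mdeg M (int s + r) \<inter> seq_sum M z i))"
proof -
  have Mp: "pregraded R M" by (rule is_graded_module_pregraded[OF M])
  interpret M: module R M by (rule pregradedD(1)[OF Mp])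
  have zc: "z k \<in> carrier R" if "k \<in> {1..i}" for k using z[OF that] by auto
  have N: "ideal_times_module R (seq_ideal R z i) M = seq_sum M z i"
    by (rule ideal_times_seq_sum[OF M.module_axioms zc])
  let ?N = "seq_sum M z i" and ?S = "colon M (seq_sum M z i) (irrelevant_ideal R)"
  have sub: "submodule ?N R M" by (rule M.seq_sum_submodule[OF zc])
  note NE = M.submoduleE[OF sub]
  have N0: "\<zero>\<^bsub>M\<^esub> \<in> ?N" using subgroup.one_closed[OF submodule.axioms(1)[OF sub]] by simp
  have cq: "colon_quot R M z i = graded_quot (graded_sub M ?S) ?N"
    unfolding colon_quot_def Let_def N ..
  have S0: "\<zero>\<^bsub>M\<^esub> \<in> ?S" using N0 irrelevant_carr by (auto simp: colon_def)
  have nz: "mdeg (colon_quot R M z i) r \<noteq> {\<zero>\<^bsub>colon_quot R M z i\<^esub>} \<longleftrightarrow> (\<exists>m\<in>mdeg M r. m \<in> ?S \<and> m \<notin> ?N)"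
    unfolding cq
    by (rule graded_quot_nonzero_iff[OF pregradedD(8)[OF Mp] submodule.axioms(1)[OF sub]
          pregradedD(3)[OF Mp] pregradedD(4)[OF Mp] S0])
  have soc: "m \<in> ?S \<longleftrightarrow> (\<forall>s\<ge>1. \<forall>a\<in>rdeg R s. a \<odot>\<^bsub>M\<^esub> m \<in> mdeg M (int s + r) \<inter> ?N)" if m: "m \<in> mdeg M r" for m
  proof
    show "m \<in> ?S \<Longrightarrow> \<forall>s\<ge>1. \<forall>a\<in>rdeg R s. a \<odot>\<^bsub>M\<^esub> m \<in> mdeg M (int s + r) \<inter> ?N"
      using irrelevant_hom pregradedD(7)[OF Mp _ m] unfolding colon_def by auto
    assume h: "\<forall>s\<ge>1. \<forall>a\<in>rdeg R s. a \<odot>\<^bsub>M\<^esub> m \<in> mdeg M (int s + r) \<inter> ?N"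
    have mc: "m \<in> carrier M" by (rule pregradedD(9)[OF Mp m])
    have "a \<odot>\<^bsub>M\<^esub> m \<in> ?N" if "a \<in> irrelevant_ideal R" for a
      using that
    proof (induction a rule: irrelevant_induct)
      case (hom n a)
      then show ?case using h by blast
    next
      case (add u v)
      then show ?case using NE(5) mc by (simp add: M.smult_l_distr)
    qed
    then show "m \<in> ?S" using mc unfolding colon_def by blast
  qed
  show ?thesis unfolding nz by (rule bex_cong[OF refl]) (simp only: soc Int_iff, blast)
qed

end

section \<open>Suprema of nonvanishing degrees and the two formulas\<close>

theorem theorem5p5:
  fixes R :: "'a graded_ring"
    and M :: "('a, 'm) graded_module"
    and \<epsilon> :: "'m \<Rightarrow> 'e"
    and E :: "nat \<Rightarrow> ('a, 'e) graded_module"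
    and d :: "nat \<Rightarrow> 'e \<Rightarrow> 'e"
    and z :: "nat \<Rightarrow> 'a"
    and t :: nat
  assumes "graded_cring R"
    and "noetherian_ring (R\<lparr>carrier := rdeg R 0\<rparr>)"
    and "fin_gen_algebra_over_degree_zero R"
    and "standard_graded R"
    and "is_graded_module R M"
    and "fin_gen_module R M"
    and "graded_injective_resolution R M \<epsilon> E d"
    and "\<forall>i\<in>{1..t}. z i \<in> rdeg R 1"
    and "filter_regular_seq R M z t"
  shows "partial_reg R E d t = (MAX i\<in>{0..t}. a_inv_module (colon_quot R M z i)) \<and>
         partial_a_star R E d t =
           (MAX i\<in>{0..t}. a_inv_module (colon_quot R M z i) - ereal (real i))"
proof -
  interpret graded_ring_base R by unfold_locales (rule assms(1))
  have z: "z k \<in> rdeg R 1" if "k \<in> {1..t}" for k using assms(8) that by blast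
  define D where "D = (\<lambda>i. fst (koszul_complex z E d i))"
  define \<delta> where "\<delta> = (\<lambda>i. snd (koszul_complex z E d i))"
  have D_simps: "D 0 = base_complex E" "\<delta> 0 = base_diff E d"
    "D (Suc i) = cone_complex (D i)" "\<delta> (Suc i) = cone_diff (z (Suc i)) (D i) (\<delta> i)" for i
    by (simp_all add: D_def \<delta>_def)
  define nz where "nz = (\<lambda>i j. tors_coh_nz R (D i) (\<delta> i) (int j))"
  \<comment> \<open>As in \<open>a_inv_module\<close>, vanishing cohomology gets the value
    -\<infinity>, so the inequalities below cover this case as well.\<close>
  define h where "h = (\<lambda>i j. Sup {ereal (of_int r) | r. nz i j r})"
  have h_eq: "h i j = Sup {ereal (of_int r) | r. nz i j r}" for i j by (simp add: h_def)
  have stage: "\<exists>e N low. koszul_stage R (D i) (\<delta> i) M e (\<lambda>r. mdeg M r \<inter> seq_sum M z i) N low" if "i \<le> t" for i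
    unfolding D_def \<delta>_def by (rule koszul_complex_stage[OF assms(7,5) z assms(9) that])
  have h_ge: "ereal (of_int r) \<le> h i j" if "nz i j r" for i j r
    unfolding h_def using that by (auto intro!: Sup_upper)
  have ic: "injective_complex R (D i) (\<delta> i)" and zi: "z (Suc i) \<in> rdeg R 1" if "i < t" for i
    using stage[of i] z[of "Suc i"] that koszul_stage.axioms(1) by (auto, blast)
  have lower: "h i (Suc j) + 1 \<le> h (Suc i) j" if i: "i < t" for i j
  proof -
    \<comment> \<open>The 1 is moved to the right so that the bound can be taken over the supremum
      defining h i (Suc j).\<close>
    have "ereal (of_int r) \<le> h (Suc i) j - 1" if "nz i (Suc j) r" for r
    proof -
      have "tors_coh_nz R (D i) (\<delta> i) (int j + 1) r" using that by (simp add: nz_def add.commute)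
      then obtain k where k: "k \<ge> r + 1" "nz (Suc i) j k"
        using tors_coh_cone_lower[OF ic[OF i] zi[OF i]] unfolding nz_def D_simps by blast
      have "ereal (of_int r) + 1 \<le> ereal (of_int k)" using k(1) by (simp add: one_ereal_def)
      also have "\<dots> \<le> h (Suc i) j" by (rule h_ge[OF k(2)])
      finally show ?thesis by (simp add: ereal_le_minus)
    qed
    then have "h i (Suc j) \<le> h (Suc i) j - 1" unfolding h_eq[of i "Suc j"] by (auto intro!: Sup_least)
    then show ?thesis by (simp add: ereal_le_minus)
  qed
  have upper: "h (Suc i) j \<le> max (h i j) (h i (Suc j) + 1)" if i: "i < t" for i j
  proof -
    have "ereal (of_int r) \<le> max (h i j) (h i (Suc j) + 1)" if "nz (Suc i) j r" for r
    proof -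
      have "nz i j r \<or> nz i (Suc j) (r - 1)"
        using tors_coh_cone_upper[OF ic[OF i] zi[OF i], of "int j" r] that
        unfolding nz_def D_simps by (simp add: add.commute)
      then show ?thesis
      proof
        assume "nz i j r"
        then show ?thesis using h_ge by (simp add: le_max_iff_disj)
      next
        assume "nz i (Suc j) (r - 1)"
        then have "ereal (of_int (r - 1)) + 1 \<le> h i (Suc j) + 1" by (intro add_right_mono h_ge)
        moreover have "ereal (of_int (r - 1)) + 1 = ereal (of_int r)" by (simp add: one_ereal_def)
        ultimately show ?thesis by (simp add: le_max_iff_disj)
      qed
    qed
    then show ?thesis unfolding h_eq[of "Suc i" j] by (auto intro!: Sup_least)
  qed
  \<comment> \<open>Row 0 of the table consists of the invariants a_i(M), because stage 0 is the
    resolution itself.\<close>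
  have a_inv_h: "a_inv R E d i = h 0 i" for i
    unfolding a_inv_def a_inv_module_def h_def nz_def D_simps
      local_cohomology_nonzero_iff[OF assms(4,7,5)] ..
  have colon_h: "a_inv_module (colon_quot R M z i) = h i 0" if i: "i \<le> t" for i
  proof -
    obtain e N low where st: "koszul_stage R (D i) (\<delta> i) M e (\<lambda>r. mdeg M r \<inter> seq_sum M z i) N low"
      using stage[OF i] by blast
    define c where "c = (\<lambda>r. mdeg (colon_quot R M z i) r \<noteq> {\<zero>\<^bsub>colon_quot R M z i\<^esub>})"
    have c: "c r \<longleftrightarrow> (\<exists>m\<in>mdeg M r. m \<notin> mdeg M r \<inter> seq_sum M z i \<and>
      (\<forall>s\<ge>1. \<forall>a\<in>rdeg R s. a \<odot>\<^bsub>M\<^esub> m \<in> mdeg M (int s + r) \<inter> seq_sum M z i))" for r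
      unfolding c_def by (rule colon_quot_nonzero_iff[OF assms(5)]) (use z i in auto)
    have "c r \<Longrightarrow> nz i 0 r" for r
      unfolding c nz_def using koszul_stage.socle_tors_coh[OF st] by auto
    moreover have "\<exists>k\<ge>r. c k" if "nz i 0 r" for r
      unfolding c using koszul_stage.tors_coh_socle[OF st] that unfolding nz_def by simp
    \<comment> \<open>The two sets of degrees need not coincide, but every degree with nonzero
      torsion cohomology is at most some socle degree, and socle degrees themselves carry torsion
      cohomology; so the suprema agree.\<close>
    ultimately have "Sup {ereal (of_int r) | r. c r} = h i 0"
      unfolding h_def by (intro antisym Sup_mono) (auto, force)
    then show ?thesis unfolding a_inv_module_def c_def .
  qed
  have m1: "(MAX i\<in>{0..t}. a_inv_module (colon_quot R M z i)) = (MAX i\<in>{0..t}. h i 0)"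
    by (rule arg_cong[of _ _ Max], rule image_cong) (use colon_h in auto)
  have m2: "(MAX i\<in>{0..t}. a_inv_module (colon_quot R M z i) - ereal (real i)) =
      (MAX i\<in>{0..t}. h i 0 - ereal (real i))"
    by (rule arg_cong[of _ _ Max], rule image_cong) (use colon_h in auto)
  show ?thesis
    unfolding partial_reg_def partial_a_star_def a_inv_h m1 m2
    using max_diagonal[of t h, OF lower upper] by blast
qed

end
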